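(* In the setting described in the context (forward SDE with coefficients $\mu,\sigma$, Euler scheme $X=X^\pi$, DBDP1 scheme with independent neural networks $\mathcal U_i(\cdot;\xi)$, $\mathcal Z_i(\cdot;\eta)$), assume that: (i) there is a constant $[f]_L>0$ such that for all $(t_1,x_1,y_1,z_1),(t_2,x_2,y_2,z_2)\in[0,T]\times\mathbb R^d\times\mathbb R\times\mathbb R^d$, $$|f(t_2,x_2,y_2,z_2)-f(t_1,x_1,y_1,z_1)|\le [f]_L\big(|t_2-t_1|^{1/2}+|x_2-x_1|+|y_2-y_1|+|z_2-z_1|\big),$$ and $\sup_{0\le t\le T}|f(t,0,0,0)|<\infty$; (ii) $g$ satisfies a linear growth condition. Then there exists a constant $C>0$, independent of $\pi$, such that (for $|\pi|$ small enough) $$\max_{i=0,\dots,N-1}\mathbb E\big|Y_{t_i}-\widehat{\mathcal U}_i^{(1)}(X_{t_i})\big|^2+\mathbb E\Big[\sum_{i=0}^{N-1}\int_{t_i}^{t_{i+1}}\big|Z_t-\widehat{\mathcal Z}_i^{(1)}(X_{t_i})\big|^2dt\Big]$$ $$\le C\Big(\mathbb E\big|g(\mathcal X_T)-g(X_T)\big|^2+|\pi|+\varepsilon^Z(\pi)+\sum_{i=0}^{N-1}\big(N\varepsilon_i^{\mathcal N,v}+\varepsilon_i^{\mathcal N,z}\big)\Big).$$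
   Context: **Forward process and BSDE.** Let $T>0$, $d\ge1$, $x_0\in\mathbb R^d$, and let $W$ be a $d$-dimensional Brownian motion on a probability space $(\Omega,\mathcal F,\mathbb P)$ with filtration $\mathbb F=(\mathcal F_t)_{0\le t\le T}$ satisfying the usual conditions. Let $\mu:[0,T]\times\mathbb R^d\to\mathbb R^d$, $\sigma:[0,T]\times\mathbb R^d\to\mathbb R^{d\times d}$ satisfy the standard Lipschitz conditions, so that the SDE $$\mathcal X_t=x_0+\int_0^t\mu(s,\mathcal X_s)ds+\int_0^t\sigma(s,\mathcal X_s)dW_s,\quad 0\le t\le T,$$ has a unique adapted solution, with $\mathbb E[\sup_{0\le t\le T}|\mathcal X_t|^p]\le C_p(1+|x_0|^p)$ for all $p>1$, and so that the Euler error estimate below holds. Given $f:[0,T]\times\mathbb R^d\times\mathbb R\times\mathbb R^d\to\mathbb R$ and $g:\mathbb R^d\to\mathbb R$, $(Y,Z)$ is the unique adapted $\mathbb R\times\mathbb R^d$-valued solution, with $\mathbb E[\sup_{0\le t\le T}|Y_t|^2+\int_0^T|Z_t|^2dt]<\infty$, of the BSDE $$Y_t=g(\mathcal X_T)+\int_t^Tf(s,\mathcal X_s,Y_s,Z_s)ds-\int_t^TZ_s^{\top}dW_s,\quad 0\le t\le T.$$ **Time grid and Euler scheme.** $\pi=\{0=t_0<t_1<\dots<t_N=T\}$, $\Delta t_i=t_{i+1}-t_i$, $|\pi|=\max_i\Delta t_i$, $\Delta W_{t_i}=W_{t_{i+1}}-W_{t_i}$; grids are such that $N|\pi|$ is bounded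 by a constant depending only on $T$. The Euler scheme is $X_0=x_0$, $X_{t_{i+1}}=X_{t_i}+\mu(t_i,X_{t_i})\Delta t_i+\sigma(t_i,X_{t_i})\Delta W_{t_i}$, $i=0,\dots,N-1$, and $X_T:=X_{t_N}$. The Euler estimate is $\max_{i}\mathbb E[|\mathcal X_{t_{i+1}}-X_{t_{i+1}}|^2+\sup_{t\in[t_i,t_{i+1}]}|\mathcal X_t-X_{t_i}|^2]=O(|\pi|)$ as $|\pi|\to0$. $\mathbb E_i$ denotes conditional expectation given $\mathcal F_{t_i}$. **Regularity of $Z$.** $$\varepsilon^Z(\pi):=\mathbb E\Big[\sum_{i=0}^{N-1}\int_{t_i}^{t_{i+1}}|Z_t-\bar Z_{t_i}|^2dt\Big],\qquad \bar Z_{t_i}:=\frac1{\Delta t_i}\mathbb E_i\Big[\int_{t_i}^{t_{i+1}}Z_tdt\Big].$$ **Neural networks.** For a nonlinear activation function $\varrho:\mathbb R\to\mathbb R$ (applied componentwise), $L\ge2$, $m\ge1$ and output dimension $d_1$, a feedforward network is a function $x\in\mathbb R^d\mapsto A_L\circ\varrho\circ A_{L-1}\circ\dots\circ\varrho\circ A_1(x)\in\mathbb R^{d_1}$ with affine maps $A_\ell(x)=\mathcal W_\ell x+\beta_\ell$, $A_1:\mathbb R^d\to\mathbb R^m$, $A_\ell:\mathbb R^m\to\mathbb R^m$ for $2\le\ell\le L-1$, $A_L:\mathbb R^m\to\mathbb R^{d_1}$. Its parameter is the collection of all weights $\mathcal W_\ell$ and biases $\beta_\ell$. The structure ($\varrho,L,m$)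 is fixed; parameters are unconstrained, i.e. vary in the whole Euclidean parameter space. $\mathcal U_i(\cdot;\xi)$ denotes such a network with $d_1=1$ and $\mathcal Z_i(\cdot;\eta)$ one with $d_1=d$; the two networks are independent in the sense that the total parameter is $\theta=(\xi,\eta)$ with $\xi$ and $\eta$ varying separately. **DBDP1 scheme.** Let $F(t,x,y,z,h,\Delta):=y-f(t,x,y,z)h+z^{\top}\Delta$. Set $\widehat{\mathcal U}_N^{(1)}=g$. For $i=N-1,\dots,0$, given $\widehat{\mathcal U}_{i+1}^{(1)}$, let $\theta_i^*=(\xi_i^*,\eta_i^* )$ be a minimizer (over all $\theta=(\xi,\eta)$) of $$\hat L_i^{(1)}(\theta)=\mathbb E\Big|\widehat{\mathcal U}_{i+1}^{(1)}(X_{t_{i+1}})-F\big(t_i,X_{t_i},\mathcal U_i(X_{t_i};\xi),\mathcal Z_i(X_{t_i};\eta),\Delta t_i,\Delta W_{t_i}\big)\Big|^2,$$ and set $\widehat{\mathcal U}_i^{(1)}=\mathcal U_i(\cdot;\xi_i^* )$, $\widehat{\mathcal Z}_i^{(1)}=\mathcal Z_i(\cdot;\eta_i^* )$. **Network approximation errors.** For $i=0,\dots,N-1$ define (implicitly, for $|\pi|$ small enough, by a fixed point argument) $$\widehat{\mathcal V}_{t_i}=\mathbb E_i\big[\widehat{\mathcal U}_{i+1}^{(1)}(X_{t_{i+1}})\big]+f\big(t_i,X_{t_i},\widehat{\mathcal V}_{t_i},\overline{\widehat Z}_{t_i}\big)\Delta t_i,\qquad \overline{\widehat Z}_{t_i}=\frac1{\Delta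 t_i}\mathbb E_i\big[\widehat{\mathcal U}_{i+1}^{(1)}(X_{t_{i+1}})\Delta W_{t_i}\big].$$ By the Markov property, $\widehat{\mathcal V}_{t_i}=\hat v_i(X_{t_i})$ and $\overline{\widehat Z}_{t_i}=\overline{\hat z}_i(X_{t_i})$ for deterministic functions $\hat v_i,\overline{\hat z}_i$. Set $$\varepsilon_i^{\mathcal N,v}:=\inf_\xi\mathbb E\big|\hat v_i(X_{t_i})-\mathcal U_i(X_{t_i};\xi)\big|^2,\qquad \varepsilon_i^{\mathcal N,z}:=\inf_\eta\mathbb E\big|\overline{\hat z}_i(X_{t_i})-\mathcal Z_i(X_{t_i};\eta)\big|^2.$$ *)

theory Defs
  imports "HOL-Probability.Probability"
begin

section \<open>Filtered probability space and Brownian motion\<close>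

text \<open>
  Time is the interval \<open>{0..T}\<close> inside \<open>real\<close>; the values of filtrations and processes at other
  times are irrelevant. \<open>\<real>\<^sup>d\<close> is \<open>real ^ 'd\<close> for an arbitrary finite type \<open>'d\<close>. Expectations of
  nonnegative quantities are \<open>nn_integral\<close>s with values in \<open>[0,\<infinity>]\<close>, so that a quantity that is not
  integrable has expectation \<open>\<infinity>\<close>, and not \<open>0\<close> as for the Bochner integral.
\<close>

definition usual_filtration :: "real \<Rightarrow> 'a measure \<Rightarrow> (real \<Rightarrow> 'a measure) \<Rightarrow> bool" where
  "usual_filtration T M F \<longleftrightarrow>
     (\<forall>t\<in>{0..T}. subalgebra M (F t)) \<and>
     (\<forall>s t. 0 \<le> s \<and> s \<le> t \<and> t \<le> T \<longrightarrow> sets (F s) \<subseteq> sets (F t)) \<and>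
     (\<forall>t\<in>{0..<T}. (\<Inter>s\<in>{t<..T}. sets (F s)) = sets (F t)) \<and>
     complete_measure M \<and> null_sets M \<subseteq> sets (F 0)"

definition adapted :: "real \<Rightarrow> (real \<Rightarrow> 'a measure) \<Rightarrow> (real \<Rightarrow> 'a \<Rightarrow> 'b::topological_space) \<Rightarrow> bool" where
  "adapted T F H \<longleftrightarrow> (\<forall>t\<in>{0..T}. H t \<in> borel_measurable (F t))"

definition progressive :: "real \<Rightarrow> (real \<Rightarrow> 'a measure) \<Rightarrow> (real \<Rightarrow> 'a \<Rightarrow> 'b::topological_space) \<Rightarrow> bool" where
  "progressive T F H \<longleftrightarrow>
     (\<forall>t\<in>{0..T}. (\<lambda>(s, \<omega>). H s \<omega>) \<in> borel_measurable (restrict_space borel {0..t} \<Otimes>\<^sub>M F t))"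

definition continuous_paths :: "real \<Rightarrow> 'a measure \<Rightarrow> (real \<Rightarrow> 'a \<Rightarrow> 'b::topological_space) \<Rightarrow> bool" where
  "continuous_paths T M H \<longleftrightarrow> (AE \<omega> in M. continuous_on {0..T} (\<lambda>t. H t \<omega>))"

definition brownian_motion ::
  "real \<Rightarrow> 'a measure \<Rightarrow> (real \<Rightarrow> 'a measure) \<Rightarrow> (real \<Rightarrow> 'a \<Rightarrow> real ^ 'd) \<Rightarrow> bool" where
  "brownian_motion T M F W \<longleftrightarrow>
     adapted T F W \<and> continuous_paths T M W \<and> (AE \<omega> in M. W 0 \<omega> = 0) \<and>
     (\<forall>s t. 0 \<le> s \<and> s < t \<and> t \<le> T \<longrightarrow>
        prob_space.indep_set M (sets (F s))
          (sets (vimage_algebra (space M) (\<lambda>\<omega>. W t \<omega> - W s \<omega>) borel)) \<and>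
        distributed M lborel (\<lambda>\<omega>. W t \<omega> - W s \<omega>)
          (\<lambda>x. ennreal (\<Prod>j\<in>UNIV. normal_density 0 (sqrt (t - s)) (x $ j))))"


section \<open>It\^o integral\<close>

text \<open>
  The It\^o integral of square-integrable progressive integrands, as the \<open>L\<^sup>2\<close> limit of the elementary
  integrals of bounded simple processes \<open>\<Sum>k<n. \<xi>\<^sub>k 1\<^bsub>(s\<^sub>k, s\<^sub>k\<^sub>+\<^sub>1]\<^esub>\<close>. The integral is determined almost
  surely only, hence the relational form.
\<close>

definition simple_integrand ::
  "(real \<Rightarrow> 'a measure) \<Rightarrow> real \<Rightarrow> real \<Rightarrow> nat \<Rightarrow> (nat \<Rightarrow> real) \<Rightarrow> (nat \<Rightarrow> 'a \<Rightarrow> real ^ 'd) \<Rightarrow> bool" where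
  "simple_integrand F a b n s \<xi> \<longleftrightarrow>
     s 0 = a \<and> s n = b \<and> (\<forall>k<n. s k < s (Suc k)) \<and>
     (\<forall>k<n. \<xi> k \<in> borel_measurable (F (s k)) \<and> (\<exists>B. \<forall>\<omega>\<in>space (F (s k)). norm (\<xi> k \<omega>) \<le> B))"

definition simple_process ::
  "nat \<Rightarrow> (nat \<Rightarrow> real) \<Rightarrow> (nat \<Rightarrow> 'a \<Rightarrow> real ^ 'd) \<Rightarrow> real \<Rightarrow> 'a \<Rightarrow> real ^ 'd" where
  "simple_process n s \<xi> u \<omega> = (\<Sum>k<n. indicator {s k<..s (Suc k)} u *\<^sub>R \<xi> k \<omega>)"

definition simple_ito ::
  "(real \<Rightarrow> 'a \<Rightarrow> real ^ 'd) \<Rightarrow> nat \<Rightarrow> (nat \<Rightarrow> real) \<Rightarrow> (nat \<Rightarrow> 'a \<Rightarrow> real ^ 'd) \<Rightarrow> 'a \<Rightarrow> real" where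
  "simple_ito W n s \<xi> \<omega> = (\<Sum>k<n. \<xi> k \<omega> \<bullet> (W (s (Suc k)) \<omega> - W (s k) \<omega>))"

definition has_ito_integral ::
  "'a measure \<Rightarrow> (real \<Rightarrow> 'a measure) \<Rightarrow> (real \<Rightarrow> 'a \<Rightarrow> real ^ 'd) \<Rightarrow> real \<Rightarrow> real \<Rightarrow>
   (real \<Rightarrow> 'a \<Rightarrow> real ^ 'd) \<Rightarrow> ('a \<Rightarrow> real) \<Rightarrow> bool" where
  "has_ito_integral M F W a b H I \<longleftrightarrow>
     progressive b F H \<and> I \<in> borel_measurable M \<and>
     (\<exists>n s \<xi>.
        (\<forall>k. simple_integrand F a b (n k) (s k) (\<xi> k)) \<and>
        (\<lambda>k. \<integral>\<^sup>+\<omega>. (\<integral>\<^sup>+u\<in>{a..b}. ennreal ((norm (simple_process (n k) (s k) (\<xi> k) u \<omega> - H u \<omega>))\<^sup>2) \<partial>lborel) \<partial>M)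
          \<longlonglongrightarrow> 0 \<and>
        (\<lambda>k. \<integral>\<^sup>+\<omega>. ennreal ((simple_ito W (n k) (s k) (\<xi> k) \<omega> - I \<omega>)\<^sup>2) \<partial>M) \<longlonglongrightarrow> 0)"


section \<open>Forward SDE and BSDE\<close>

definition lipschitz_coefficients ::
  "real \<Rightarrow> (real \<Rightarrow> real ^ 'd \<Rightarrow> real ^ 'd) \<Rightarrow> (real \<Rightarrow> real ^ 'd \<Rightarrow> real ^ 'd ^ 'd) \<Rightarrow> bool" where
  "lipschitz_coefficients T \<mu> \<sigma> \<longleftrightarrow>
     (\<lambda>(t, x). \<mu> t x) \<in> borel_measurable (restrict_space borel {0..T} \<Otimes>\<^sub>M borel) \<and>
     (\<lambda>(t, x). \<sigma> t x) \<in> borel_measurable (restrict_space borel {0..T} \<Otimes>\<^sub>M borel) \<and>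
     (\<exists>K. \<forall>t\<in>{0..T}. \<forall>x y. norm (\<mu> t x - \<mu> t y) + norm (\<sigma> t x - \<sigma> t y) \<le> K * norm (x - y)) \<and>
     (\<exists>K. \<forall>t\<in>{0..T}. \<forall>x. norm (\<mu> t x) + norm (\<sigma> t x) \<le> K * (1 + norm x))"

text \<open>Component \<open>j\<close> of \<open>\<integral> \<sigma> dW\<close> is the integral of row \<open>j\<close> of \<open>\<sigma>\<close>. Each equation is required almost
  surely at each fixed time; as the solutions have almost surely continuous paths, this amounts to
  the equation almost surely at all times.\<close>

definition sde_solution ::
  "real \<Rightarrow> 'a measure \<Rightarrow> (real \<Rightarrow> 'a measure) \<Rightarrow> (real \<Rightarrow> 'a \<Rightarrow> real ^ 'd) \<Rightarrow> real ^ 'd \<Rightarrow>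
   (real \<Rightarrow> real ^ 'd \<Rightarrow> real ^ 'd) \<Rightarrow> (real \<Rightarrow> real ^ 'd \<Rightarrow> real ^ 'd ^ 'd) \<Rightarrow>
   (real \<Rightarrow> 'a \<Rightarrow> real ^ 'd) \<Rightarrow> bool" where
  "sde_solution T M F W x0 \<mu> \<sigma> \<X> \<longleftrightarrow>
     progressive T F \<X> \<and> continuous_paths T M \<X> \<and>
     (\<forall>t\<in>{0..T}. \<forall>j.
        has_ito_integral M F W 0 t (\<lambda>s \<omega>. \<sigma> s (\<X> s \<omega>) $ j)
          (\<lambda>\<omega>. (\<X> t \<omega> - x0 - (LINT s:{0..t}|lborel. \<mu> s (\<X> s \<omega>))) $ j))"

definition moment_bounds :: "real \<Rightarrow> 'a measure \<Rightarrow> real ^ 'd \<Rightarrow> (real \<Rightarrow> 'a \<Rightarrow> real ^ 'd) \<Rightarrow> bool" where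
  "moment_bounds T M x0 \<X> \<longleftrightarrow>
     (\<forall>p>1. \<exists>C. (\<integral>\<^sup>+\<omega>. (\<Squnion>t\<in>{0..T}. ennreal (norm (\<X> t \<omega>) powr p)) \<partial>M)
                  \<le> ennreal (C * (1 + norm x0 powr p)))"

definition bsde_solution ::
  "real \<Rightarrow> 'a measure \<Rightarrow> (real \<Rightarrow> 'a measure) \<Rightarrow> (real \<Rightarrow> 'a \<Rightarrow> real ^ 'd) \<Rightarrow>
   (real \<Rightarrow> real ^ 'd \<Rightarrow> real \<Rightarrow> real ^ 'd \<Rightarrow> real) \<Rightarrow> (real ^ 'd \<Rightarrow> real) \<Rightarrow>
   (real \<Rightarrow> 'a \<Rightarrow> real ^ 'd) \<Rightarrow> (real \<Rightarrow> 'a \<Rightarrow> real) \<Rightarrow> (real \<Rightarrow> 'a \<Rightarrow> real ^ 'd) \<Rightarrow> bool" where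
  "bsde_solution T M F W f g \<X> Y Z \<longleftrightarrow>
     progressive T F Y \<and> continuous_paths T M Y \<and> progressive T F Z \<and>
     (\<integral>\<^sup>+\<omega>. (\<Squnion>t\<in>{0..T}. ennreal (\<bar>Y t \<omega>\<bar>\<^sup>2)) + (\<integral>\<^sup>+t\<in>{0..T}. ennreal ((norm (Z t \<omega>))\<^sup>2) \<partial>lborel) \<partial>M) < \<infinity> \<and>
     (\<forall>t\<in>{0..T}.
        has_ito_integral M F W t T Z
          (\<lambda>\<omega>. g (\<X> T \<omega>) + (LINT s:{t..T}|lborel. f s (\<X> s \<omega>) (Y s \<omega>) (Z s \<omega>)) - Y t \<omega>))"


section \<open>Time grids and Euler scheme\<close>

definition mesh :: "nat \<Rightarrow> (nat \<Rightarrow> real) \<Rightarrow> real" where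
  "mesh N t = (MAX i\<in>{..<N}. t (Suc i) - t i)"

text \<open>\<open>c\<close> is the bound for \<open>N |\<pi>|\<close> common to all grids under consideration.\<close>

definition time_grid :: "real \<Rightarrow> real \<Rightarrow> nat \<Rightarrow> (nat \<Rightarrow> real) \<Rightarrow> bool" where
  "time_grid T c N t \<longleftrightarrow>
     t 0 = 0 \<and> t N = T \<and> (\<forall>i<N. t i < t (Suc i)) \<and> real N * mesh N t \<le> c"

primrec euler ::
  "(real \<Rightarrow> real ^ 'd \<Rightarrow> real ^ 'd) \<Rightarrow> (real \<Rightarrow> real ^ 'd \<Rightarrow> real ^ 'd ^ 'd) \<Rightarrow> real ^ 'd \<Rightarrow>
   (real \<Rightarrow> 'a \<Rightarrow> real ^ 'd) \<Rightarrow> (nat \<Rightarrow> real) \<Rightarrow> nat \<Rightarrow> 'a \<Rightarrow> real ^ 'd" where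
  "euler \<mu> \<sigma> x0 W t 0 \<omega> = x0"
| "euler \<mu> \<sigma> x0 W t (Suc i) \<omega> =
     (let x = euler \<mu> \<sigma> x0 W t i \<omega>
      in x + (t (Suc i) - t i) *\<^sub>R \<mu> (t i) x + \<sigma> (t i) x *v (W (t (Suc i)) \<omega> - W (t i) \<omega>))"

definition euler_estimate ::
  "real \<Rightarrow> real \<Rightarrow> 'a measure \<Rightarrow> (real \<Rightarrow> 'a \<Rightarrow> real ^ 'd) \<Rightarrow> real ^ 'd \<Rightarrow>
   (real \<Rightarrow> real ^ 'd \<Rightarrow> real ^ 'd) \<Rightarrow> (real \<Rightarrow> real ^ 'd \<Rightarrow> real ^ 'd ^ 'd) \<Rightarrow>
   (real \<Rightarrow> 'a \<Rightarrow> real ^ 'd) \<Rightarrow> bool" where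
  "euler_estimate T c M W x0 \<mu> \<sigma> \<X> \<longleftrightarrow>
     (\<exists>K. \<exists>\<delta>>0. \<forall>N t. time_grid T c N t \<and> mesh N t \<le> \<delta> \<longrightarrow>
        (MAX i\<in>{..<N}. \<integral>\<^sup>+\<omega>.
             ennreal ((norm (\<X> (t (Suc i)) \<omega> - euler \<mu> \<sigma> x0 W t (Suc i) \<omega>))\<^sup>2)
           + (\<Squnion>s\<in>{t i..t (Suc i)}. ennreal ((norm (\<X> s \<omega> - euler \<mu> \<sigma> x0 W t i \<omega>))\<^sup>2)) \<partial>M)
        \<le> ennreal (K * mesh N t))"


section \<open>Regularity of \<open>Z\<close>\<close>

definition vec_cond_exp :: "'a measure \<Rightarrow> 'a measure \<Rightarrow> ('a \<Rightarrow> real ^ 'd) \<Rightarrow> 'a \<Rightarrow> real ^ 'd" where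
  "vec_cond_exp M G V \<omega> = (\<chi> j. real_cond_exp M G (\<lambda>\<omega>'. V \<omega>' $ j) \<omega>)"

definition Z_bar ::
  "'a measure \<Rightarrow> (real \<Rightarrow> 'a measure) \<Rightarrow> (real \<Rightarrow> 'a \<Rightarrow> real ^ 'd) \<Rightarrow> (nat \<Rightarrow> real) \<Rightarrow> nat \<Rightarrow> 'a \<Rightarrow> real ^ 'd" where
  "Z_bar M F Z t i \<omega> =
     (1 / (t (Suc i) - t i)) *\<^sub>R
       vec_cond_exp M (F (t i)) (\<lambda>\<omega>'. LINT s:{t i..t (Suc i)}|lborel. Z s \<omega>') \<omega>"

definition eps_Z ::
  "'a measure \<Rightarrow> (real \<Rightarrow> 'a measure) \<Rightarrow> (real \<Rightarrow> 'a \<Rightarrow> real ^ 'd) \<Rightarrow> nat \<Rightarrow> (nat \<Rightarrow> real) \<Rightarrow> ennreal" where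
  "eps_Z M F Z N t =
     (\<integral>\<^sup>+\<omega>. (\<Sum>i<N. \<integral>\<^sup>+s\<in>{t i..t (Suc i)}. ennreal ((norm (Z s \<omega> - Z_bar M F Z t i \<omega>))\<^sup>2) \<partial>lborel) \<partial>M)"


section \<open>Neural networks\<close>

text \<open>
  The parameter of a network with \<open>L\<close> layers, width \<open>CARD('m)\<close>, input dimension \<open>CARD('d)\<close> and output
  dimension \<open>CARD('o)\<close> consists of the affine maps \<open>A\<^sub>1\<close>, \<open>[A\<^sub>2, \<dots>, A\<^bsub>L-1\<^esub>]\<close> and \<open>A\<^sub>L\<close>, each given by its
  weight matrix and its bias.
\<close>

type_synonym ('d, 'm, 'o) net_param =
  "(((real, 'd) vec, 'm) vec \<times> (real, 'm) vec) \<times>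
   (((real, 'm) vec, 'm) vec \<times> (real, 'm) vec) list \<times>
   (((real, 'm) vec, 'o) vec \<times> (real, 'o) vec)"

definition net_params :: "nat \<Rightarrow> ('d::finite, 'm::finite, 'o::finite) net_param set" where
  "net_params L = {(A1, As, AL). length As = L - 2}"

definition affine_map :: "(real ^ 'n ^ 'k) \<times> (real ^ 'k) \<Rightarrow> real ^ 'n \<Rightarrow> real ^ 'k" where
  "affine_map A x = fst A *v x + snd A"

definition activate :: "(real \<Rightarrow> real) \<Rightarrow> real ^ 'n \<Rightarrow> real ^ 'n" where
  "activate \<rho> x = (\<chi> i. \<rho> (x $ i))"

fun network ::
  "(real \<Rightarrow> real) \<Rightarrow> ('d::finite, 'm::finite, 'o::finite) net_param \<Rightarrow> real ^ 'd \<Rightarrow> real ^ 'o" where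
  "network \<rho> (A1, As, AL) x =
     affine_map AL (activate \<rho> (fold (\<lambda>A y. affine_map A (activate \<rho> y)) As (affine_map A1 x)))"

definition net_U :: "(real \<Rightarrow> real) \<Rightarrow> ('d::finite, 'm::finite, 1) net_param \<Rightarrow> real ^ 'd \<Rightarrow> real" where
  "net_U \<rho> \<xi> x = network \<rho> \<xi> x $ 1"

definition net_Z :: "(real \<Rightarrow> real) \<Rightarrow> ('d::finite, 'm::finite, 'd) net_param \<Rightarrow> real ^ 'd \<Rightarrow> real ^ 'd" where
  "net_Z \<rho> \<eta> x = network \<rho> \<eta> x"


section \<open>The DBDP1 scheme\<close>

definition F_gen ::
  "(real \<Rightarrow> real ^ 'd \<Rightarrow> real \<Rightarrow> real ^ 'd \<Rightarrow> real) \<Rightarrow>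
   real \<Rightarrow> real ^ 'd \<Rightarrow> real \<Rightarrow> real ^ 'd \<Rightarrow> real \<Rightarrow> real ^ 'd \<Rightarrow> real" where
  "F_gen f t x y z h \<Delta> = y - f t x y z * h + z \<bullet> \<Delta>"

definition U_hat ::
  "(real \<Rightarrow> real) \<Rightarrow> (real ^ 'd \<Rightarrow> real) \<Rightarrow> nat \<Rightarrow> (nat \<Rightarrow> ('d::finite, 'm::finite, 1) net_param) \<Rightarrow>
   nat \<Rightarrow> real ^ 'd \<Rightarrow> real" where
  "U_hat \<rho> g N \<xi> i = (if i = N then g else net_U \<rho> (\<xi> i))"

definition dbdp1_loss ::
  "'a measure \<Rightarrow> (real \<Rightarrow> 'a \<Rightarrow> real ^ 'd) \<Rightarrow> (real \<Rightarrow> real ^ 'd \<Rightarrow> real \<Rightarrow> real ^ 'd \<Rightarrow> real) \<Rightarrow>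
   (real \<Rightarrow> real) \<Rightarrow> (nat \<Rightarrow> real) \<Rightarrow> (nat \<Rightarrow> 'a \<Rightarrow> real ^ 'd) \<Rightarrow> (real ^ 'd \<Rightarrow> real) \<Rightarrow> nat \<Rightarrow>
   ('d::finite, 'm::finite, 1) net_param \<times> ('d, 'm, 'd) net_param \<Rightarrow> ennreal" where
  "dbdp1_loss M W f \<rho> t X u i = (\<lambda>(\<xi>, \<eta>).
     \<integral>\<^sup>+\<omega>. ennreal (\<bar>u (X (Suc i) \<omega>)
              - F_gen f (t i) (X i \<omega>) (net_U \<rho> \<xi> (X i \<omega>)) (net_Z \<rho> \<eta> (X i \<omega>))
                  (t (Suc i) - t i) (W (t (Suc i)) \<omega> - W (t i) \<omega>)\<bar>\<^sup>2) \<partial>M)"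

definition dbdp1_scheme ::
  "'a measure \<Rightarrow> (real \<Rightarrow> 'a \<Rightarrow> real ^ 'd) \<Rightarrow> (real \<Rightarrow> real ^ 'd \<Rightarrow> real \<Rightarrow> real ^ 'd \<Rightarrow> real) \<Rightarrow>
   (real ^ 'd \<Rightarrow> real) \<Rightarrow> (real \<Rightarrow> real) \<Rightarrow> nat \<Rightarrow> nat \<Rightarrow> (nat \<Rightarrow> real) \<Rightarrow> (nat \<Rightarrow> 'a \<Rightarrow> real ^ 'd) \<Rightarrow>
   (nat \<Rightarrow> ('d::finite, 'm::finite, 1) net_param) \<Rightarrow> (nat \<Rightarrow> ('d, 'm, 'd) net_param) \<Rightarrow> bool" where
  "dbdp1_scheme M W f g \<rho> L N t X \<xi> \<eta> \<longleftrightarrow>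
     (\<forall>i<N. is_arg_min (dbdp1_loss M W f \<rho> t X (U_hat \<rho> g N \<xi> (Suc i)) i)
              (\<lambda>\<theta>. \<theta> \<in> net_params L \<times> net_params L) (\<xi> i, \<eta> i))"


section \<open>Network approximation errors\<close>

definition Z_hat_bar ::
  "'a measure \<Rightarrow> (real \<Rightarrow> 'a measure) \<Rightarrow> (real \<Rightarrow> 'a \<Rightarrow> real ^ 'd) \<Rightarrow> (nat \<Rightarrow> real) \<Rightarrow>
   (nat \<Rightarrow> 'a \<Rightarrow> real ^ 'd) \<Rightarrow> (real ^ 'd \<Rightarrow> real) \<Rightarrow> nat \<Rightarrow> 'a \<Rightarrow> real ^ 'd" where
  "Z_hat_bar M F W t X u i \<omega> =
     (1 / (t (Suc i) - t i)) *\<^sub>R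
       vec_cond_exp M (F (t i)) (\<lambda>\<omega>'. u (X (Suc i) \<omega>') *\<^sub>R (W (t (Suc i)) \<omega>' - W (t i) \<omega>')) \<omega>"

text \<open>
  \<open>v i\<close> and \<open>z i\<close> are the deterministic functions with \<open>v i (X i) = V_hat\<close> and \<open>z i (X i) = Z_hat_bar\<close>
  almost surely, where \<open>V_hat\<close> is the solution of the implicit equation at time \<open>t i\<close>. They are
  determined up to null sets of the law of \<open>X i\<close> when the mesh is small.
\<close>

definition dbdp1_targets ::
  "'a measure \<Rightarrow> (real \<Rightarrow> 'a measure) \<Rightarrow> (real \<Rightarrow> 'a \<Rightarrow> real ^ 'd) \<Rightarrow>
   (real \<Rightarrow> real ^ 'd \<Rightarrow> real \<Rightarrow> real ^ 'd \<Rightarrow> real) \<Rightarrow> nat \<Rightarrow> (nat \<Rightarrow> real) \<Rightarrow> (nat \<Rightarrow> 'a \<Rightarrow> real ^ 'd) \<Rightarrow>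
   (nat \<Rightarrow> real ^ 'd \<Rightarrow> real) \<Rightarrow> (nat \<Rightarrow> real ^ 'd \<Rightarrow> real) \<Rightarrow> (nat \<Rightarrow> real ^ 'd \<Rightarrow> real ^ 'd) \<Rightarrow> bool" where
  "dbdp1_targets M F W f N t X u v z \<longleftrightarrow>
     (\<forall>i<N. v i \<in> borel_measurable borel \<and> z i \<in> borel_measurable borel \<and>
        (AE \<omega> in M. z i (X i \<omega>) = Z_hat_bar M F W t X (u (Suc i)) i \<omega>) \<and>
        (AE \<omega> in M. v i (X i \<omega>) =
           real_cond_exp M (F (t i)) (\<lambda>\<omega>'. u (Suc i) (X (Suc i) \<omega>')) \<omega>
           + f (t i) (X i \<omega>) (v i (X i \<omega>)) (Z_hat_bar M F W t X (u (Suc i)) i \<omega>) * (t (Suc i) - t i)))"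

definition eps_v ::
  "'a measure \<Rightarrow> (real \<Rightarrow> real) \<Rightarrow> ('d::finite, 'm::finite, 1) net_param set \<Rightarrow>
   (nat \<Rightarrow> 'a \<Rightarrow> real ^ 'd) \<Rightarrow> (nat \<Rightarrow> real ^ 'd \<Rightarrow> real) \<Rightarrow> nat \<Rightarrow> ennreal" where
  "eps_v M \<rho> \<Theta> X v i = (INF \<xi>\<in>\<Theta>. \<integral>\<^sup>+\<omega>. ennreal (\<bar>v i (X i \<omega>) - net_U \<rho> \<xi> (X i \<omega>)\<bar>\<^sup>2) \<partial>M)"

definition eps_z ::
  "'a measure \<Rightarrow> (real \<Rightarrow> real) \<Rightarrow> ('d::finite, 'm::finite, 'd) net_param set \<Rightarrow>
   (nat \<Rightarrow> 'a \<Rightarrow> real ^ 'd) \<Rightarrow> (nat \<Rightarrow> real ^ 'd \<Rightarrow> real ^ 'd) \<Rightarrow> nat \<Rightarrow> ennreal" where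
  "eps_z M \<rho> \<Theta> X z i = (INF \<eta>\<in>\<Theta>. \<integral>\<^sup>+\<omega>. ennreal ((norm (z i (X i \<omega>) - net_Z \<rho> \<eta> (X i \<omega>)))\<^sup>2) \<partial>M)"

end

theory Submission
  imports Defs
begin

text \<open>
  The proof compares the solution with the scheme one step at a time, by orthogonality in \<open>L\<^sup>2\<close>.
  Fix a step from \<open>s = t\<^sub>i\<close> to \<open>t = t\<^sub>i\<^sub>+\<^sub>1\<close> of length \<open>h\<close>, write \<open>U\<close> for the computed value at time \<open>t\<close>,
  \<open>D = Y\<^sub>t - U\<close>, and let \<open>V\<close> and \<open>z\<close> be the implicit Euler step from \<open>U\<close>, so that \<open>V = E\<^sub>s U + f(s, X, V, z) h\<close> and
  \<open>h z = E\<^sub>s (U \<Delta>W)\<close>.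

  The equation for \<open>Y\<close> gives \<open>Y\<^sub>s - V = E\<^sub>s D\<close> plus the conditional mean of a difference of drivers. The
  Lipschitz condition bounds that difference by the distances of \<open>\<X>\<close> from the Euler scheme, of \<open>Y\<close> from \<open>V\<close> and of \<open>Z\<close>
  from \<open>z\<close>. The last one is the delicate term, since it is not small by itself. With the mean
  \<open>Z'\<close> of \<open>Z\<close> over the step, \<open>h (Z' - z)\<close> is the conditional mean of \<open>(D + \<integral> f) \<Delta>W\<close>, and \<open>\<Delta>W\<close> is orthogonal to
  everything known at time \<open>s\<close>; hence \<open>h E\<bar>Z' - z\<bar>\<^sup>2\<close> is at most a multiple of \<open>G = E\<bar>D - E\<^sub>s D\<bar>\<^sup>2\<close> up to terms of order \<open>h\<close>.
  But the first estimate contains \<open>E\<bar>E\<^sub>s D\<bar>\<^sup>2 = E\<bar>D\<bar>\<^sup>2 - G\<close>. A suitable weight in Young's inequality lets this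
  gain absorb the \<open>Z\<close>-term with half of \<open>G\<close> left over (\<open>bsde_step\<close>).

  The scheme replaces \<open>V\<close> and \<open>z\<close> by networks. The loss splits orthogonally into a residual that
  does not depend on the parameters and the distance between the coefficients that the networks
  produce and those of the projection of \<open>U\<close> (\<open>loss_decomposition\<close>). A minimizer of the loss is
  therefore a quasi-optimal approximation of \<open>(V, z)\<close> (\<open>optimal_coefficients\<close>), with error at most a multiple of
  \<open>\<epsilon>\<^sup>v + h \<epsilon>\<^sup>z\<close>. Passing from \<open>V\<close> to the network costs a factor \<open>1 + 1 / N\<close> in the recursion and
  \<open>1 + N\<close> in front of this error, which explains the weight \<open>N\<close> of \<open>\<epsilon>\<^sup>v\<close> in the theorem.

  Iterating the step from the terminal time backwards (\<open>backward_gronwall\<close>) bounds all errors of \<open>Y\<close>, and also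
  \<open>\<Sum> G\<close>, which in turn bounds the errors of \<open>Z\<close>.

  The stochastic calculus enters through three facts about \<open>J = \<integral>\<^sub>s\<^sup>t Z dW\<close>, all consequences of the isometry
  for elementary integrands (\<open>ito_difference\<close>): \<open>E\<bar>J\<bar>\<^sup>2 = E \<integral> \<bar>Z\<bar>\<^sup>2\<close>, \<open>J\<close> is orthogonal to functions known at
  time \<open>s\<close>, and \<open>E J (\<zeta> \<bullet> \<Delta>W) = E \<integral> \<zeta> \<bullet> Z\<close> for \<open>\<zeta>\<close> known at time \<open>s\<close>.
\<close>

section \<open>Square-integrable functions\<close>

definition L2 :: "'a measure \<Rightarrow> ('a \<Rightarrow> 'b::euclidean_space) \<Rightarrow> bool" where
  "L2 M X \<longleftrightarrow> X \<in> borel_measurable M \<and> integrable M (\<lambda>\<omega>. (norm (X \<omega>))\<^sup>2)"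

text \<open>A function whose square is not integrable has \<open>msq\<close> equal to \<open>0\<close>, the default value of the integral;
  a bound for \<open>msq\<close> alone therefore does not give square integrability.\<close>

definition msq :: "'a measure \<Rightarrow> ('a \<Rightarrow> 'b::euclidean_space) \<Rightarrow> real" where
  "msq M X = (\<integral>\<omega>. (norm (X \<omega>))\<^sup>2 \<partial>M)"

lemma L2_measurable: "L2 M X \<Longrightarrow> X \<in> borel_measurable M"
  by (simp add: L2_def)

lemma L2_sq_integrable: "L2 M X \<Longrightarrow> integrable M (\<lambda>\<omega>. (norm (X \<omega>))\<^sup>2)"
  by (simp add: L2_def)

lemma msq_nonneg [simp]: "0 \<le> msq M X"
  by (simp add: msq_def)

lemma L2_zero [simp]: "L2 M (\<lambda>_. 0)"
  by (simp add: L2_def)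

lemma nn_integral_L2: "L2 M X \<Longrightarrow> (\<integral>\<^sup>+\<omega>. ennreal ((norm (X \<omega>))\<^sup>2) \<partial>M) = ennreal (msq M X)"
  unfolding msq_def L2_def by (intro nn_integral_eq_integral) auto

lemma L2_iff_nn_integral:
  "X \<in> borel_measurable M \<Longrightarrow> L2 M X \<longleftrightarrow> (\<integral>\<^sup>+\<omega>. ennreal ((norm (X \<omega>))\<^sup>2) \<partial>M) < \<infinity>"
  by (simp add: L2_def integrable_iff_bounded)

lemma L2_dominated:
  assumes "L2 M X" "Y \<in> borel_measurable M" "AE \<omega> in M. norm (Y \<omega>) \<le> C * norm (X \<omega>)"
  shows "L2 M Y"
proof -
  note [measurable] = assms(2) L2_measurable[OF assms(1)]
  have "integrable M (\<lambda>\<omega>. (norm (Y \<omega>))\<^sup>2)"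
  proof (rule Bochner_Integration.integrable_bound)
    show "integrable M (\<lambda>\<omega>. C\<^sup>2 * (norm (X \<omega>))\<^sup>2)"
      using assms(1) by (simp add: L2_def)
    show "AE \<omega> in M. norm ((norm (Y \<omega>))\<^sup>2) \<le> norm (C\<^sup>2 * (norm (X \<omega>))\<^sup>2)"
      using assms(3) by eventually_elim (auto simp: power_mult_distrib[symmetric] intro: power_mono)
  qed simp
  then show ?thesis by (simp add: L2_def assms(2))
qed

lemma L2_norm: "L2 M X \<Longrightarrow> L2 M (\<lambda>\<omega>. norm (X \<omega>))"
  by (auto simp: L2_def)

lemma L2_scaleR: "L2 M X \<Longrightarrow> L2 M (\<lambda>\<omega>. c *\<^sub>R X \<omega>)"
  by (auto simp: L2_def power_mult_distrib)

lemma L2_mult_left: "L2 M X \<Longrightarrow> L2 M (\<lambda>\<omega>. (c::real) * X \<omega>)"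
  using L2_scaleR[of M X c] by simp

lemma L2_mult_right: "L2 M X \<Longrightarrow> L2 M (\<lambda>\<omega>. X \<omega> * (c::real))"
  using L2_scaleR[of M X c] by (simp add: mult.commute)

lemma L2_minus: "L2 M X \<Longrightarrow> L2 M (\<lambda>\<omega>. - X \<omega>)"
  by (auto simp: L2_def)

lemma norm_add_sq_le: "(norm (x + y :: 'b::real_normed_vector))\<^sup>2 \<le> 2 * (norm x)\<^sup>2 + 2 * (norm y)\<^sup>2"
proof -
  have "(norm (x + y))\<^sup>2 \<le> (norm x + norm y)\<^sup>2"
    by (intro power_mono norm_triangle_ineq) auto
  also have "\<dots> \<le> 2 * (norm x)\<^sup>2 + 2 * (norm y)\<^sup>2"
    using sum_squares_ge_zero[of "norm x - norm y" 0] by (simp add: power2_eq_square algebra_simps)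
  finally show ?thesis .
qed

lemma L2_add:
  assumes "L2 M X" "L2 M Y" shows "L2 M (\<lambda>\<omega>. X \<omega> + Y \<omega>)"
proof -
  note [measurable] = assms[THEN L2_measurable]
  have "integrable M (\<lambda>\<omega>. (norm (X \<omega> + Y \<omega>))\<^sup>2)"
  proof (rule Bochner_Integration.integrable_bound)
    show "integrable M (\<lambda>\<omega>. 2 * (norm (X \<omega>))\<^sup>2 + 2 * (norm (Y \<omega>))\<^sup>2)"
      using assms by (simp add: L2_def)
    show "AE \<omega> in M. norm ((norm (X \<omega> + Y \<omega>))\<^sup>2) \<le> norm (2 * (norm (X \<omega>))\<^sup>2 + 2 * (norm (Y \<omega>))\<^sup>2)"
      using norm_add_sq_le[of "X _" "Y _"] by auto
  qed simp
  then show ?thesis by (simp add: L2_def)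
qed

lemma L2_diff: "L2 M X \<Longrightarrow> L2 M Y \<Longrightarrow> L2 M (\<lambda>\<omega>. X \<omega> - Y \<omega>)"
  using L2_add[of M X "\<lambda>\<omega>. - Y \<omega>"] L2_minus[of M Y] by simp

lemma L2_sum: "(\<And>i. i \<in> I \<Longrightarrow> L2 M (X i)) \<Longrightarrow> L2 M (\<lambda>\<omega>. \<Sum>i\<in>I. X i \<omega>)"
  by (induction I rule: infinite_finite_induct) (auto intro: L2_add)

lemma L2_const: "finite_measure M \<Longrightarrow> L2 M (\<lambda>_. c)"
  by (simp add: L2_def finite_measure.integrable_const)

lemma msq_cong_AE:
  assumes "X \<in> borel_measurable M" "Y \<in> borel_measurable M" "AE \<omega> in M. X \<omega> = Y \<omega>"
  shows "msq M X = msq M Y"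
proof -
  note [measurable] = assms(1,2)
  show ?thesis unfolding msq_def
  proof (rule integral_cong_AE)
    show "AE \<omega> in M. (norm (X \<omega>))\<^sup>2 = (norm (Y \<omega>))\<^sup>2"
      using assms(3) by eventually_elim simp
  qed simp_all
qed

lemma L2_bounded_mult:
  assumes "L2 M X" "c \<in> borel_measurable M" "\<And>\<omega>. \<bar>c \<omega>\<bar> \<le> B"
  shows "L2 M (\<lambda>\<omega>. c \<omega> *\<^sub>R X \<omega>)"
proof (rule L2_dominated[OF assms(1), where C = B])
  note [measurable] = assms(2) L2_measurable[OF assms(1)]
  show "(\<lambda>\<omega>. c \<omega> *\<^sub>R X \<omega>) \<in> borel_measurable M" by simp
  show "AE \<omega> in M. norm (c \<omega> *\<^sub>R X \<omega>) \<le> B * norm (X \<omega>)"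
    using assms(3) by (auto intro!: mult_right_mono)
qed

lemma L2_inner_integrable:
  assumes "L2 M X" "L2 M Y" shows "integrable M (\<lambda>\<omega>. X \<omega> \<bullet> Y \<omega>)"
proof (rule Bochner_Integration.integrable_bound)
  note [measurable] = assms[THEN L2_measurable]
  show "integrable M (\<lambda>\<omega>. (norm (X \<omega>))\<^sup>2 + (norm (Y \<omega>))\<^sup>2)"
    using assms by (simp add: L2_def)
  show "(\<lambda>\<omega>. X \<omega> \<bullet> Y \<omega>) \<in> borel_measurable M" by simp
  have "\<bar>x \<bullet> y\<bar> \<le> (norm x)\<^sup>2 + (norm y)\<^sup>2" for x y :: 'b
  proof -
    have "\<bar>x \<bullet> y\<bar> \<le> norm x * norm y" by (rule Cauchy_Schwarz_ineq2)
    also have "\<dots> \<le> (norm x)\<^sup>2 + (norm y)\<^sup>2"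
      using sum_squares_bound[of "norm x" "norm y"] zero_le_power2[of "norm x"] zero_le_power2[of "norm y"]
        mult_nonneg_nonneg[of "norm x" "norm y"] norm_ge_zero[of x] norm_ge_zero[of y]
      by linarith
    finally show ?thesis .
  qed
  then show "AE \<omega> in M. norm (X \<omega> \<bullet> Y \<omega>) \<le> norm ((norm (X \<omega>))\<^sup>2 + (norm (Y \<omega>))\<^sup>2)"
    by auto
qed

lemma L2_mult_integrable:
  fixes X Y :: "'a \<Rightarrow> real"
  shows "L2 M X \<Longrightarrow> L2 M Y \<Longrightarrow> integrable M (\<lambda>\<omega>. X \<omega> * Y \<omega>)"
  using L2_inner_integrable[of M X Y] by simp

lemma L2_integrable:
  assumes "finite_measure M" "L2 M X" shows "integrable M X"
proof (rule Bochner_Integration.integrable_bound)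
  note [measurable] = assms(2)[THEN L2_measurable]
  interpret finite_measure M by fact
  show "integrable M (\<lambda>\<omega>. 1 + (norm (X \<omega>))\<^sup>2)"
    using assms(2) by (auto simp add: L2_def)
  have "norm (X \<omega>) \<le> 1 + (norm (X \<omega>))\<^sup>2" for \<omega>
    using sum_squares_bound[of 1 "norm (X \<omega>)"] norm_ge_zero[of "X \<omega>"] by (simp del: norm_ge_zero)
  then show "AE \<omega> in M. norm (X \<omega>) \<le> norm (1 + (norm (X \<omega>))\<^sup>2)" by auto
qed (rule L2_measurable[OF assms(2)])

lemma borel_measurable_vec_nth [measurable (raw)]:
  fixes X :: "'a \<Rightarrow> real ^ 'd"
  shows "X \<in> borel_measurable M \<Longrightarrow> (\<lambda>\<omega>. X \<omega> $ j) \<in> borel_measurable M"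
  by (rule measurable_compose[OF _ borel_measurable_nth])

lemma L2_component:
  fixes X :: "'a \<Rightarrow> real ^ 'd" assumes "L2 M X" shows "L2 M (\<lambda>\<omega>. X \<omega> $ j)"
proof (rule L2_dominated[OF assms, where C = 1])
  show "(\<lambda>\<omega>. X \<omega> $ j) \<in> borel_measurable M"
    using measurable_compose[OF L2_measurable[OF assms] borel_measurable_nth[of j]] by simp
qed (auto intro: component_le_norm_cart)

lemma norm_sq_vec: "(norm (x :: real ^ 'd))\<^sup>2 = (\<Sum>j\<in>UNIV. (x $ j)\<^sup>2)"
  unfolding norm_vec_def L2_set_def by (simp add: sum_nonneg)

lemma borel_measurable_vecI:
  fixes X :: "'a \<Rightarrow> real ^ 'd"
  assumes "\<And>j. (\<lambda>\<omega>. X \<omega> $ j) \<in> borel_measurable M" shows "X \<in> borel_measurable M"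
proof (rule borel_measurable_euclidean_space[THEN iffD2], rule ballI)
  fix b :: "real ^ 'd" assume "b \<in> Basis"
  then obtain j where "b = axis j 1" by (auto simp: Basis_vec_def)
  then show "(\<lambda>x. X x \<bullet> b) \<in> borel_measurable M" using assms[of j] by (simp add: inner_axis)
qed

lemma L2_vecI:
  fixes X :: "'a \<Rightarrow> real ^ 'd"
  assumes "\<And>j. L2 M (\<lambda>\<omega>. X \<omega> $ j)" shows "L2 M X"
  unfolding L2_def
proof
  show "X \<in> borel_measurable M"
    using L2_measurable[OF assms] by (rule borel_measurable_vecI)
  show "integrable M (\<lambda>\<omega>. (norm (X \<omega>))\<^sup>2)"
    unfolding norm_sq_vec using assms by (auto simp: L2_def)
qed

lemma msq_scaleR: "msq M (\<lambda>\<omega>. c *\<^sub>R X \<omega>) = c\<^sup>2 * msq M X"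
  by (simp add: msq_def power_mult_distrib)

lemma msq_mono:
  assumes "L2 M Y" "AE \<omega> in M. norm (X \<omega>) \<le> norm (Y \<omega>)"
  shows "msq M X \<le> msq M Y"
  unfolding msq_def
proof (cases "integrable M (\<lambda>\<omega>. (norm (X \<omega>))\<^sup>2)")
  case True
  show "(\<integral>\<omega>. (norm (X \<omega>))\<^sup>2 \<partial>M) \<le> (\<integral>\<omega>. (norm (Y \<omega>))\<^sup>2 \<partial>M)"
  proof (rule integral_mono_AE[OF True L2_sq_integrable[OF assms(1)]])
    show "AE \<omega> in M. (norm (X \<omega>))\<^sup>2 \<le> (norm (Y \<omega>))\<^sup>2"
      using assms(2) by eventually_elim (auto intro: power_mono)
  qed
qed (auto simp: not_integrable_integral_eq)

lemma msq_add:
  assumes "L2 M X" "L2 M Y"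
  shows "msq M (\<lambda>\<omega>. X \<omega> + Y \<omega>) = msq M X + 2 * (\<integral>\<omega>. X \<omega> \<bullet> Y \<omega> \<partial>M) + msq M Y"
proof -
  have "msq M (\<lambda>\<omega>. X \<omega> + Y \<omega>) = (\<integral>\<omega>. (norm (X \<omega>))\<^sup>2 + 2 * (X \<omega> \<bullet> Y \<omega>) + (norm (Y \<omega>))\<^sup>2 \<partial>M)"
    unfolding msq_def
    by (intro Bochner_Integration.integral_cong)
       (auto simp: power2_norm_eq_inner inner_add_left inner_add_right inner_commute)
  also have "\<dots> = msq M X + 2 * (\<integral>\<omega>. X \<omega> \<bullet> Y \<omega> \<partial>M) + msq M Y"
    using assms L2_inner_integrable[OF assms] by (simp add: L2_def msq_def)
  finally show ?thesis .
qed

lemma msq_diff: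
  assumes "L2 M X" "L2 M Y"
  shows "msq M (\<lambda>\<omega>. X \<omega> - Y \<omega>) = msq M X - 2 * (\<integral>\<omega>. X \<omega> \<bullet> Y \<omega> \<partial>M) + msq M Y"
  using msq_add[OF assms(1) L2_minus[OF assms(2)]] by (simp add: msq_def)

lemma msq_inner_self: "(\<integral>\<omega>. X \<omega> \<bullet> X \<omega> \<partial>M) = msq M X"
  by (simp add: msq_def power2_norm_eq_inner)

text \<open>Young's inequality, by expanding the mean square of \<open>e X - Y\<close>.\<close>

lemma inner_le_msq:
  assumes "L2 M X" "L2 M Y" "e > 0"
  shows "2 * (\<integral>\<omega>. X \<omega> \<bullet> Y \<omega> \<partial>M) \<le> e * msq M X + msq M Y / e"
proof -
  have "0 \<le> msq M (\<lambda>\<omega>. e *\<^sub>R X \<omega> - Y \<omega>)" by simp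
  also have "\<dots> = e\<^sup>2 * msq M X - 2 * (e * (\<integral>\<omega>. X \<omega> \<bullet> Y \<omega> \<partial>M)) + msq M Y"
    by (subst msq_diff[OF L2_scaleR[OF assms(1)] assms(2)]) (simp add: msq_scaleR)
  finally show ?thesis
    using \<open>e > 0\<close> by (simp add: field_simps power2_eq_square)
qed

lemma msq_add_young:
  assumes "L2 M X" "L2 M Y" "e > 0"
  shows "msq M (\<lambda>\<omega>. X \<omega> + Y \<omega>) \<le> (1 + e) * msq M X + (1 + 1 / e) * msq M Y"
  using msq_add[OF assms(1,2)] inner_le_msq[OF assms] by (simp add: algebra_simps)

lemma msq_add_le:
  assumes "L2 M X" "L2 M Y"
  shows "msq M (\<lambda>\<omega>. X \<omega> + Y \<omega>) \<le> 2 * msq M X + 2 * msq M Y"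
  using msq_add_young[OF assms, of 1] by simp

lemma msq_diff_le:
  assumes "L2 M X" "L2 M Y"
  shows "msq M (\<lambda>\<omega>. X \<omega> - Y \<omega>) \<le> 2 * msq M X + 2 * msq M Y"
  using msq_add_le[OF assms(1) L2_minus[OF assms(2)]] by (simp add: msq_def)

lemma L2_cauchy_schwarz:
  assumes "L2 M X" "L2 M Y"
  shows "(\<integral>\<omega>. X \<omega> \<bullet> Y \<omega> \<partial>M)\<^sup>2 \<le> msq M X * msq M Y"
proof -
  let ?p = "\<integral>\<omega>. X \<omega> \<bullet> Y \<omega> \<partial>M"
  have q: "0 \<le> t\<^sup>2 * msq M X - 2 * t * ?p + msq M Y" for t
  proof -
    have "0 \<le> msq M (\<lambda>\<omega>. t *\<^sub>R X \<omega> - Y \<omega>)" by simp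
    also have "\<dots> = t\<^sup>2 * msq M X - 2 * (t * ?p) + msq M Y"
      by (subst msq_diff[OF L2_scaleR[OF assms(1)] assms(2)]) (simp add: msq_scaleR)
    finally show ?thesis by simp
  qed
  show ?thesis
  proof (cases "msq M X = 0")
    case True
    have "?p = 0"
    proof (rule ccontr)
      assume "?p \<noteq> 0"
      then have "2 * ((msq M Y + 1) / ?p) * ?p = 2 * (msq M Y + 1)" by simp
      then show False using q[of "(msq M Y + 1) / ?p"] True msq_nonneg[of M Y] by simp
    qed
    then show ?thesis by simp
  next
    case False
    then have pos: "0 < msq M X" using msq_nonneg[of M X] by linarith
    have "0 \<le> msq M Y - ?p\<^sup>2 / msq M X"
      using q[of "?p / msq M X"] pos by (simp add: power2_eq_square field_simps)
    then show ?thesis using pos by (simp add: field_simps)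
  qed
qed

text \<open>Convergence is stated with \<open>nn_integral\<close>, as in the definition of the It\^o integral.\<close>

lemma L2_inner_tendsto:
  assumes "\<And>k. L2 M (X k)" "L2 M X'" "L2 M Y"
    and lim: "(\<lambda>k. \<integral>\<^sup>+\<omega>. ennreal ((norm (X k \<omega> - X' \<omega>))\<^sup>2) \<partial>M) \<longlonglongrightarrow> 0"
  shows "(\<lambda>k. \<integral>\<omega>. X k \<omega> \<bullet> Y \<omega> \<partial>M) \<longlonglongrightarrow> (\<integral>\<omega>. X' \<omega> \<bullet> Y \<omega> \<partial>M)"
proof -
  have d: "L2 M (\<lambda>\<omega>. X k \<omega> - X' \<omega>)" for k using assms by (intro L2_diff) auto
  have "(\<lambda>k. ennreal (msq M (\<lambda>\<omega>. X k \<omega> - X' \<omega>))) \<longlonglongrightarrow> ennreal 0"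
    using lim nn_integral_L2[OF d] by simp
  then have "(\<lambda>k. msq M (\<lambda>\<omega>. X k \<omega> - X' \<omega>)) \<longlonglongrightarrow> 0"
    by (subst (asm) tendsto_ennreal_iff) auto
  then have *: "(\<lambda>k. sqrt (msq M (\<lambda>\<omega>. X k \<omega> - X' \<omega>) * msq M Y)) \<longlonglongrightarrow> 0"
    using tendsto_real_sqrt[OF tendsto_mult_left_zero[where c = "msq M Y"]] by simp
  have "(\<lambda>k. (\<integral>\<omega>. X k \<omega> \<bullet> Y \<omega> \<partial>M) - (\<integral>\<omega>. X' \<omega> \<bullet> Y \<omega> \<partial>M)) \<longlonglongrightarrow> 0"
  proof (rule Lim_null_comparison[OF _ *], intro always_eventually allI)
    fix k
    have "(\<integral>\<omega>. X k \<omega> \<bullet> Y \<omega> \<partial>M) - (\<integral>\<omega>. X' \<omega> \<bullet> Y \<omega> \<partial>M) = (\<integral>\<omega>. (X k \<omega> - X' \<omega>) \<bullet> Y \<omega> \<partial>M)"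
      using assms by (simp add: inner_diff_left L2_inner_integrable)
    then show "norm ((\<integral>\<omega>. X k \<omega> \<bullet> Y \<omega> \<partial>M) - (\<integral>\<omega>. X' \<omega> \<bullet> Y \<omega> \<partial>M))
        \<le> sqrt (msq M (\<lambda>\<omega>. X k \<omega> - X' \<omega>) * msq M Y)"
      using L2_cauchy_schwarz[OF d[of k] assms(3)] by (simp add: real_le_rsqrt)
  qed
  then show ?thesis by (rule LIM_zero_cancel)
qed

lemma L2_limit:
  assumes "\<And>k. L2 M (X k)" "X' \<in> borel_measurable M"
    and lim: "(\<lambda>k. \<integral>\<^sup>+\<omega>. ennreal ((norm (X k \<omega> - X' \<omega>))\<^sup>2) \<partial>M) \<longlonglongrightarrow> 0"
  shows "L2 M X'"
proof -
  note [measurable] = assms(2) L2_measurable[OF assms(1)]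
  have "eventually (\<lambda>k. (\<integral>\<^sup>+\<omega>. ennreal ((norm (X k \<omega> - X' \<omega>))\<^sup>2) \<partial>M) < \<infinity>) sequentially"
    using lim by (rule order_tendstoD) simp
  then obtain k where "(\<integral>\<^sup>+\<omega>. ennreal ((norm (X k \<omega> - X' \<omega>))\<^sup>2) \<partial>M) < \<infinity>"
    by (auto simp: eventually_sequentially)
  then have "L2 M (\<lambda>\<omega>. X k \<omega> - X' \<omega>)" by (subst L2_iff_nn_integral) auto
  from L2_diff[OF assms(1)[of k] this] show ?thesis by simp
qed

text \<open>A priori bounds are obtained by testing against truncations, for which all integrals are known
  to exist; monotone convergence then removes the truncation.\<close>

lemma L2_by_truncation:
  fixes X :: "'a \<Rightarrow> 'b::euclidean_space"
  assumes [measurable]: "X \<in> borel_measurable M" "A \<in> borel_measurable M"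
    and fin: "finite_measure M"
    and bound: "\<And>n::nat. msq M (\<lambda>\<omega>. indicator {\<omega>. norm (X \<omega>) \<le> n \<and> norm (A \<omega> :: 'c::euclidean_space) \<le> n} \<omega> *\<^sub>R X \<omega>) \<le> C"
  shows "L2 M X"
proof -
  interpret finite_measure M by fact
  let ?S = "\<lambda>n::nat. {\<omega>. norm (X \<omega>) \<le> n \<and> norm (A \<omega>) \<le> n}"
  let ?f = "\<lambda>n \<omega>. ennreal ((norm (indicator (?S n) \<omega> *\<^sub>R X \<omega>))\<^sup>2)"
  have m[measurable]: "(\<lambda>\<omega>. indicator (?S n) \<omega> *\<^sub>R X \<omega>) \<in> borel_measurable M" for n
    by measurable
  have b: "L2 M (\<lambda>\<omega>. indicator (?S n) \<omega> *\<^sub>R X \<omega>)" for n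
  proof (rule L2_dominated[OF L2_const[OF fin, of "real n"] m, where C = 1])
    show "AE \<omega> in M. norm (indicator (?S n) \<omega> *\<^sub>R X \<omega>) \<le> 1 * norm (real n)"
      by (auto split: split_indicator)
  qed
  have inc: "incseq ?f"
    by (auto simp: incseq_def le_fun_def split: split_indicator)
  have sup: "(SUP n. ?f n \<omega>) = ennreal ((norm (X \<omega>))\<^sup>2)" for \<omega>
  proof (rule antisym)
    show "(SUP n. ?f n \<omega>) \<le> ennreal ((norm (X \<omega>))\<^sup>2)"
      by (rule SUP_least) (auto split: split_indicator)
    obtain n :: nat where "max (norm (X \<omega>)) (norm (A \<omega>)) \<le> n" using real_arch_simple by blast
    then have "\<omega> \<in> ?S n" by simp
    then have "ennreal ((norm (X \<omega>))\<^sup>2) = ?f n \<omega>" by (simp only: indicator_simps scaleR_one)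
    then show "ennreal ((norm (X \<omega>))\<^sup>2) \<le> (SUP n. ?f n \<omega>)"
      by (intro SUP_upper2[of n]) (simp_all only: UNIV_I order_refl)
  qed
  have "(\<integral>\<^sup>+\<omega>. ennreal ((norm (X \<omega>))\<^sup>2) \<partial>M) = (SUP n. \<integral>\<^sup>+\<omega>. ?f n \<omega> \<partial>M)"
    unfolding sup[symmetric] by (rule nn_integral_monotone_convergence_SUP[OF inc]) measurable
  also have "\<dots> \<le> ennreal C"
    using bound by (intro SUP_least) (simp only: nn_integral_L2[OF b] ennreal_leI)
  finally show ?thesis
    by (subst L2_iff_nn_integral) (auto simp: less_top[symmetric] top_unique)
qed

section \<open>Moments of Brownian increments\<close>

lemma Basis_vec_real: "(Basis :: (real ^ 'd) set) = range (\<lambda>j. axis j 1)"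
  by (auto simp: Basis_vec_def)

lemma inj_axis: "inj (\<lambda>j. axis j (1::real) :: real ^ 'd)"
  by (auto simp: inj_def axis_eq_axis)

text \<open>Lebesgue measure on \<open>\<real>\<^sup>d\<close> is the image of a product measure and the density is a product, so the
  integral of a monomial factorizes.\<close>

lemma gaussian_vec_monomial:
  fixes n :: "'d::finite \<Rightarrow> nat" and s :: real
  assumes "0 < s"
  defines "nd \<equiv> normal_density 0 s"
  shows "integrable lborel (\<lambda>x :: real ^ 'd. (\<Prod>j\<in>UNIV. nd (x $ j)) * (\<Prod>j\<in>UNIV. (x $ j) ^ n j))" (is ?A)
    and "(\<integral>x. (\<Prod>j\<in>UNIV. nd (x $ j)) * (\<Prod>j\<in>UNIV. (x $ j) ^ n j) \<partial>(lborel :: (real ^ 'd) measure))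
      = (\<Prod>j\<in>UNIV. \<integral>y. nd y * y ^ n j \<partial>lborel)" (is ?B)
proof -
  let ?ax = "\<lambda>j. axis j 1 :: real ^ 'd"
  let ?g = "\<lambda>b y. nd y * y ^ n (inv ?ax b)"
  let ?P = "\<Pi>\<^sub>M b\<in>(Basis :: (real ^ 'd) set). (lborel :: real measure)"
  let ?v = "\<lambda>f :: real ^ 'd \<Rightarrow> real. \<Sum>b\<in>Basis. f b *\<^sub>R b"
  interpret product_sigma_finite "\<lambda>b :: real ^ 'd. lborel :: real measure" ..
  have int1: "integrable lborel (\<lambda>y. nd y * y ^ k)" for k
    using integrable_normal_moment[OF assms(1), of 0 k] by (simp add: nd_def)
  have inv_ax: "inv ?ax (?ax j) = j" for j by (simp add: inv_f_f[OF inj_axis])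
  have comp: "?v f $ j = f (?ax j)" for f j
  proof -
    have "?v f $ j = (\<Sum>i\<in>UNIV. f (?ax i) * (?ax i $ j))"
      unfolding Basis_vec_real by (subst sum.reindex[OF inj_axis]) simp
    also have "\<dots> = (\<Sum>i\<in>UNIV. if i = j then f (?ax i) else 0)"
      by (intro sum.cong) (auto simp: axis_def)
    finally show ?thesis by simp
  qed
  have prod: "(\<Prod>j\<in>UNIV. nd (?v f $ j)) * (\<Prod>j\<in>UNIV. (?v f $ j) ^ n j) = (\<Prod>b\<in>Basis. ?g b (f b))" for f
    unfolding comp prod.distrib[symmetric]
    by (simp only: Basis_vec_real prod.reindex[OF inj_axis] comp_def inv_ax)
  have meas: "(\<lambda>x :: real ^ 'd. (\<Prod>j\<in>UNIV. nd (x $ j)) * (\<Prod>j\<in>UNIV. (x $ j) ^ n j)) \<in> borel_measurable borel"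
    unfolding nd_def by measurable
  have mv: "?v \<in> measurable ?P borel" by measurable
  show ?A
    unfolding lborel_eq[where 'a = "real ^ 'd"]
    by (subst integrable_distr_eq[OF mv meas], unfold prod)
       (rule product_integrable_prod, simp_all add: int1)
  have "(\<integral>x. (\<Prod>j\<in>UNIV. nd (x $ j)) * (\<Prod>j\<in>UNIV. (x $ j) ^ n j) \<partial>(lborel :: (real ^ 'd) measure))
      = (\<Prod>b\<in>(Basis :: (real ^ 'd) set). \<integral>y. ?g b y \<partial>lborel)"
    unfolding lborel_eq[where 'a = "real ^ 'd"]
    by (subst integral_distr[OF mv meas], unfold prod)
       (rule product_integral_prod, simp_all add: int1)
  also have "\<dots> = (\<Prod>j\<in>UNIV. \<integral>y. nd y * y ^ n j \<partial>lborel)"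
    unfolding Basis_vec_real by (subst prod.reindex[OF inj_axis]) (simp add: inv_ax)
  finally show ?B .
qed

lemma gaussian_vec_moments:
  fixes s :: real and j k :: "'d::finite"
  assumes "0 < s"
  defines "p \<equiv> \<lambda>x :: real ^ 'd. \<Prod>j\<in>UNIV. normal_density 0 s (x $ j)"
  shows "integrable lborel (\<lambda>x. p x * x $ j)" "(\<integral>x. p x * x $ j \<partial>lborel) = 0"
    and "integrable lborel (\<lambda>x. p x * (x $ j * x $ k))"
    and "(\<integral>x. p x * (x $ j * x $ k) \<partial>lborel) = (if j = k then s\<^sup>2 else 0)"
proof -
  have m0: "(\<integral>y. normal_density 0 s y * y ^ 0 \<partial>lborel) = 1"
    using integral_normal_density[OF assms(1), of 0] by simp
  have m1: "(\<integral>y. normal_density 0 s y * y ^ 1 \<partial>lborel) = 0"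
    using integral_normal_moment_nz_1[OF assms(1), of 0] by simp
  have m2: "(\<integral>y. normal_density 0 s y * y ^ 2 \<partial>lborel) = s\<^sup>2"
    using integral_normal_moment_even[OF assms(1), of 0 1] \<open>0 < s\<close> by simp
  have single: "(\<Prod>i\<in>UNIV. (x $ i) ^ of_bool (i = j)) = x $ j" for x :: "real ^ 'd" and j
  proof -
    have "(\<Prod>i\<in>UNIV. (x $ i) ^ of_bool (i = j)) = (\<Prod>i\<in>UNIV. if i = j then x $ i else 1)"
      by (intro prod.cong) auto
    then show ?thesis by simp
  qed
  have double: "(\<Prod>i\<in>UNIV. (x $ i) ^ (of_bool (i = j) + of_bool (i = k))) = x $ j * x $ k" for x :: "real ^ 'd"
    by (simp only: power_add prod.distrib single)
  show "integrable lborel (\<lambda>x. p x * x $ j)"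
    using gaussian_vec_monomial(1)[OF assms(1), of "\<lambda>i. of_bool (i = j)"] by (simp only: single p_def)
  show "(\<integral>x. p x * x $ j \<partial>lborel) = 0"
  proof -
    have "(\<integral>x. p x * x $ j \<partial>lborel) = (\<Prod>i\<in>UNIV. \<integral>y. normal_density 0 s y * y ^ of_bool (i = j) \<partial>lborel)"
      using gaussian_vec_monomial(2)[OF assms(1), of "\<lambda>i. of_bool (i = j)"] by (simp only: single p_def)
    also have "\<dots> = 0" by (rule prod_zero) (use m1 in auto)
    finally show ?thesis .
  qed
  show "integrable lborel (\<lambda>x. p x * (x $ j * x $ k))"
    using gaussian_vec_monomial(1)[OF assms(1), of "\<lambda>i. of_bool (i = j) + of_bool (i = k)"]
    by (simp only: double p_def)
  have eq: "(\<integral>x. p x * (x $ j * x $ k) \<partial>lborel)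
      = (\<Prod>i\<in>UNIV. \<integral>y. normal_density 0 s y * y ^ (of_bool (i = j) + of_bool (i = k)) \<partial>lborel)"
    using gaussian_vec_monomial(2)[OF assms(1), of "\<lambda>i. of_bool (i = j) + of_bool (i = k)"]
    by (simp only: double p_def)
  show "(\<integral>x. p x * (x $ j * x $ k) \<partial>lborel) = (if j = k then s\<^sup>2 else 0)"
  proof (cases "j = k")
    case True
    have "(\<Prod>i\<in>UNIV. \<integral>y. normal_density 0 s y * y ^ (of_bool (i = j) + of_bool (i = k)) \<partial>lborel)
        = (\<Prod>i\<in>UNIV. if i = k then s\<^sup>2 else 1)"
      using m0 m2 True by (intro prod.cong) (auto simp: power2_eq_square)
    then show ?thesis using True eq by simp
  next
    case False
    have "(\<Prod>i\<in>UNIV. \<integral>y. normal_density 0 s y * y ^ (of_bool (i = j) + of_bool (i = k)) \<partial>lborel) = 0"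
    proof (rule prod_zero)
      show "\<exists>i\<in>UNIV. (\<integral>y. normal_density 0 s y * y ^ (of_bool (i = j) + of_bool (i = k)) \<partial>lborel) = 0"
        using m1 False by (intro bexI[of _ j]) auto
    qed simp
    then show ?thesis using False eq by simp
  qed
qed

text \<open>The part of the filtered setting on which all \<open>L\<^sup>2\<close> computations rest: increments are Gaussian and
  independent of the past.\<close>

locale brownian_space = prob_space M for M :: "'a measure" +
  fixes T :: real and F :: "real \<Rightarrow> 'a measure" and W :: "real \<Rightarrow> 'a \<Rightarrow> real ^ 'd"
  assumes T_pos: "0 < T"
    and subalg: "\<And>t. t \<in> {0..T} \<Longrightarrow> subalgebra M (F t)"
    and filt_mono: "\<And>s t. 0 \<le> s \<Longrightarrow> s \<le> t \<Longrightarrow> t \<le> T \<Longrightarrow> sets (F s) \<subseteq> sets (F t)"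
    and W_adapted: "adapted T F W"
    and W_indep: "\<And>s t. 0 \<le> s \<Longrightarrow> s < t \<Longrightarrow> t \<le> T \<Longrightarrow>
        indep_set (sets (F s)) (sets (vimage_algebra (space M) (\<lambda>\<omega>. W t \<omega> - W s \<omega>) borel))"
    and W_gauss: "\<And>s t. 0 \<le> s \<Longrightarrow> s < t \<Longrightarrow> t \<le> T \<Longrightarrow>
        distributed M lborel (\<lambda>\<omega>. W t \<omega> - W s \<omega>)
          (\<lambda>x. ennreal (\<Prod>j\<in>UNIV. normal_density 0 (sqrt (t - s)) (x $ j)))"
begin

lemma F_space: "t \<in> {0..T} \<Longrightarrow> space (F t) = space M"
  using subalg by (auto simp: subalgebra_def)

lemma F_borel_mono:
  "0 \<le> s \<Longrightarrow> s \<le> t \<Longrightarrow> t \<le> T \<Longrightarrow> X \<in> borel_measurable (F s) \<Longrightarrow> X \<in> borel_measurable (F t)"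
  using filt_mono[of s t] F_space[of s] F_space[of t] by (auto simp: measurable_def)

lemma F_borel_M: "t \<in> {0..T} \<Longrightarrow> X \<in> borel_measurable (F t) \<Longrightarrow> X \<in> borel_measurable M"
  using measurable_from_subalg[OF subalg] by blast

lemma W_F: "0 \<le> s \<Longrightarrow> s \<le> t \<Longrightarrow> t \<le> T \<Longrightarrow> W s \<in> borel_measurable (F t)"
  using W_adapted F_borel_mono[of s t "W s"] by (auto simp: adapted_def)

lemma W_M [measurable]: "s \<in> {0..T} \<Longrightarrow> W s \<in> borel_measurable M"
  using F_borel_M W_F[of s s] by auto

lemma cond_exp_space: "t \<in> {0..T} \<Longrightarrow> sigma_finite_subalgebra M (F t)"
  using subalg by (intro finite_measure_subalgebra_is_sigma_finite)
    (auto simp: finite_measure_subalgebra_def finite_measure_subalgebra_axioms_def intro: finite_measure_axioms)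

lemma increment_moments:
  assumes "0 \<le> s" "s < t" "t \<le> T"
  defines "D \<equiv> \<lambda>\<omega>. W t \<omega> - W s \<omega>"
  shows "integrable M (\<lambda>\<omega>. D \<omega> $ j)" "(\<integral>\<omega>. D \<omega> $ j \<partial>M) = 0"
    "integrable M (\<lambda>\<omega>. D \<omega> $ j * D \<omega> $ k)" "(\<integral>\<omega>. D \<omega> $ j * D \<omega> $ k \<partial>M) = (if j = k then t - s else 0)"
proof -
  have s: "0 < sqrt (t - s)" using assms by simp
  note d = W_gauss[OF assms(1-3), folded D_def]
  have nn: "0 \<le> (\<Prod>j\<in>UNIV. normal_density 0 (sqrt (t - s)) ((x :: real ^ 'd) $ j))" for x
    by (intro prod_nonneg) auto
  have m1: "(\<lambda>x :: real ^ 'd. x $ j) \<in> borel_measurable lborel"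
   and m2: "(\<lambda>x :: real ^ 'd. x $ j * x $ k) \<in> borel_measurable lborel" by measurable
  note g = gaussian_vec_moments(1,2)[OF s, where j = j] gaussian_vec_moments(3,4)[OF s, where j = j and k = k]
  show "integrable M (\<lambda>\<omega>. D \<omega> $ j)" using distributed_integrable[OF d m1 nn] g(1) by simp
  show "(\<integral>\<omega>. D \<omega> $ j \<partial>M) = 0" using distributed_integral[OF d m1 nn] g(2) by simp
  show "integrable M (\<lambda>\<omega>. D \<omega> $ j * D \<omega> $ k)" using distributed_integrable[OF d m2 nn] g(3) by simp
  show "(\<integral>\<omega>. D \<omega> $ j * D \<omega> $ k \<partial>M) = (if j = k then t - s else 0)"
  proof -
    have "(sqrt (t - s))\<^sup>2 = t - s" using assms(2) by simp
    then show ?thesis using distributed_integral[OF d m2 nn] g(4) by (simp only:)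
  qed
qed

lemma increment_indep_mult:
  fixes X :: "'a \<Rightarrow> real" and h :: "real ^ 'd \<Rightarrow> real"
  assumes st: "0 \<le> s" "s < t" "t \<le> T" and X: "X \<in> borel_measurable (F s)" "integrable M X"
    and h: "h \<in> borel_measurable borel" "integrable M (\<lambda>\<omega>. h (W t \<omega> - W s \<omega>))"
  shows "integrable M (\<lambda>\<omega>. X \<omega> * h (W t \<omega> - W s \<omega>))"
    and "(\<integral>\<omega>. X \<omega> * h (W t \<omega> - W s \<omega>) \<partial>M) = (\<integral>\<omega>. X \<omega> \<partial>M) * (\<integral>\<omega>. h (W t \<omega> - W s \<omega>) \<partial>M)"
proof -
  let ?D = "\<lambda>\<omega>. W t \<omega> - W s \<omega>"
  have "indep_var borel X borel (\<lambda>\<omega>. h (?D \<omega>))"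
    unfolding indep_var_eq
  proof (intro conjI)
    show "random_variable borel X" "random_variable borel (\<lambda>\<omega>. h (?D \<omega>))"
      using X h by (auto simp: borel_measurable_integrable)
    have sF: "space (F s) = space M" using F_space st by simp
    have 1: "sigma_sets (space M) {X -` A \<inter> space M |A. A \<in> sets borel} \<subseteq> sets (F s)"
    proof -
      have "{X -` A \<inter> space M |A. A \<in> sets borel} \<subseteq> sets (F s)"
        using X(1) sF by (auto simp: measurable_def)
      then show ?thesis using sets.sigma_sets_subset[of _ "F s"] sF by simp
    qed
    let ?V = "vimage_algebra (space M) ?D borel"
    have 2: "sigma_sets (space M) {(\<lambda>\<omega>. h (?D \<omega>)) -` A \<inter> space M |A. A \<in> sets borel} \<subseteq> sets ?V"
    proof -
      have "(\<lambda>\<omega>. h (?D \<omega>)) \<in> borel_measurable ?V"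
        using measurable_compose[OF measurable_vimage_algebra1 h(1), of ?D "space M"] by simp
      then have "{(\<lambda>\<omega>. h (?D \<omega>)) -` A \<inter> space M |A. A \<in> sets borel} \<subseteq> sets ?V"
        by (auto simp: measurable_def)
      then show ?thesis using sets.sigma_sets_subset[of _ ?V] by simp
    qed
    from W_indep[OF st] show "indep_set (sigma_sets (space M) {X -` A \<inter> space M |A. A \<in> sets borel})
       (sigma_sets (space M) {(\<lambda>\<omega>. h (?D \<omega>)) -` A \<inter> space M |A. A \<in> sets borel})"
      unfolding indep_set_def
      by (rule indep_sets_mono_sets) (use 1 2 in \<open>auto split: bool.split\<close>)
  qed
  from indep_var_integrable[OF this X(2) h(2)] indep_var_lebesgue_integral[OF this X(2) h(2)]
  show "integrable M (\<lambda>\<omega>. X \<omega> * h (W t \<omega> - W s \<omega>))"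
    and "(\<integral>\<omega>. X \<omega> * h (W t \<omega> - W s \<omega>) \<partial>M) = (\<integral>\<omega>. X \<omega> \<partial>M) * (\<integral>\<omega>. h (W t \<omega> - W s \<omega>) \<partial>M)"
    by auto
qed

text \<open>The first two conditional moments of an increment, in weak form: tested against integrable
  functions of the past.\<close>

lemma increment_test:
  fixes X :: "'a \<Rightarrow> real"
  assumes st: "0 \<le> s" "s < t" "t \<le> T" and X: "X \<in> borel_measurable (F s)" "integrable M X"
  defines "D \<equiv> \<lambda>\<omega>. W t \<omega> - W s \<omega>"
  shows "integrable M (\<lambda>\<omega>. X \<omega> * D \<omega> $ j)" "(\<integral>\<omega>. X \<omega> * D \<omega> $ j \<partial>M) = 0"
    "integrable M (\<lambda>\<omega>. X \<omega> * (D \<omega> $ j * D \<omega> $ k))"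
    "(\<integral>\<omega>. X \<omega> * (D \<omega> $ j * D \<omega> $ k) \<partial>M) = (if j = k then (t - s) * (\<integral>\<omega>. X \<omega> \<partial>M) else 0)"
  unfolding D_def
  using increment_indep_mult[OF st X, of "\<lambda>x. x $ j"] increment_indep_mult[OF st X, of "\<lambda>x. x $ j * x $ k"]
    increment_moments(1,2)[OF st, where j = j] increment_moments(3,4)[OF st, where j = j and k = k]
  by auto

text \<open>The It\^o isometry over one interval. Square integrability of \<open>X\<close> suffices in place of boundedness,
  because products of two such functions are integrable and can serve as test functions above.\<close>

lemma L2_inner_increment:
  assumes st: "0 \<le> s" "s \<le> t" "t \<le> T" and X: "X \<in> borel_measurable (F s)" "L2 M X"
  shows "L2 M (\<lambda>\<omega>. X \<omega> \<bullet> (W t \<omega> - W s \<omega>))"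
    and "\<And>V. V \<in> borel_measurable (F s) \<Longrightarrow> L2 M V \<Longrightarrow>
      (\<integral>\<omega>. (X \<omega> \<bullet> (W t \<omega> - W s \<omega>)) * (V \<omega> \<bullet> (W t \<omega> - W s \<omega>)) \<partial>M) = (t - s) * (\<integral>\<omega>. X \<omega> \<bullet> V \<omega> \<partial>M)"
    and "\<And>A. A \<in> borel_measurable (F s) \<Longrightarrow> L2 M A \<Longrightarrow> (\<integral>\<omega>. (X \<omega> \<bullet> (W t \<omega> - W s \<omega>)) * A \<omega> \<partial>M) = 0"
proof -
  let ?D = "\<lambda>\<omega>. W t \<omega> - W s \<omega>"
  consider "s = t" | "s < t" using st by linarith
  then have "L2 M (\<lambda>\<omega>. X \<omega> \<bullet> ?D \<omega>) \<and>
    (\<forall>V. V \<in> borel_measurable (F s) \<longrightarrow> L2 M V \<longrightarrow>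
      (\<integral>\<omega>. (X \<omega> \<bullet> ?D \<omega>) * (V \<omega> \<bullet> ?D \<omega>) \<partial>M) = (t - s) * (\<integral>\<omega>. X \<omega> \<bullet> V \<omega> \<partial>M)) \<and>
    (\<forall>A. A \<in> borel_measurable (F s) \<longrightarrow> L2 M A \<longrightarrow> (\<integral>\<omega>. (X \<omega> \<bullet> ?D \<omega>) * A \<omega> \<partial>M) = 0)"
  proof cases
    case 2
    have [measurable]: "s \<in> {0..T}" "t \<in> {0..T}" using st by auto
    have MX[measurable]: "X \<in> borel_measurable M" using X(2) by (rule L2_measurable)
    have pair: "integrable M (\<lambda>\<omega>. (X \<omega> \<bullet> ?D \<omega>) * (V \<omega> \<bullet> ?D \<omega>)) \<and>
        (\<integral>\<omega>. (X \<omega> \<bullet> ?D \<omega>) * (V \<omega> \<bullet> ?D \<omega>) \<partial>M) = (t - s) * (\<integral>\<omega>. X \<omega> \<bullet> V \<omega> \<partial>M)"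
      if V: "V \<in> borel_measurable (F s)" "L2 M V" for V
    proof -
      have e: "(X \<omega> \<bullet> ?D \<omega>) * (V \<omega> \<bullet> ?D \<omega>)
          = (\<Sum>j\<in>UNIV. \<Sum>k\<in>UNIV. (X \<omega> $ j * V \<omega> $ k) * (?D \<omega> $ j * ?D \<omega> $ k))" for \<omega>
        unfolding inner_vec_def sum_product by (intro sum.cong refl) (simp add: mult_ac)
      have m: "(\<lambda>\<omega>. X \<omega> $ j * V \<omega> $ k) \<in> borel_measurable (F s)" for j k
        using borel_measurable_vec_nth[OF X(1)] borel_measurable_vec_nth[OF V(1)] by simp
      have i: "integrable M (\<lambda>\<omega>. X \<omega> $ j * V \<omega> $ k)" for j k
        by (intro L2_mult_integrable L2_component X V)
      note t = increment_test(3,4)[OF st(1) 2 st(3) m i]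
      have "(\<integral>\<omega>. (X \<omega> \<bullet> ?D \<omega>) * (V \<omega> \<bullet> ?D \<omega>) \<partial>M)
          = (\<Sum>j\<in>UNIV. \<Sum>k\<in>UNIV. if j = k then (t - s) * (\<integral>\<omega>. X \<omega> $ j * V \<omega> $ k \<partial>M) else 0)"
        unfolding e by (simp add: t del: vector_minus_component)
      also have "\<dots> = (t - s) * (\<integral>\<omega>. X \<omega> \<bullet> V \<omega> \<partial>M)"
        using i by (simp add: inner_vec_def sum_distrib_left)
      finally show ?thesis unfolding e using t(1) by auto
    qed
    have "(\<integral>\<omega>. (X \<omega> \<bullet> ?D \<omega>) * A \<omega> \<partial>M) = 0" if A: "A \<in> borel_measurable (F s)" "L2 M A" for A
    proof -
      have e: "(X \<omega> \<bullet> ?D \<omega>) * A \<omega> = (\<Sum>j\<in>UNIV. (X \<omega> $ j * A \<omega>) * ?D \<omega> $ j)" for \<omega>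
        by (simp add: inner_vec_def sum_distrib_left mult_ac)
      have m: "(\<lambda>\<omega>. X \<omega> $ j * A \<omega>) \<in> borel_measurable (F s)" for j
        using borel_measurable_vec_nth[OF X(1)] A(1) by simp
      have i: "integrable M (\<lambda>\<omega>. X \<omega> $ j * A \<omega>)" for j
        by (intro L2_mult_integrable L2_component X A)
      note t = increment_test(1,2)[OF st(1) 2 st(3) m i]
      show ?thesis unfolding e by (simp add: t del: vector_minus_component)
    qed
    moreover have "L2 M (\<lambda>\<omega>. X \<omega> \<bullet> ?D \<omega>)"
      unfolding L2_def using pair[OF X] by (simp add: power2_eq_square)
    ultimately show ?thesis using pair by auto
  qed simp
  then show "L2 M (\<lambda>\<omega>. X \<omega> \<bullet> ?D \<omega>)"
    and "\<And>V. V \<in> borel_measurable (F s) \<Longrightarrow> L2 M V \<Longrightarrow>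
      (\<integral>\<omega>. (X \<omega> \<bullet> ?D \<omega>) * (V \<omega> \<bullet> ?D \<omega>) \<partial>M) = (t - s) * (\<integral>\<omega>. X \<omega> \<bullet> V \<omega> \<partial>M)"
    and "\<And>A. A \<in> borel_measurable (F s) \<Longrightarrow> L2 M A \<Longrightarrow> (\<integral>\<omega>. (X \<omega> \<bullet> ?D \<omega>) * A \<omega> \<partial>M) = 0"
    by auto
qed

lemma msq_inner_increment:
  assumes "0 \<le> s" "s \<le> t" "t \<le> T" "X \<in> borel_measurable (F s)" "L2 M X"
  shows "msq M (\<lambda>\<omega>. X \<omega> \<bullet> (W t \<omega> - W s \<omega>)) = (t - s) * msq M X"
  using L2_inner_increment(2)[OF assms assms(4,5)] by (simp add: flip: msq_inner_self)

end

section \<open>Time integrals\<close>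

text \<open>The domain of time-dependent processes on \<open>(a, b]\<close>. The interval is half-open like the pieces of a
  simple process, so that consecutive slabs are disjoint and cover.\<close>

definition slab :: "real \<Rightarrow> real \<Rightarrow> 'a measure \<Rightarrow> (real \<times> 'a) measure" where
  "slab a b M = restrict_space (lborel \<Otimes>\<^sub>M M) ({a<..b} \<times> space M)"

lemma slab_set: "({a<..b::real} \<times> space M) \<inter> space (lborel \<Otimes>\<^sub>M M) \<in> sets (lborel \<Otimes>\<^sub>M M)"
  by simp

lemma space_slab: "space (slab a b M) = {a<..b} \<times> space M"
  by (auto simp: slab_def space_restrict_space space_pair_measure)

lemma slab_fst [measurable]: "fst \<in> borel_measurable (slab a b M)"
  unfolding slab_def by (rule measurable_restrict_space1) simp

lemma slab_snd [measurable]: "snd \<in> measurable (slab a b M) M"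
  unfolding slab_def by (rule measurable_restrict_space1) simp

lemma slab_mono_measurable:
  "a \<le> a' \<Longrightarrow> b' \<le> b \<Longrightarrow> f \<in> measurable (slab a b M) N \<Longrightarrow> f \<in> measurable (slab a' b' M) N"
proof -
  assume "a \<le> a'" "b' \<le> b" and f: "f \<in> measurable (slab a b M) N"
  have "slab a' b' M = restrict_space (slab a b M) ({a'<..b'} \<times> space M)"
    unfolding slab_def using \<open>a \<le> a'\<close> \<open>b' \<le> b\<close>
    by (subst restrict_restrict_space) (auto intro!: arg_cong2[where f = restrict_space])
  then show ?thesis using measurable_restrict_space1[OF f] by simp
qed

lemma progressive_measurable_slab:
  fixes H :: "real \<Rightarrow> 'a \<Rightarrow> 'b::euclidean_space"
  assumes "progressive T F H" "subalgebra M (F T)" "0 \<le> T"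
  shows "(\<lambda>(s, \<omega>). H s \<omega>) \<in> borel_measurable (slab 0 T M)"
proof -
  have "(\<lambda>(s, \<omega>). H s \<omega>) \<in> borel_measurable (restrict_space borel {0..T} \<Otimes>\<^sub>M F T)"
    using assms by (auto simp: progressive_def)
  moreover have "(\<lambda>q. (fst q, snd q)) \<in> measurable (slab 0 T M) (restrict_space borel {0..T} \<Otimes>\<^sub>M F T)"
  proof (rule measurable_Pair)
    show "fst \<in> measurable (slab 0 T M) (restrict_space borel {0..T})"
      by (rule measurable_restrict_space2) (auto simp: space_slab)
    show "snd \<in> measurable (slab 0 T M) (F T)"
      using slab_snd[of 0 T M] assms(2)
      by (auto simp: measurable_def subalgebra_def)
  qed
  ultimately show ?thesis
    using measurable_compose by (fastforce simp: case_prod_unfold)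
qed

lemma (in prob_space) pair_lborel: "pair_sigma_finite (lborel :: real measure) M"
  by (simp add: pair_sigma_finite_def sigma_finite_lborel sigma_finite_measure_axioms)

lemma (in prob_space) nn_integral_slab:
  assumes f: "f \<in> borel_measurable (slab a b M)"
  shows "(\<integral>\<^sup>+q. f q \<partial>slab a b M) = (\<integral>\<^sup>+\<omega>. (\<integral>\<^sup>+s\<in>{a<..b}. f (s, \<omega>) \<partial>lborel) \<partial>M)"
    and "(\<lambda>\<omega>. \<integral>\<^sup>+s\<in>{a<..b}. f (s, \<omega>) \<partial>lborel) \<in> borel_measurable M"
proof -
  interpret pair_sigma_finite "lborel :: real measure" M by (rule pair_lborel)
  have m: "(\<lambda>q. f q * indicator ({a<..b} \<times> space M) q) \<in> borel_measurable (lborel \<Otimes>\<^sub>M M)"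
    using f unfolding slab_def by (subst (asm) borel_measurable_restrict_space_iff_ennreal[OF slab_set])
  have c: "(\<integral>\<^sup>+s. f (s, \<omega>) * indicator ({a<..b} \<times> space M) (s, \<omega>) \<partial>lborel)
      = (\<integral>\<^sup>+s\<in>{a<..b}. f (s, \<omega>) \<partial>lborel)" if "\<omega> \<in> space M" for \<omega>
    using that by (intro nn_integral_cong) (auto split: split_indicator)
  have "(\<integral>\<^sup>+q. f q \<partial>slab a b M) = (\<integral>\<^sup>+q. f q * indicator ({a<..b} \<times> space M) q \<partial>(lborel \<Otimes>\<^sub>M M))"
    unfolding slab_def by (rule nn_integral_restrict_space[OF slab_set])
  also have "\<dots> = (\<integral>\<^sup>+\<omega>. (\<integral>\<^sup>+s. f (s, \<omega>) * indicator ({a<..b} \<times> space M) (s, \<omega>) \<partial>lborel) \<partial>M)"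
    using nn_integral_snd[OF m] by simp
  also have "\<dots> = (\<integral>\<^sup>+\<omega>. (\<integral>\<^sup>+s\<in>{a<..b}. f (s, \<omega>) \<partial>lborel) \<partial>M)"
    by (rule nn_integral_cong) (rule c)
  finally show "(\<integral>\<^sup>+q. f q \<partial>slab a b M) = (\<integral>\<^sup>+\<omega>. (\<integral>\<^sup>+s\<in>{a<..b}. f (s, \<omega>) \<partial>lborel) \<partial>M)" .
  have "(\<lambda>\<omega>. \<integral>\<^sup>+s. f (s, \<omega>) * indicator ({a<..b} \<times> space M) (s, \<omega>) \<partial>lborel) \<in> borel_measurable M"
    using m by measurable
  then show "(\<lambda>\<omega>. \<integral>\<^sup>+s\<in>{a<..b}. f (s, \<omega>) \<partial>lborel) \<in> borel_measurable M"
    using c by (subst (asm) measurable_cong) auto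
qed

lemma nn_integral_Ioc_Icc:
  "(\<integral>\<^sup>+s\<in>{a<..b::real}. f s \<partial>lborel) = (\<integral>\<^sup>+s\<in>{a..b}. f s \<partial>lborel)"
proof (rule nn_integral_cong_AE)
  show "AE s in lborel. f s * indicator {a<..b} s = f s * indicator {a..b} s"
    using AE_lborel_singleton[of a] by eventually_elim (auto split: split_indicator)
qed

lemma (in prob_space) nn_integral_slab_Icc:
  assumes f: "f \<in> borel_measurable (slab a b M)"
  shows "(\<integral>\<^sup>+\<omega>. (\<integral>\<^sup>+s\<in>{a..b}. f (s, \<omega>) \<partial>lborel) \<partial>M) = (\<integral>\<^sup>+q. f q \<partial>slab a b M)"
    and "(\<lambda>\<omega>. \<integral>\<^sup>+s\<in>{a..b}. f (s, \<omega>) \<partial>lborel) \<in> borel_measurable M"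
  using nn_integral_slab[OF f] by (simp_all add: nn_integral_Ioc_Icc)

lemma (in prob_space) emeasure_slab: "a \<le> b \<Longrightarrow> emeasure (slab a b M) (space (slab a b M)) = ennreal (b - a)"
proof -
  assume "a \<le> b"
  have "emeasure (slab a b M) (space (slab a b M)) = (\<integral>\<^sup>+q. 1 \<partial>slab a b M)" by simp
  also have "\<dots> = (\<integral>\<^sup>+\<omega>. ennreal (b - a) \<partial>M)"
    using \<open>a \<le> b\<close> by (subst nn_integral_slab) auto
  finally show ?thesis by (simp add: emeasure_space_1)
qed

lemma (in prob_space) finite_measure_slab: "finite_measure (slab a b M)"
proof (cases "a \<le> b")
  case True
  show ?thesis by (rule finite_measureI) (simp add: emeasure_slab[OF True])
next
  case False
  then have "space (slab a b M) = {}" by (simp add: space_slab)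
  then show ?thesis by (intro finite_measureI) simp
qed

lemma slab_integral_sub:
  fixes f :: "real \<times> 'a \<Rightarrow> 'b::euclidean_space"
  assumes "c \<le> a" "b \<le> d"
  shows "(\<integral>q. indicator {a<..b} (fst q) *\<^sub>R f q \<partial>slab c d M) = (\<integral>q. f q \<partial>slab a b M)"
  unfolding slab_def integral_restrict_space[OF slab_set]
  using assms by (intro Bochner_Integration.integral_cong) (auto split: split_indicator)

lemma (in prob_space) slab_integral_const:
  fixes f :: "'a \<Rightarrow> real"
  assumes "a \<le> b" "integrable M f"
  shows "integrable (slab a b M) (\<lambda>q. f (snd q))" "(\<integral>q. f (snd q) \<partial>slab a b M) = (b - a) * (\<integral>\<omega>. f \<omega> \<partial>M)"
proof -
  note [measurable] = borel_measurable_integrable[OF assms(2)]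
  have nn: "(\<integral>\<^sup>+q. ennreal (g (snd q)) \<partial>slab a b M) = ennreal (b - a) * (\<integral>\<^sup>+\<omega>. ennreal (g \<omega>) \<partial>M)"
    if [measurable]: "g \<in> borel_measurable M" for g :: "'a \<Rightarrow> real"
  proof -
    have "(\<lambda>q. ennreal (g (snd q))) \<in> borel_measurable (slab a b M)" by measurable
    then have "(\<integral>\<^sup>+q. ennreal (g (snd q)) \<partial>slab a b M) = (\<integral>\<^sup>+\<omega>. (\<integral>\<^sup>+s\<in>{a<..b}. ennreal (g \<omega>) \<partial>lborel) \<partial>M)"
      by (subst nn_integral_slab) auto
    also have "\<dots> = (\<integral>\<^sup>+\<omega>. ennreal (b - a) * ennreal (g \<omega>) \<partial>M)"
      using \<open>a \<le> b\<close> by (simp add: nn_integral_cmult_indicator mult.commute)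
    also have "\<dots> = ennreal (b - a) * (\<integral>\<^sup>+\<omega>. ennreal (g \<omega>) \<partial>M)"
      by (rule nn_integral_cmult) simp
    finally show ?thesis .
  qed
  show i: "integrable (slab a b M) (\<lambda>q. f (snd q))"
    using nn[of "\<lambda>\<omega>. norm (f \<omega>)"] assms(2)
    by (auto simp: integrable_iff_bounded ennreal_mult_less_top)
  show "(\<integral>q. f (snd q) \<partial>slab a b M) = (b - a) * (\<integral>\<omega>. f \<omega> \<partial>M)"
    unfolding real_lebesgue_integral_def[OF i] real_lebesgue_integral_def[OF assms(2)]
    using nn[of f] nn[of "\<lambda>\<omega>. - f \<omega>"] \<open>a \<le> b\<close> by (simp add: enn2real_mult algebra_simps)
qed

lemma (in prob_space) slab_L2_const:
  assumes "a \<le> b" "L2 M X"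
  shows "L2 (slab a b M) (\<lambda>q. X (snd q))" "msq (slab a b M) (\<lambda>q. X (snd q)) = (b - a) * msq M X"
  using slab_integral_const[OF assms(1) L2_sq_integrable[OF assms(2)]] L2_measurable[OF assms(2)]
  by (auto simp: L2_def msq_def)

lemma slab_integrable_sub:
  fixes f :: "real \<times> 'a \<Rightarrow> 'b::euclidean_space"
  assumes "c \<le> a" "b \<le> d" "integrable (slab c d M) f"
  shows "integrable (slab a b M) f"
proof -
  have "integrable (lborel \<Otimes>\<^sub>M M) (\<lambda>q. indicator ({c<..d} \<times> space M) q *\<^sub>R f q)"
    using assms(3) unfolding slab_def by (subst (asm) integrable_restrict_space[OF slab_set])
  then have "integrable (lborel \<Otimes>\<^sub>M M)
      (\<lambda>q. indicator ({a<..b} \<times> space M) q *\<^sub>R (indicator ({c<..d} \<times> space M) q *\<^sub>R f q))"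
    by (rule integrable_mult_indicator[rotated]) simp
  also have "(\<lambda>q. indicator ({a<..b} \<times> space M) q *\<^sub>R (indicator ({c<..d} \<times> space M) q *\<^sub>R f q))
      = (\<lambda>q. indicator ({a<..b} \<times> space M) q *\<^sub>R f q)"
    using assms(1,2) by (auto simp: fun_eq_iff split: split_indicator)
  finally show ?thesis
    unfolding slab_def by (subst integrable_restrict_space[OF slab_set])
qed

lemma slab_L2_sub: "c \<le> a \<Longrightarrow> b \<le> d \<Longrightarrow> L2 (slab c d M) H \<Longrightarrow> L2 (slab a b M) H"
  unfolding L2_def using slab_mono_measurable slab_integrable_sub by blast

lemma slab_L2_indicator:
  fixes H :: "real \<times> 'a \<Rightarrow> 'b::euclidean_space"
  assumes "L2 (slab c d M) H"
  shows "L2 (slab c d M) (\<lambda>q. indicator {a<..b} (fst q) *\<^sub>R H q)"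
  by (rule L2_bounded_mult[OF assms, of _ 1]) (auto split: split_indicator)

lemma slab_msq_indicator:
  fixes H :: "real \<times> 'a \<Rightarrow> 'b::euclidean_space"
  assumes "c \<le> a" "b \<le> d"
  shows "msq (slab c d M) (\<lambda>q. indicator {a<..b} (fst q) *\<^sub>R H q) = msq (slab a b M) H"
proof -
  have "msq (slab c d M) (\<lambda>q. indicator {a<..b} (fst q) *\<^sub>R H q)
      = (\<integral>q. indicator {a<..b} (fst q) *\<^sub>R (norm (H q))\<^sup>2 \<partial>slab c d M)"
    unfolding msq_def by (intro Bochner_Integration.integral_cong) (auto split: split_indicator)
  then show ?thesis unfolding slab_integral_sub[OF assms] by (simp add: msq_def)
qed

lemma slab_msq_mono:
  fixes H :: "real \<times> 'a \<Rightarrow> 'b::euclidean_space"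
  assumes "c \<le> a" "b \<le> d" "L2 (slab c d M) H"
  shows "msq (slab a b M) H \<le> msq (slab c d M) H"
  unfolding slab_msq_indicator[OF assms(1,2), symmetric]
  by (rule msq_mono[OF assms(3)]) (auto split: split_indicator)

lemma slab_msq_sum_le:
  fixes H :: "real \<times> 'a \<Rightarrow> 'b::euclidean_space" and t :: "nat \<Rightarrow> real"
  assumes t: "\<And>i j. i \<le> j \<Longrightarrow> j \<le> N \<Longrightarrow> t i \<le> t j" and H: "L2 (slab (t 0) (t N) M) H"
  shows "(\<Sum>i<N. msq (slab (t i) (t (Suc i)) M) H) \<le> msq (slab (t 0) (t N) M) H"
proof -
  have disj: "(\<Sum>i<n. indicator {t i<..t (Suc i)} u) = (indicator {t 0<..t n} u :: real)" if "n \<le> N" for u n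
    using that
  proof (induction n)
    case (Suc n)
    then show ?case using t[of 0 n] t[of n "Suc n"] by (auto split: split_indicator)
  qed simp
  have "(\<Sum>i<N. msq (slab (t i) (t (Suc i)) M) H)
      = (\<Sum>i<N. \<integral>q. indicator {t i<..t (Suc i)} (fst q) *\<^sub>R (norm (H q))\<^sup>2 \<partial>slab (t 0) (t N) M)"
    using t by (intro sum.cong refl, subst slab_integral_sub) (auto simp: msq_def)
  also have "\<dots> = (\<integral>q. (\<Sum>i<N. indicator {t i<..t (Suc i)} (fst q) *\<^sub>R (norm (H q))\<^sup>2) \<partial>slab (t 0) (t N) M)"
  proof (rule Bochner_Integration.integral_sum[symmetric])
    fix i
    have [measurable]: "fst -` {t i<..t (Suc i)} \<inter> space (slab (t 0) (t N) M) \<in> sets (slab (t 0) (t N) M)"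
      by (rule measurable_sets[OF slab_fst]) simp
    have "integrable (slab (t 0) (t N) M)
      (\<lambda>q. indicator (fst -` {t i<..t (Suc i)} \<inter> space (slab (t 0) (t N) M)) q *\<^sub>R (norm (H q))\<^sup>2)"
      by (rule integrable_mult_indicator[OF _ L2_sq_integrable[OF H]]) simp
    then show "integrable (slab (t 0) (t N) M) (\<lambda>q. indicator {t i<..t (Suc i)} (fst q) *\<^sub>R (norm (H q))\<^sup>2)"
      by (rule Bochner_Integration.integrable_cong[THEN iffD1, rotated 2]) (auto split: split_indicator)
  qed
  also have "\<dots> = (\<integral>q. (\<Sum>i<N. indicator {t i<..t (Suc i)} (fst q)) * (norm (H q))\<^sup>2 \<partial>slab (t 0) (t N) M)"
    by (simp add: sum_distrib_right)
  also have "\<dots> = msq (slab (t 0) (t N) M) H"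
    unfolding disj[OF order_refl] msq_def
    by (intro Bochner_Integration.integral_cong) (auto simp: space_slab split: split_indicator)
  finally show ?thesis by simp
qed

definition time_integral :: "real \<Rightarrow> real \<Rightarrow> (real \<Rightarrow> 'a \<Rightarrow> 'b::euclidean_space) \<Rightarrow> 'a \<Rightarrow> 'b" where
  "time_integral a b H \<omega> = (LINT s:{a..b}|lborel. H s \<omega>)"

lemma set_integral_Ioc_Icc:
  fixes f :: "real \<Rightarrow> 'b::euclidean_space"
  assumes "f \<in> borel_measurable lborel \<or> set_borel_measurable lborel {a<..b} f"
  shows "(LINT s:{a..b}|lborel. f s) = (LINT s:{a<..b}|lborel. f s)"
proof -
  have ae: "AE s in lborel. indicator {a..b} s *\<^sub>R f s = indicator {a<..b} s *\<^sub>R f s"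
    using AE_lborel_singleton[of a] by eventually_elim (auto split: split_indicator)
  have m: "(\<lambda>s. indicator {a<..b} s *\<^sub>R f s) \<in> borel_measurable lborel"
    using assms by (auto simp: set_borel_measurable_def)
  have "(\<lambda>s. indicator {a..b} s *\<^sub>R f s) = (\<lambda>s. indicator {a<..b} s *\<^sub>R f s + indicator ({a} \<inter> {a..b}) s *\<^sub>R f a)"
    by (auto simp: fun_eq_iff split: split_indicator)
  then have "(\<lambda>s. indicator {a..b} s *\<^sub>R f s) \<in> borel_measurable lborel"
    using m by simp
  then show ?thesis
    unfolding set_lebesgue_integral_def using m ae by (intro integral_cong_AE) auto
qed

text \<open>Fubini's theorem for path integrals. In the last part the expectation of a path integral against a
  test function becomes an integral over the slab; this pairing determines its mean square and its conditional expectations.\<close>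

lemma (in prob_space) time_integral_basic:
  fixes H :: "real \<Rightarrow> 'a \<Rightarrow> 'b::euclidean_space"
  assumes H: "L2 (slab a b M) (\<lambda>(s, \<omega>). H s \<omega>)"
  shows "time_integral a b H \<in> borel_measurable M"
    and "AE \<omega> in M. set_integrable lborel {a..b} (\<lambda>s. H s \<omega>)"
    and "\<And>V. L2 M V \<Longrightarrow> integrable M (\<lambda>\<omega>. V \<omega> \<bullet> time_integral a b H \<omega>)"
    and "\<And>V. L2 M V \<Longrightarrow> (\<integral>\<omega>. V \<omega> \<bullet> time_integral a b H \<omega> \<partial>M) = (\<integral>q. V (snd q) \<bullet> H (fst q) (snd q) \<partial>slab a b M)"
proof -
  interpret S: pair_sigma_finite M "lborel :: real measure"
    by (simp add: pair_sigma_finite_def sigma_finite_lborel sigma_finite_measure_axioms)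
  interpret R: pair_sigma_finite "lborel :: real measure" M by (rule pair_lborel)
  define g where "g = (\<lambda>(\<omega>, s). indicator {a<..b} s *\<^sub>R H s \<omega>)"
  have swap: "integrable (M \<Otimes>\<^sub>M lborel) (\<lambda>(\<omega>, s). indicator {a<..b} s *\<^sub>R f s \<omega>) \<and>
      (\<integral>q. f (fst q) (snd q) \<partial>slab a b M) = integral\<^sup>L (M \<Otimes>\<^sub>M lborel) (\<lambda>(\<omega>, s). indicator {a<..b} s *\<^sub>R f s \<omega>)"
    if f: "integrable (slab a b M) (\<lambda>q. f (fst q) (snd q))" for f :: "real \<Rightarrow> 'a \<Rightarrow> 'c::euclidean_space"
  proof -
    let ?h = "\<lambda>q. indicator ({a<..b} \<times> space M) q *\<^sub>R f (fst q) (snd q)"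
    have i: "integrable (lborel \<Otimes>\<^sub>M M) ?h"
      using f unfolding slab_def by (subst (asm) integrable_restrict_space[OF slab_set])
    have c: "(\<lambda>(\<omega>, s). ?h (s, \<omega>)) q = (\<lambda>(\<omega>, s). indicator {a<..b} s *\<^sub>R f s \<omega>) q"
      if "q \<in> space (M \<Otimes>\<^sub>M lborel)" for q
      using that by (auto simp: space_pair_measure split: split_indicator)
    have "(\<integral>q. f (fst q) (snd q) \<partial>slab a b M) = integral\<^sup>L (lborel \<Otimes>\<^sub>M M) ?h"
      unfolding slab_def by (rule integral_restrict_space[OF slab_set])
    also have "\<dots> = integral\<^sup>L (M \<Otimes>\<^sub>M lborel) (\<lambda>(\<omega>, s). ?h (s, \<omega>))"
      using R.integral_product_swap[of ?h] borel_measurable_integrable[OF i] by simp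
    also have "\<dots> = integral\<^sup>L (M \<Otimes>\<^sub>M lborel) (\<lambda>(\<omega>, s). indicator {a<..b} s *\<^sub>R f s \<omega>)"
      by (intro Bochner_Integration.integral_cong c refl)
    finally have "(\<integral>q. f (fst q) (snd q) \<partial>slab a b M)
      = integral\<^sup>L (M \<Otimes>\<^sub>M lborel) (\<lambda>(\<omega>, s). indicator {a<..b} s *\<^sub>R f s \<omega>)" .
    moreover have "integrable (M \<Otimes>\<^sub>M lborel) (\<lambda>(\<omega>, s). ?h (s, \<omega>))"
      using R.integrable_product_swap[OF i] by simp
    then have "integrable (M \<Otimes>\<^sub>M lborel) (\<lambda>(\<omega>, s). indicator {a<..b} s *\<^sub>R f s \<omega>)"
      by (rule Bochner_Integration.integrable_cong[THEN iffD1, rotated 2]) (auto simp only: c)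
    ultimately show ?thesis by blast
  qed
  have iH: "integrable (slab a b M) (\<lambda>q. H (fst q) (snd q))"
    using L2_integrable[OF finite_measure_slab H] by (simp add: case_prod_unfold)
  have ig: "integrable (M \<Otimes>\<^sub>M lborel) g"
    using swap[OF iH] by (simp add: g_def)
  note [measurable] = borel_measurable_integrable[OF ig]
  have sec: "set_borel_measurable lborel {a<..b} (\<lambda>s. H s \<omega>)" if "\<omega> \<in> space M" for \<omega>
    using measurable_Pair2[OF borel_measurable_integrable[OF ig] that]
    by (simp add: g_def set_borel_measurable_def)
  have eq: "time_integral a b H \<omega> = (\<integral>s. g (\<omega>, s) \<partial>lborel)" if "\<omega> \<in> space M" for \<omega>
    using set_integral_Ioc_Icc[OF disjI2[OF sec[OF that]]]
    by (simp add: time_integral_def g_def set_lebesgue_integral_def)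
  have "(\<lambda>\<omega>. \<integral>s. g (\<omega>, s) \<partial>lborel) \<in> borel_measurable M" by measurable
  then show mt: "time_integral a b H \<in> borel_measurable M"
    by (subst measurable_cong[OF eq])
  have ae: "AE \<omega> in M. integrable lborel (\<lambda>s. g (\<omega>, s))"
    using S.AE_integrable_fst'[OF ig] .
  then show "AE \<omega> in M. set_integrable lborel {a..b} (\<lambda>s. H s \<omega>)"
  proof eventually_elim
    case (elim \<omega>)
    have "(\<lambda>s. indicator {a..b} s *\<^sub>R H s \<omega>) = (\<lambda>s. g (\<omega>, s) + indicator ({a} \<inter> {a..b}) s *\<^sub>R H a \<omega>)"
      by (auto simp: g_def fun_eq_iff split: split_indicator)
    moreover have "integrable lborel (\<lambda>s. indicator ({a} \<inter> {a..b}) s *\<^sub>R H a \<omega>)"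
    proof (rule integrable_real_indicator[THEN integrable_scaleR_left])
      show "{a} \<inter> {a..b} \<in> sets lborel" by simp
      have "emeasure lborel ({a} \<inter> {a..b}) \<le> emeasure lborel {a}" by (rule emeasure_mono) auto
      then show "emeasure lborel ({a} \<inter> {a..b}) < \<infinity>" by simp
    qed
    ultimately show ?case
      unfolding set_integrable_def using elim by simp
  qed
  fix V :: "'a \<Rightarrow> 'b" assume V: "L2 M V"
  show "integrable M (\<lambda>\<omega>. V \<omega> \<bullet> time_integral a b H \<omega>)"
   and "(\<integral>\<omega>. V \<omega> \<bullet> time_integral a b H \<omega> \<partial>M) = (\<integral>q. V (snd q) \<bullet> H (fst q) (snd q) \<partial>slab a b M)"
  proof -
    note [measurable] = L2_measurable[OF V]
    have "integrable (slab a b M) (\<lambda>q. V (snd q) \<bullet> H (fst q) (snd q))"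
    proof (cases "a \<le> b")
      case True
      then show ?thesis
        using L2_inner_integrable[OF slab_L2_const(1)[OF True V] H] by (simp add: case_prod_unfold)
    next
      case False
      have "space (slab a b M) = {}" using False by (simp add: space_slab)
      then show ?thesis
        by (subst Bochner_Integration.integrable_cong[OF refl, of _ _ "\<lambda>_. 0"]) auto
    qed
    note sw = swap[OF this]
    have e: "AE \<omega> in M. (\<integral>s. indicator {a<..b} s *\<^sub>R (V \<omega> \<bullet> H s \<omega>) \<partial>lborel) = V \<omega> \<bullet> time_integral a b H \<omega>"
      using ae AE_space
    proof eventually_elim
      case (elim \<omega>)
      have "(\<integral>s. indicator {a<..b} s *\<^sub>R (V \<omega> \<bullet> H s \<omega>) \<partial>lborel) = (\<integral>s. V \<omega> \<bullet> g (\<omega>, s) \<partial>lborel)"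
        by (simp add: g_def)
      also have "\<dots> = V \<omega> \<bullet> time_integral a b H \<omega>"
        using elim by (simp add: eq)
      finally show ?case .
    qed
    let ?k = "\<lambda>(\<omega>, s). indicator {a<..b} s *\<^sub>R (V \<omega> \<bullet> H s \<omega>)"
    have i1: "integrable M (\<lambda>\<omega>. \<integral>s. ?k (\<omega>, s) \<partial>lborel)"
      using S.integrable_fst'[OF conjunct1[OF sw]] by simp
    have m1: "(\<lambda>\<omega>. V \<omega> \<bullet> time_integral a b H \<omega>) \<in> borel_measurable M"
      using mt by measurable
    show "integrable M (\<lambda>\<omega>. V \<omega> \<bullet> time_integral a b H \<omega>)"
      by (rule integrable_cong_AE[THEN iffD1, OF borel_measurable_integrable[OF i1] m1 _ i1]) (use e in simp)
    have "(\<integral>\<omega>. V \<omega> \<bullet> time_integral a b H \<omega> \<partial>M) = (\<integral>\<omega>. (\<integral>s. ?k (\<omega>, s) \<partial>lborel) \<partial>M)"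
      by (rule integral_cong_AE[OF m1 borel_measurable_integrable[OF i1]]) (use e in auto)
    also have "\<dots> = integral\<^sup>L (M \<Otimes>\<^sub>M lborel) ?k"
      using S.integral_fst'[OF conjunct1[OF sw]] .
    finally show "(\<integral>\<omega>. V \<omega> \<bullet> time_integral a b H \<omega> \<partial>M) = (\<integral>q. V (snd q) \<bullet> H (fst q) (snd q) \<partial>slab a b M)"
      using sw by simp
  qed
qed

text \<open>By duality: \<open>I\<close> is tested against its own truncations, and the pairing is estimated over the slab,
  where the mean square of a function of \<open>\<omega>\<close> is \<open>b - a\<close> times its mean square over \<open>\<Omega>\<close>.\<close>

lemma (in prob_space) time_integral_L2:
  fixes H :: "real \<Rightarrow> 'a \<Rightarrow> 'b::euclidean_space"
  assumes "a < b" and H: "L2 (slab a b M) (\<lambda>(s, \<omega>). H s \<omega>)"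
  shows "L2 M (time_integral a b H)"
    and "msq M (time_integral a b H) \<le> (b - a) * msq (slab a b M) (\<lambda>(s, \<omega>). H s \<omega>)"
proof -
  let ?I = "time_integral a b H" and ?m = "msq (slab a b M) (\<lambda>(s, \<omega>). H s \<omega>)"
  have m[measurable]: "?I \<in> borel_measurable M" by (rule time_integral_basic(1)[OF H])
  have test: "2 * (\<integral>\<omega>. V \<omega> \<bullet> ?I \<omega> \<partial>M) \<le> msq M V + (b - a) * ?m" if V: "L2 M V" for V
  proof -
    have "2 * (\<integral>\<omega>. V \<omega> \<bullet> ?I \<omega> \<partial>M) \<le> 1 / (b - a) * msq (slab a b M) (\<lambda>q. V (snd q)) + ?m / (1 / (b - a))"
      unfolding time_integral_basic(4)[OF H V]
      using inner_le_msq[OF slab_L2_const(1)[of a b, OF _ V] H, of "1 / (b - a)"] \<open>a < b\<close>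
      by (simp add: case_prod_unfold)
    then show ?thesis
      using \<open>a < b\<close> slab_L2_const(2)[of a b, OF _ V] by (simp add: mult.commute)
  qed
  show L: "L2 M ?I"
  proof (rule L2_by_truncation[OF m borel_measurable_const[of 0] finite_measure_axioms])
    fix n :: nat
    let ?S = "{\<omega>. norm (?I \<omega>) \<le> real n \<and> norm (0::real) \<le> real n}"
    let ?V = "\<lambda>\<omega>. indicator ?S \<omega> *\<^sub>R ?I \<omega>"
    have [measurable]: "?V \<in> borel_measurable M" by measurable
    have V: "L2 M ?V"
      by (rule L2_dominated[OF L2_const[OF finite_measure_axioms, of "real n"], where C = 1])
         (auto split: split_indicator)
    have "(\<integral>\<omega>. ?V \<omega> \<bullet> ?I \<omega> \<partial>M) = msq M ?V"
      unfolding msq_def by (intro Bochner_Integration.integral_cong) (auto simp: power2_norm_eq_inner split: split_indicator)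
    with test[OF V] show "msq M ?V \<le> (b - a) * ?m" by simp
  qed
  show "msq M ?I \<le> (b - a) * ?m"
    using test[OF L] by (simp add: msq_inner_self)
qed

section \<open>The isometry of the It\^o integral\<close>

definition elementary :: "real \<Rightarrow> real \<Rightarrow> ('a \<Rightarrow> 'b::real_vector) \<Rightarrow> real \<times> 'a \<Rightarrow> 'b" where
  "elementary a b \<xi> = (\<lambda>(s, \<omega>). indicator {a<..b} s *\<^sub>R \<xi> \<omega>)"

lemma grid_mono:
  fixes t :: "nat \<Rightarrow> real"
  assumes step: "\<And>k. k < n \<Longrightarrow> t k < t (Suc k)" and "i \<le> j" "j \<le> n"
  shows "t i \<le> t j"
  using assms(2,3)
proof (induction j rule: dec_induct)
  case (step m)
  then show ?case using assms(1)[of m] by fastforce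
qed simp

context brownian_space
begin

lemma elementary_L2:
  fixes \<xi> :: "'a \<Rightarrow> 'b::euclidean_space"
  assumes "L2 M \<xi>" shows "L2 (slab 0 T M) (elementary a b \<xi>)"
proof -
  have "elementary a b \<xi> = (\<lambda>q. indicator {a<..b} (fst q) *\<^sub>R \<xi> (snd q))"
    by (auto simp: elementary_def)
  then show ?thesis
    using slab_L2_indicator[OF slab_L2_const(1)[of 0 T, OF _ assms]] T_pos by simp
qed

lemma elementary_inner:
  fixes \<xi> \<zeta> :: "'a \<Rightarrow> 'b::euclidean_space"
  assumes "0 \<le> a" "b \<le> T" "0 \<le> c" "d \<le> T" "L2 M \<xi>" "L2 M \<zeta>"
  shows "(\<integral>q. elementary a b \<xi> q \<bullet> elementary c d \<zeta> q \<partial>slab 0 T M) = max 0 (min b d - max a c) * (\<integral>\<omega>. \<xi> \<omega> \<bullet> \<zeta> \<omega> \<partial>M)"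
proof -
  have "(\<integral>q. elementary a b \<xi> q \<bullet> elementary c d \<zeta> q \<partial>slab 0 T M)
      = (\<integral>q. indicator {max a c<..min b d} (fst q) *\<^sub>R (\<xi> (snd q) \<bullet> \<zeta> (snd q)) \<partial>slab 0 T M)"
    by (intro Bochner_Integration.integral_cong) (auto simp: elementary_def split: split_indicator)
  also have "\<dots> = (\<integral>q. \<xi> (snd q) \<bullet> \<zeta> (snd q) \<partial>slab (max a c) (min b d) M)"
    using assms by (intro slab_integral_sub) auto
  also have "\<dots> = max 0 (min b d - max a c) * (\<integral>\<omega>. \<xi> \<omega> \<bullet> \<zeta> \<omega> \<partial>M)"
  proof (cases "max a c \<le> min b d")
    case True
    then show ?thesis
      using slab_integral_const(2)[OF True L2_inner_integrable[OF assms(5,6)]] by simp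
  next
    case False
    then have "(\<integral>q. \<xi> (snd q) \<bullet> \<zeta> (snd q) \<partial>slab (max a c) (min b d) M)
        = (\<integral>q. 0 \<partial>slab (max a c) (min b d) M)"
      by (intro Bochner_Integration.integral_cong) (auto simp: space_slab)
    moreover have "max 0 (min b d - max a c) = 0" using False by linarith
    ultimately show ?thesis by (simp only: Bochner_Integration.integral_zero mult_zero_left)
  qed
  finally show ?thesis .
qed

text \<open>Increments over disjoint intervals are orthogonal, because the later one has mean zero given the
  past. Overlapping intervals are cut so that only a common piece is left.\<close>

lemma elementary_isometry:
  assumes ab: "0 \<le> a" "a \<le> b" "b \<le> T" and cd: "0 \<le> c" "c \<le> d" "d \<le> T"
    and \<xi>: "\<xi> \<in> borel_measurable (F a)" "L2 M \<xi>" and \<zeta>: "\<zeta> \<in> borel_measurable (F c)" "L2 M \<zeta>"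
  shows "(\<integral>\<omega>. (\<xi> \<omega> \<bullet> (W b \<omega> - W a \<omega>)) * (\<zeta> \<omega> \<bullet> (W d \<omega> - W c \<omega>)) \<partial>M)
    = (\<integral>q. elementary a b \<xi> q \<bullet> elementary c d \<zeta> q \<partial>slab 0 T M)"
proof -
  define J where "J = (\<lambda>\<xi> a b \<omega>. (\<xi> \<omega> :: real ^ 'd) \<bullet> (W b \<omega> - W a \<omega>))"
  have JL: "L2 M (J \<xi> a b)" if "0 \<le> c" "c \<le> a" "a \<le> b" "b \<le> T" "\<xi> \<in> borel_measurable (F c)" "L2 M \<xi>" for \<xi> a b c
    using L2_inner_increment(1)[of a b \<xi>] F_borel_mono[of c a \<xi>] that by (auto simp: J_def)
  have disj: "(\<integral>\<omega>. J \<xi> a b \<omega> * J \<zeta> c' d \<omega> \<partial>M) = 0"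
    if "0 \<le> a'" "a' \<le> a" "a \<le> b" "b \<le> c'" "0 \<le> c" "c \<le> c'" "c' \<le> d" "d \<le> T"
      "\<xi> \<in> borel_measurable (F a')" "L2 M \<xi>" "\<zeta> \<in> borel_measurable (F c)" "L2 M \<zeta>" for \<xi> \<zeta> a b c d a' c'
  proof -
    have "J \<xi> a b \<in> borel_measurable (F c')"
      using F_borel_mono[of a' c' \<xi>] W_F[of a c'] W_F[of b c'] that
      unfolding J_def by (intro borel_measurable_inner borel_measurable_diff) auto
    moreover have "L2 M (J \<xi> a b)" using that by (intro JL[of a']) auto
    ultimately show ?thesis
      using L2_inner_increment(3)[of c' d \<zeta> "J \<xi> a b"] F_borel_mono[of c c' \<zeta>] that
      by (auto simp: J_def mult.commute)
  qed
  have main: "(\<integral>\<omega>. J \<xi> a b \<omega> * J \<zeta> c d \<omega> \<partial>M) = max 0 (min b d - max a c) * (\<integral>\<omega>. \<xi> \<omega> \<bullet> \<zeta> \<omega> \<partial>M)"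
    if ord: "0 \<le> a" "a \<le> b" "b \<le> T" "a \<le> c" "c \<le> d" "d \<le> T"
      and \<xi>: "\<xi> \<in> borel_measurable (F a)" "L2 M \<xi>" and \<zeta>: "\<zeta> \<in> borel_measurable (F c)" "L2 M \<zeta>" for \<xi> \<zeta> a b c d
  proof (cases "b \<le> c")
    case True
    then show ?thesis using disj[of a a b c c d \<xi> \<zeta>] that by simp
  next
    case False
    define m where "m = min b d"
    have m: "c \<le> m" "m \<le> b" "m \<le> d" "m = b \<or> m = d" using False ord by (auto simp: m_def min_def)
    \<comment> \<open>Cut both intervals at \<open>c\<close> and at their first common endpoint: only the common part contributes.\<close>
    note L = JL[of a a c \<xi>] JL[of a c m \<xi>] JL[of a m b \<xi>] JL[of c c m \<zeta>] JL[of c m d \<zeta>]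
    have i: "integrable M (\<lambda>\<omega>. J \<xi> a c \<omega> * J \<zeta> c m \<omega>)" "integrable M (\<lambda>\<omega>. J \<xi> a c \<omega> * J \<zeta> m d \<omega>)"
      "integrable M (\<lambda>\<omega>. J \<xi> c m \<omega> * J \<zeta> c m \<omega>)" "integrable M (\<lambda>\<omega>. J \<xi> c m \<omega> * J \<zeta> m d \<omega>)"
      "integrable M (\<lambda>\<omega>. J \<xi> m b \<omega> * J \<zeta> c m \<omega>)"
      using L ord m \<xi> \<zeta> by (auto intro!: L2_mult_integrable)
    have z: "J \<xi> m b \<omega> * J \<zeta> m d \<omega> = 0" for \<omega> using m(4) by (auto simp: J_def)
    have z': "J \<zeta> c m \<omega> * J \<xi> m b \<omega> = J \<xi> m b \<omega> * J \<zeta> c m \<omega>" for \<omega> by simp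
    have "J \<xi> a b \<omega> * J \<zeta> c d \<omega> = J \<xi> a c \<omega> * J \<zeta> c m \<omega> + J \<xi> a c \<omega> * J \<zeta> m d \<omega> + J \<xi> c m \<omega> * J \<zeta> c m \<omega>
        + J \<xi> c m \<omega> * J \<zeta> m d \<omega> + J \<xi> m b \<omega> * J \<zeta> c m \<omega>" for \<omega>
    proof -
      have "J \<xi> a b \<omega> = J \<xi> a c \<omega> + J \<xi> c m \<omega> + J \<xi> m b \<omega>" "J \<zeta> c d \<omega> = J \<zeta> c m \<omega> + J \<zeta> m d \<omega>"
        by (simp_all add: J_def flip: inner_add_right)
      then show ?thesis using z[of \<omega>] by (simp add: algebra_simps)
    qed
    then have "(\<integral>\<omega>. J \<xi> a b \<omega> * J \<zeta> c d \<omega> \<partial>M) = (\<integral>\<omega>. J \<xi> a c \<omega> * J \<zeta> c m \<omega> \<partial>M) + (\<integral>\<omega>. J \<xi> a c \<omega> * J \<zeta> m d \<omega> \<partial>M)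
        + (\<integral>\<omega>. J \<xi> c m \<omega> * J \<zeta> c m \<omega> \<partial>M) + (\<integral>\<omega>. J \<xi> c m \<omega> * J \<zeta> m d \<omega> \<partial>M) + (\<integral>\<omega>. J \<xi> m b \<omega> * J \<zeta> c m \<omega> \<partial>M)"
      using i by simp
    also have "(\<integral>\<omega>. J \<xi> a c \<omega> * J \<zeta> c m \<omega> \<partial>M) = 0" using ord m \<xi> \<zeta> by (intro disj[of a _ _ _ c]) auto
    also have "(\<integral>\<omega>. J \<xi> a c \<omega> * J \<zeta> m d \<omega> \<partial>M) = 0" using ord m \<xi> \<zeta> by (intro disj[of a _ _ _ c]) auto
    also have "(\<integral>\<omega>. J \<xi> c m \<omega> * J \<zeta> m d \<omega> \<partial>M) = 0" using ord m \<xi> \<zeta> by (intro disj[of a _ _ _ c]) auto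
    also have "(\<integral>\<omega>. J \<xi> m b \<omega> * J \<zeta> c m \<omega> \<partial>M) = 0"
      using ord m \<xi> \<zeta> disj[of c c m m a b \<zeta> \<xi>] by (simp add: z')
    also have "(\<integral>\<omega>. J \<xi> c m \<omega> * J \<zeta> c m \<omega> \<partial>M) = (m - c) * (\<integral>\<omega>. \<xi> \<omega> \<bullet> \<zeta> \<omega> \<partial>M)"
      using L2_inner_increment(2)[of c m \<xi> \<zeta>] F_borel_mono[of a c \<xi>] ord m \<xi> \<zeta> by (simp add: J_def)
    finally show ?thesis using m ord by (simp add: m_def)
  qed
  have "(\<integral>\<omega>. J \<xi> a b \<omega> * J \<zeta> c d \<omega> \<partial>M) = max 0 (min b d - max a c) * (\<integral>\<omega>. \<xi> \<omega> \<bullet> \<zeta> \<omega> \<partial>M)"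
  proof (cases "a \<le> c")
    case True
    then show ?thesis using main[of a b c d \<xi> \<zeta>] assms by simp
  next
    case False
    then show ?thesis using main[of c d a b \<zeta> \<xi>] assms
      by (simp add: mult.commute inner_commute min.commute max.commute)
  qed
  then show ?thesis
    unfolding J_def using elementary_inner[of a b c d \<xi> \<zeta>] assms by simp
qed

lemma simple_integrand_props:
  assumes "simple_integrand F a b n s \<xi>" "0 \<le> a" "b \<le> T"
  shows "a \<le> b" "\<And>k. k \<le> n \<Longrightarrow> a \<le> s k \<and> s k \<le> b" "\<And>k. k < n \<Longrightarrow> s k < s (Suc k)"
    "\<And>k. k < n \<Longrightarrow> \<xi> k \<in> borel_measurable (F (s k))" "\<And>k. k < n \<Longrightarrow> L2 M (\<xi> k)"
proof -
  have s0: "s 0 = a" "s n = b" and step: "\<And>k. k < n \<Longrightarrow> s k < s (Suc k)"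
    and meas: "\<And>k. k < n \<Longrightarrow> \<xi> k \<in> borel_measurable (F (s k))"
    and bd: "\<And>k. k < n \<Longrightarrow> \<exists>B. \<forall>\<omega>\<in>space (F (s k)). norm (\<xi> k \<omega>) \<le> B"
    using assms(1) by (auto simp: simple_integrand_def)
  note mono = grid_mono[of n s, OF step]
  show ab: "a \<le> b" using mono[of 0 n] s0 by simp
  show rng: "a \<le> s k \<and> s k \<le> b" if "k \<le> n" for k using mono[of 0 k] mono[of k n] s0 that by simp
  show "s k < s (Suc k)" if "k < n" for k using step that .
  show "\<xi> k \<in> borel_measurable (F (s k))" if "k < n" for k using meas that .
  show "L2 M (\<xi> k)" if k: "k < n" for k
  proof -
    have t: "s k \<in> {0..T}" using rng[of k] k assms by auto
    obtain B where B: "\<forall>\<omega>\<in>space M. norm (\<xi> k \<omega>) \<le> B" using bd[OF k] F_space[OF t] by auto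
    show ?thesis
    proof (rule L2_dominated[OF L2_const[OF finite_measure_axioms, of "1::real"], where C = B])
      show "\<xi> k \<in> borel_measurable M" using F_borel_M[OF t meas[OF k]] .
      show "AE \<omega> in M. norm (\<xi> k \<omega>) \<le> B * norm (1::real)" using B by auto
    qed
  qed
qed

text \<open>The isometry in weak form: the pairing of \<open>I\<close> with every elementary integral is the pairing of the
  integrands over the slab, and \<open>I\<close> is orthogonal to the functions known at time \<open>a\<close>. Both are equations
  between pairings with fixed \<open>L\<^sup>2\<close> functions and therefore pass from simple processes to \<open>L\<^sup>2\<close> limits.\<close>

definition ito_pair :: "real \<Rightarrow> (real \<times> 'a \<Rightarrow> real ^ 'd) \<Rightarrow> ('a \<Rightarrow> real) \<Rightarrow> bool" where
  "ito_pair a H I \<longleftrightarrow> L2 (slab 0 T M) H \<and> L2 M I \<and>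
    (\<forall>c d \<zeta>. 0 \<le> c \<longrightarrow> c \<le> d \<longrightarrow> d \<le> T \<longrightarrow> \<zeta> \<in> borel_measurable (F c) \<longrightarrow> L2 M \<zeta> \<longrightarrow>
      (\<integral>\<omega>. I \<omega> * (\<zeta> \<omega> \<bullet> (W d \<omega> - W c \<omega>)) \<partial>M) = (\<integral>q. H q \<bullet> elementary c d \<zeta> q \<partial>slab 0 T M)) \<and>
    (\<forall>A. A \<in> borel_measurable (F a) \<longrightarrow> L2 M A \<longrightarrow> (\<integral>\<omega>. I \<omega> * A \<omega> \<partial>M) = 0)"

lemma ito_pair_L2: "ito_pair a H I \<Longrightarrow> L2 (slab 0 T M) H" "ito_pair a H I \<Longrightarrow> L2 M I"
  by (simp_all add: ito_pair_def)

lemma ito_pair_elementary: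
  "ito_pair a H I \<Longrightarrow> 0 \<le> c \<Longrightarrow> c \<le> d \<Longrightarrow> d \<le> T \<Longrightarrow> \<zeta> \<in> borel_measurable (F c) \<Longrightarrow> L2 M \<zeta> \<Longrightarrow>
    (\<integral>\<omega>. I \<omega> * (\<zeta> \<omega> \<bullet> (W d \<omega> - W c \<omega>)) \<partial>M) = (\<integral>q. H q \<bullet> elementary c d \<zeta> q \<partial>slab 0 T M)"
  by (simp add: ito_pair_def)

lemma ito_pair_past:
  "ito_pair a H I \<Longrightarrow> A \<in> borel_measurable (F a) \<Longrightarrow> L2 M A \<Longrightarrow> (\<integral>\<omega>. I \<omega> * A \<omega> \<partial>M) = 0"
  by (simp add: ito_pair_def)

lemma simple_process_elementary:
  "(\<lambda>(u, \<omega>). simple_process n s \<xi> u \<omega>) = (\<lambda>q. \<Sum>k<n. elementary (s k) (s (Suc k)) (\<xi> k) q)"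
  by (auto simp: simple_process_def elementary_def)

lemma simple_ito_pair:
  assumes S: "simple_integrand F a b n s \<xi>" and a: "0 \<le> a" and b: "b \<le> T"
  shows "ito_pair a (\<lambda>(u, \<omega>). simple_process n s \<xi> u \<omega>) (simple_ito W n s \<xi>)"
proof -
  note p = simple_integrand_props[OF S a b]
  let ?J = "\<lambda>k \<omega>. \<xi> k \<omega> \<bullet> (W (s (Suc k)) \<omega> - W (s k) \<omega>)"
  have r: "0 \<le> s k" "s k \<le> s (Suc k)" "s (Suc k) \<le> T" "a \<le> s k" if "k < n" for k
    using p(2)[of k] p(2)[of "Suc k"] p(3)[of k] that a b by auto
  have JL: "L2 M (?J k)" if "k < n" for k using that r p by (intro L2_inner_increment(1)) auto
  have EL: "L2 (slab 0 T M) (elementary (s k) (s (Suc k)) (\<xi> k))" if "k < n" for k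
    using that p(5) by (intro elementary_L2)
  have PL: "L2 (slab 0 T M) (\<lambda>(u, \<omega>). simple_process n s \<xi> u \<omega>)"
    unfolding simple_process_elementary using EL by (intro L2_sum) auto
  have IL: "L2 M (simple_ito W n s \<xi>)"
    unfolding simple_ito_def[abs_def] using JL by (intro L2_sum) auto
  show ?thesis
    unfolding ito_pair_def
  proof (intro conjI allI impI PL IL)
    fix c d :: real and \<zeta> :: "'a \<Rightarrow> real ^ 'd" assume cd: "0 \<le> c" "c \<le> d" "d \<le> T" "\<zeta> \<in> borel_measurable (F c)" "L2 M \<zeta>"
    have VL: "L2 M (\<lambda>\<omega>. \<zeta> \<omega> \<bullet> (W d \<omega> - W c \<omega>))" using cd by (intro L2_inner_increment(1))
    have "(\<integral>\<omega>. simple_ito W n s \<xi> \<omega> * (\<zeta> \<omega> \<bullet> (W d \<omega> - W c \<omega>)) \<partial>M)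
        = (\<Sum>k<n. \<integral>\<omega>. ?J k \<omega> * (\<zeta> \<omega> \<bullet> (W d \<omega> - W c \<omega>)) \<partial>M)"
      unfolding simple_ito_def sum_distrib_right
      using JL VL by (intro Bochner_Integration.integral_sum L2_mult_integrable) auto
    also have "\<dots> = (\<Sum>k<n. \<integral>q. elementary (s k) (s (Suc k)) (\<xi> k) q \<bullet> elementary c d \<zeta> q \<partial>slab 0 T M)"
      using r p cd by (intro sum.cong refl elementary_isometry) auto
    also have "\<dots> = (\<integral>q. (\<lambda>(u, \<omega>). simple_process n s \<xi> u \<omega>) q \<bullet> elementary c d \<zeta> q \<partial>slab 0 T M)"
      unfolding simple_process_elementary inner_sum_left
      using EL elementary_L2[OF cd(5)]
      by (intro Bochner_Integration.integral_sum[symmetric] L2_inner_integrable) auto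
    finally show "(\<integral>\<omega>. simple_ito W n s \<xi> \<omega> * (\<zeta> \<omega> \<bullet> (W d \<omega> - W c \<omega>)) \<partial>M)
      = (\<integral>q. (\<lambda>(u, \<omega>). simple_process n s \<xi> u \<omega>) q \<bullet> elementary c d \<zeta> q \<partial>slab 0 T M)" .
  next
    fix A :: "'a \<Rightarrow> real" assume A: "A \<in> borel_measurable (F a)" "L2 M A"
    have "(\<integral>\<omega>. simple_ito W n s \<xi> \<omega> * A \<omega> \<partial>M) = (\<Sum>k<n. \<integral>\<omega>. ?J k \<omega> * A \<omega> \<partial>M)"
      unfolding simple_ito_def sum_distrib_right
      by (intro Bochner_Integration.integral_sum L2_mult_integrable JL A(2)) simp
    also have "\<dots> = 0"
    proof (rule sum.neutral, rule ballI)
      fix k assume "k \<in> {..<n}"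
      then have k: "k < n" by simp
      have "s k \<le> T" using r(2,3)[OF k] by simp
      show "(\<integral>\<omega>. ?J k \<omega> * A \<omega> \<partial>M) = 0"
        by (rule L2_inner_increment(3)[OF r(1-3)[OF k] p(4,5)[OF k]
            F_borel_mono[OF a r(4)[OF k] \<open>s k \<le> T\<close> A(1)] A(2)])
    qed
    finally show "(\<integral>\<omega>. simple_ito W n s \<xi> \<omega> * A \<omega> \<partial>M) = 0" .
  qed
qed

lemma simple_ito_inner:
  assumes S: "simple_integrand F a b n s \<xi>" and a: "0 \<le> a" and b: "b \<le> T" and I: "ito_pair c H I"
  shows "(\<integral>\<omega>. simple_ito W n s \<xi> \<omega> * I \<omega> \<partial>M) = (\<integral>q. (\<lambda>(u, \<omega>). simple_process n s \<xi> u \<omega>) q \<bullet> H q \<partial>slab 0 T M)"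
proof -
  note p = simple_integrand_props[OF S a b]
  let ?J = "\<lambda>k \<omega>. \<xi> k \<omega> \<bullet> (W (s (Suc k)) \<omega> - W (s k) \<omega>)"
  have r: "0 \<le> s k" "s k \<le> s (Suc k)" "s (Suc k) \<le> T" if "k < n" for k
    using p(2)[of k] p(2)[of "Suc k"] p(3)[of k] that a b by auto
  have JL: "L2 M (?J k)" if "k < n" for k using that r p by (intro L2_inner_increment(1)) auto
  have EL: "L2 (slab 0 T M) (elementary (s k) (s (Suc k)) (\<xi> k))" if "k < n" for k
    using that p(5) by (intro elementary_L2)
  have L: "L2 M I" "L2 (slab 0 T M) H" using I by (auto simp: ito_pair_def)
  have "(\<integral>\<omega>. simple_ito W n s \<xi> \<omega> * I \<omega> \<partial>M) = (\<Sum>k<n. \<integral>\<omega>. ?J k \<omega> * I \<omega> \<partial>M)"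
    unfolding simple_ito_def sum_distrib_right
    using JL L by (intro Bochner_Integration.integral_sum L2_mult_integrable) auto
  also have "\<dots> = (\<Sum>k<n. \<integral>q. elementary (s k) (s (Suc k)) (\<xi> k) q \<bullet> H q \<partial>slab 0 T M)"
  proof (intro sum.cong refl)
    fix k assume "k \<in> {..<n}"
    then show "(\<integral>\<omega>. ?J k \<omega> * I \<omega> \<partial>M) = (\<integral>q. elementary (s k) (s (Suc k)) (\<xi> k) q \<bullet> H q \<partial>slab 0 T M)"
      using I r[of k] p(4,5)[of k] by (simp add: ito_pair_def inner_commute[of "elementary _ _ _ _"] mult.commute)
  qed
  also have "\<dots> = (\<integral>q. (\<lambda>(u, \<omega>). simple_process n s \<xi> u \<omega>) q \<bullet> H q \<partial>slab 0 T M)"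
    unfolding simple_process_elementary inner_sum_left
    using EL L by (intro Bochner_Integration.integral_sum[symmetric] L2_inner_integrable) auto
  finally show ?thesis .
qed

text \<open>Over the whole slab the integrand of an integral over \<open>{a..T}\<close> is cut off at time \<open>a\<close>; this makes
  integrals with different lower limits comparable.\<close>

definition tail :: "real \<Rightarrow> (real \<Rightarrow> 'a \<Rightarrow> 'b::euclidean_space) \<Rightarrow> real \<times> 'a \<Rightarrow> 'b" where
  "tail a H q = indicator {a<..T} (fst q) *\<^sub>R H (fst q) (snd q)"

definition ito_approx ::
  "real \<Rightarrow> (real \<Rightarrow> 'a \<Rightarrow> real ^ 'd) \<Rightarrow> ('a \<Rightarrow> real) \<Rightarrow>
   (nat \<Rightarrow> nat) \<Rightarrow> (nat \<Rightarrow> nat \<Rightarrow> real) \<Rightarrow> (nat \<Rightarrow> nat \<Rightarrow> 'a \<Rightarrow> real ^ 'd) \<Rightarrow> bool" where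
  "ito_approx a H I n s \<xi> \<longleftrightarrow> (\<forall>k. simple_integrand F a T (n k) (s k) (\<xi> k)) \<and>
    (\<lambda>k. \<integral>\<^sup>+q. ennreal ((norm ((\<lambda>(u, \<omega>). simple_process (n k) (s k) (\<xi> k) u \<omega>) q - tail a H q))\<^sup>2) \<partial>slab 0 T M)
        \<longlonglongrightarrow> 0 \<and>
    (\<lambda>k. \<integral>\<^sup>+\<omega>. ennreal ((norm (simple_ito W (n k) (s k) (\<xi> k) \<omega> - I \<omega>))\<^sup>2) \<partial>M) \<longlonglongrightarrow> 0"

lemma has_ito_integral_approx:
  assumes I: "has_ito_integral M F W a T H I" and a: "0 \<le> a" "a \<le> T"
    and H: "L2 (slab 0 T M) (\<lambda>(s, \<omega>). H s \<omega>)"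
  shows "\<exists>n s \<xi>. ito_approx a H I n s \<xi>"
proof -
  from I obtain n s \<xi> where S: "\<And>k. simple_integrand F a T (n k) (s k) (\<xi> k)"
    and l1: "(\<lambda>k. \<integral>\<^sup>+\<omega>. (\<integral>\<^sup>+u\<in>{a..T}. ennreal ((norm (simple_process (n k) (s k) (\<xi> k) u \<omega> - H u \<omega>))\<^sup>2) \<partial>lborel) \<partial>M)
          \<longlonglongrightarrow> 0"
    and l2: "(\<lambda>k. \<integral>\<^sup>+\<omega>. ennreal ((simple_ito W (n k) (s k) (\<xi> k) \<omega> - I \<omega>)\<^sup>2) \<partial>M) \<longlonglongrightarrow> 0"
    unfolding has_ito_integral_def by blast
  have eq: "(\<integral>\<^sup>+\<omega>. (\<integral>\<^sup>+u\<in>{a..T}. ennreal ((norm (simple_process (n k) (s k) (\<xi> k) u \<omega> - H u \<omega>))\<^sup>2) \<partial>lborel) \<partial>M)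
    = (\<integral>\<^sup>+q. ennreal ((norm ((\<lambda>(u, \<omega>). simple_process (n k) (s k) (\<xi> k) u \<omega>) q - tail a H q))\<^sup>2) \<partial>slab 0 T M)" for k
  proof -
    let ?P = "\<lambda>(u, \<omega>). simple_process (n k) (s k) (\<xi> k) u \<omega>"
    note p = simple_integrand_props[OF S[of k] a(1) order_refl]
    have PL: "L2 (slab 0 T M) ?P" using simple_ito_pair[OF S a(1) order_refl] by (auto simp: ito_pair_def)
    have TL: "L2 (slab 0 T M) (tail a H)"
      using slab_L2_indicator[OF H, of a T] by (simp add: tail_def[abs_def] case_prod_unfold)
    have m1: "(\<lambda>q. ennreal ((norm (?P q - tail a H q))\<^sup>2)) \<in> borel_measurable (slab 0 T M)"
      using L2_measurable[OF PL] L2_measurable[OF TL] by measurable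
    have zero: "simple_process (n k) (s k) (\<xi> k) u \<omega> = 0" if "u \<le> a" for u \<omega>
    proof -
      have "indicator {s k j<..s k (Suc j)} u = (0::real)" if "j < n k" for j
        using p(2)[of j] that \<open>u \<le> a\<close> by (simp add: indicator_def)
      then show ?thesis unfolding simple_process_def by (intro sum.neutral ballI) simp
    qed
    have "(\<integral>\<^sup>+\<omega>. (\<integral>\<^sup>+u\<in>{a..T}. ennreal ((norm (simple_process (n k) (s k) (\<xi> k) u \<omega> - H u \<omega>))\<^sup>2) \<partial>lborel) \<partial>M)
        = (\<integral>\<^sup>+\<omega>. (\<integral>\<^sup>+u\<in>{a<..T}. ennreal ((norm (simple_process (n k) (s k) (\<xi> k) u \<omega> - H u \<omega>))\<^sup>2) \<partial>lborel) \<partial>M)"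
      by (simp only: nn_integral_Ioc_Icc)
    also have "\<dots> = (\<integral>\<^sup>+\<omega>. (\<integral>\<^sup>+u\<in>{0<..T}. ennreal ((norm (?P (u, \<omega>) - tail a H (u, \<omega>)))\<^sup>2) \<partial>lborel) \<partial>M)"
    proof (intro nn_integral_cong)
      fix \<omega> u
      show "ennreal ((norm (simple_process (n k) (s k) (\<xi> k) u \<omega> - H u \<omega>))\<^sup>2) * indicator {a<..T} u
          = ennreal ((norm (?P (u, \<omega>) - tail a H (u, \<omega>)))\<^sup>2) * indicator {0<..T} u"
        using a zero[of u \<omega>] by (cases "u \<le> a") (simp_all add: tail_def indicator_def)
    qed
    also have "\<dots> = (\<integral>\<^sup>+q. ennreal ((norm (?P q - tail a H q))\<^sup>2) \<partial>slab 0 T M)"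
      by (rule nn_integral_slab(1)[OF m1, symmetric])
    finally show ?thesis .
  qed
  show ?thesis
    unfolding ito_approx_def
  proof (intro exI conjI allI)
    show "simple_integrand F a T (n k) (s k) (\<xi> k)" for k by (rule S)
    show "(\<lambda>k. \<integral>\<^sup>+q. ennreal ((norm ((\<lambda>(u, \<omega>). simple_process (n k) (s k) (\<xi> k) u \<omega>) q - tail a H q))\<^sup>2) \<partial>slab 0 T M)
        \<longlonglongrightarrow> 0"
      using l1 unfolding eq .
    show "(\<lambda>k. \<integral>\<^sup>+\<omega>. ennreal ((norm (simple_ito W (n k) (s k) (\<xi> k) \<omega> - I \<omega>))\<^sup>2) \<partial>M) \<longlonglongrightarrow> 0"
      using l2 by simp
  qed
qed

lemma has_ito_integral_pair:
  assumes I: "has_ito_integral M F W a T H I" and a: "0 \<le> a" "a \<le> T"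
    and H: "L2 (slab 0 T M) (\<lambda>(s, \<omega>). H s \<omega>)"
  shows "ito_pair a (tail a H) I"
proof -
  obtain n s \<xi> where A: "ito_approx a H I n s \<xi>" using has_ito_integral_approx[OF I a H] by blast
  note S = A[unfolded ito_approx_def, THEN conjunct1, rule_format]
    and l1 = A[unfolded ito_approx_def, THEN conjunct2, THEN conjunct1]
    and l2 = A[unfolded ito_approx_def, THEN conjunct2, THEN conjunct2]
  note sp = simple_ito_pair[OF S a(1) order_refl, unfolded ito_pair_def]
  have PL: "L2 (slab 0 T M) (\<lambda>(u, \<omega>). simple_process (n k) (s k) (\<xi> k) u \<omega>)"
    and JL: "L2 M (simple_ito W (n k) (s k) (\<xi> k))" for k
    using sp[of k] by auto
  have IL: "L2 M I"
    by (rule L2_limit[OF JL _ l2]) (use I in \<open>auto simp: has_ito_integral_def\<close>)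
  have TL: "L2 (slab 0 T M) (tail a H)"
    using slab_L2_indicator[OF H, of a T] by (simp add: tail_def[abs_def] case_prod_unfold)
  show ?thesis
    unfolding ito_pair_def
  proof (intro conjI allI impI IL TL)
    fix c d :: real and \<zeta> :: "'a \<Rightarrow> real ^ 'd" assume cd: "0 \<le> c" "c \<le> d" "d \<le> T" "\<zeta> \<in> borel_measurable (F c)" "L2 M \<zeta>"
    have VL: "L2 M (\<lambda>\<omega>. \<zeta> \<omega> \<bullet> (W d \<omega> - W c \<omega>))" using cd by (intro L2_inner_increment(1))
    have "(\<lambda>k. \<integral>\<omega>. simple_ito W (n k) (s k) (\<xi> k) \<omega> * (\<zeta> \<omega> \<bullet> (W d \<omega> - W c \<omega>)) \<partial>M)
        \<longlonglongrightarrow> (\<integral>\<omega>. I \<omega> * (\<zeta> \<omega> \<bullet> (W d \<omega> - W c \<omega>)) \<partial>M)"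
      using L2_inner_tendsto[OF JL IL VL l2] by simp
    moreover have "(\<lambda>k. \<integral>\<omega>. simple_ito W (n k) (s k) (\<xi> k) \<omega> * (\<zeta> \<omega> \<bullet> (W d \<omega> - W c \<omega>)) \<partial>M)
        \<longlonglongrightarrow> (\<integral>q. tail a H q \<bullet> elementary c d \<zeta> q \<partial>slab 0 T M)"
      using L2_inner_tendsto[OF PL TL elementary_L2[OF cd(5)] l1] sp cd by simp
    ultimately show "(\<integral>\<omega>. I \<omega> * (\<zeta> \<omega> \<bullet> (W d \<omega> - W c \<omega>)) \<partial>M) = (\<integral>q. tail a H q \<bullet> elementary c d \<zeta> q \<partial>slab 0 T M)"
      by (rule LIMSEQ_unique)
  next
    fix A :: "'a \<Rightarrow> real" assume A: "A \<in> borel_measurable (F a)" "L2 M A"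
    have "(\<lambda>k. \<integral>\<omega>. simple_ito W (n k) (s k) (\<xi> k) \<omega> * A \<omega> \<partial>M) \<longlonglongrightarrow> (\<integral>\<omega>. I \<omega> * A \<omega> \<partial>M)"
      using L2_inner_tendsto[OF JL IL A(2) l2] by simp
    moreover have "(\<lambda>k. \<integral>\<omega>. simple_ito W (n k) (s k) (\<xi> k) \<omega> * A \<omega> \<partial>M) \<longlonglongrightarrow> 0"
      using sp A by simp
    ultimately show "(\<integral>\<omega>. I \<omega> * A \<omega> \<partial>M) = 0" by (rule LIMSEQ_unique)
  qed
qed

text \<open>Approximating one factor at a time: the weak isometry for \<open>J\<close> evaluates the product of \<open>J\<close> with a simple
  integral, and the simple integrals tend to \<open>I\<close>.\<close>

lemma ito_product:
  assumes I: "has_ito_integral M F W a T H I" and a: "0 \<le> a" "a \<le> T"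
    and J: "has_ito_integral M F W b T H J" and b: "0 \<le> b" "b \<le> T"
    and H: "L2 (slab 0 T M) (\<lambda>(s, \<omega>). H s \<omega>)"
  shows "(\<integral>\<omega>. I \<omega> * J \<omega> \<partial>M) = (\<integral>q. tail a H q \<bullet> tail b H q \<partial>slab 0 T M)"
proof -
  obtain n s \<xi> where A: "ito_approx a H I n s \<xi>" using has_ito_integral_approx[OF I a H] by blast
  note S = A[unfolded ito_approx_def, THEN conjunct1, rule_format]
    and l1 = A[unfolded ito_approx_def, THEN conjunct2, THEN conjunct1]
    and l2 = A[unfolded ito_approx_def, THEN conjunct2, THEN conjunct2]
  note sp = simple_ito_pair[OF S a(1) order_refl, unfolded ito_pair_def]
  have PL: "L2 (slab 0 T M) (\<lambda>(u, \<omega>). simple_process (n k) (s k) (\<xi> k) u \<omega>)"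
    and JL: "L2 M (simple_ito W (n k) (s k) (\<xi> k))" for k
    using sp[of k] by auto
  note pI = has_ito_integral_pair[OF I a H] and pJ = has_ito_integral_pair[OF J b H]
  have "(\<lambda>k. \<integral>\<omega>. simple_ito W (n k) (s k) (\<xi> k) \<omega> * J \<omega> \<partial>M) \<longlonglongrightarrow> (\<integral>\<omega>. I \<omega> * J \<omega> \<partial>M)"
    using L2_inner_tendsto[OF JL ito_pair_L2(2)[OF pI] ito_pair_L2(2)[OF pJ] l2] by simp
  moreover have "(\<lambda>k. \<integral>\<omega>. simple_ito W (n k) (s k) (\<xi> k) \<omega> * J \<omega> \<partial>M) \<longlonglongrightarrow> (\<integral>q. tail a H q \<bullet> tail b H q \<partial>slab 0 T M)"
    unfolding simple_ito_inner[OF S a(1) order_refl pJ]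
    by (rule L2_inner_tendsto[OF PL ito_pair_L2(1)[OF pI] ito_pair_L2(1)[OF pJ] l1])
  ultimately show ?thesis by (rule LIMSEQ_unique)
qed

text \<open>The difference of two It\^o integrals plays the role of \<open>\<integral>\<^sub>a\<^sup>b H dW\<close>.\<close>

lemma ito_difference:
  assumes I: "has_ito_integral M F W a T H I" and J: "has_ito_integral M F W b T H J"
    and ab: "0 \<le> a" "a \<le> b" "b \<le> T" and H: "L2 (slab 0 T M) (\<lambda>(s, \<omega>). H s \<omega>)"
  shows "L2 M (\<lambda>\<omega>. I \<omega> - J \<omega>)"
    and "msq M (\<lambda>\<omega>. I \<omega> - J \<omega>) = msq (slab a b M) (\<lambda>(s, \<omega>). H s \<omega>)"
    and "\<And>A. A \<in> borel_measurable (F a) \<Longrightarrow> L2 M A \<Longrightarrow> (\<integral>\<omega>. (I \<omega> - J \<omega>) * A \<omega> \<partial>M) = 0"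
    and "\<And>\<zeta>. \<zeta> \<in> borel_measurable (F a) \<Longrightarrow> L2 M \<zeta> \<Longrightarrow>
      (\<integral>\<omega>. (I \<omega> - J \<omega>) * (\<zeta> \<omega> \<bullet> (W b \<omega> - W a \<omega>)) \<partial>M) = (\<integral>q. \<zeta> (snd q) \<bullet> H (fst q) (snd q) \<partial>slab a b M)"
proof -
  have aT: "a \<le> T" and b0: "0 \<le> b" using ab by auto
  note pI = has_ito_integral_pair[OF I ab(1) aT H] and pJ = has_ito_integral_pair[OF J b0 ab(3) H]
  note L = ito_pair_L2(2)[OF pI] ito_pair_L2(2)[OF pJ] ito_pair_L2(1)[OF pI] ito_pair_L2(1)[OF pJ]
  show "L2 M (\<lambda>\<omega>. I \<omega> - J \<omega>)" using L by (intro L2_diff)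
  have d: "tail a H q - tail b H q = indicator {a<..b} (fst q) *\<^sub>R H (fst q) (snd q)" for q
    using ab by (auto simp: tail_def split: split_indicator)
  have "msq M (\<lambda>\<omega>. I \<omega> - J \<omega>) = msq M I - 2 * (\<integral>\<omega>. I \<omega> * J \<omega> \<partial>M) + msq M J"
    using msq_diff[OF L(1,2)] by simp
  also have "\<dots> = msq (slab 0 T M) (\<lambda>q. tail a H q - tail b H q)"
    using ito_product[OF I ab(1) aT I ab(1) aT H] ito_product[OF J b0 ab(3) J b0 ab(3) H]
      ito_product[OF I ab(1) aT J b0 ab(3) H]
    by (subst msq_diff[OF L(3,4)]) (simp add: msq_inner_self flip: msq_inner_self[where X = I] msq_inner_self[where X = J])
  also have "\<dots> = msq (slab a b M) (\<lambda>(s, \<omega>). H s \<omega>)"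
    unfolding d using ab by (subst slab_msq_indicator) (auto simp: case_prod_unfold)
  finally show "msq M (\<lambda>\<omega>. I \<omega> - J \<omega>) = msq (slab a b M) (\<lambda>(s, \<omega>). H s \<omega>)" .
  fix A :: "'a \<Rightarrow> real" assume A: "A \<in> borel_measurable (F a)" "L2 M A"
  show "(\<integral>\<omega>. (I \<omega> - J \<omega>) * A \<omega> \<partial>M) = 0"
    using ito_pair_past[OF pI A] ito_pair_past[OF pJ F_borel_mono[OF ab A(1)] A(2)] L2_mult_integrable[OF L(1) A(2)] L2_mult_integrable[OF L(2) A(2)]
    by (simp add: left_diff_distrib)
next
  fix \<zeta> :: "'a \<Rightarrow> real ^ 'd" assume \<zeta>: "\<zeta> \<in> borel_measurable (F a)" "L2 M \<zeta>"
  have aT: "a \<le> T" and b0: "0 \<le> b" using ab by auto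
  note pI = has_ito_integral_pair[OF I ab(1) aT H] and pJ = has_ito_integral_pair[OF J b0 ab(3) H]
  note L = ito_pair_L2(2)[OF pI] ito_pair_L2(2)[OF pJ] ito_pair_L2(1)[OF pI] ito_pair_L2(1)[OF pJ]
  have VL: "L2 M (\<lambda>\<omega>. \<zeta> \<omega> \<bullet> (W b \<omega> - W a \<omega>))" using ab \<zeta> by (intro L2_inner_increment(1))
  note EL = elementary_L2[OF \<zeta>(2), of a b]
  have "(\<integral>\<omega>. (I \<omega> - J \<omega>) * (\<zeta> \<omega> \<bullet> (W b \<omega> - W a \<omega>)) \<partial>M)
      = (\<integral>q. tail a H q \<bullet> elementary a b \<zeta> q \<partial>slab 0 T M) - (\<integral>q. tail b H q \<bullet> elementary a b \<zeta> q \<partial>slab 0 T M)"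
    using ito_pair_elementary[OF pI ab \<zeta>] ito_pair_elementary[OF pJ ab \<zeta>] L2_mult_integrable[OF L(1) VL] L2_mult_integrable[OF L(2) VL]
    by (simp add: left_diff_distrib)
  also have "\<dots> = (\<integral>q. (tail a H q - tail b H q) \<bullet> elementary a b \<zeta> q \<partial>slab 0 T M)"
    using L2_inner_integrable[OF L(3) EL] L2_inner_integrable[OF L(4) EL] by (simp add: inner_diff_left)
  also have "\<dots> = (\<integral>q. indicator {a<..b} (fst q) *\<^sub>R (\<zeta> (snd q) \<bullet> H (fst q) (snd q)) \<partial>slab 0 T M)"
    using ab by (intro Bochner_Integration.integral_cong)
      (auto simp: tail_def elementary_def inner_commute split: split_indicator)
  also have "\<dots> = (\<integral>q. \<zeta> (snd q) \<bullet> H (fst q) (snd q) \<partial>slab a b M)"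
    using ab by (intro slab_integral_sub) auto
  finally show "(\<integral>\<omega>. (I \<omega> - J \<omega>) * (\<zeta> \<omega> \<bullet> (W b \<omega> - W a \<omega>)) \<partial>M) = (\<integral>q. \<zeta> (snd q) \<bullet> H (fst q) (snd q) \<partial>slab a b M)" .
qed

end

section \<open>Conditional expectations as projections\<close>

lemma L2_axis:
  fixes X :: "'a \<Rightarrow> real ^ 'd"
  assumes "L2 M X" shows "L2 M (\<lambda>\<omega>. axis j (X \<omega> $ j) :: real ^ 'd)"
proof (rule L2_vecI)
  fix i
  show "L2 M (\<lambda>\<omega>. (axis j (X \<omega> $ j) :: real ^ 'd) $ i)"
    using L2_component[OF assms, of j] by (cases "i = j") (simp_all add: axis_def)
qed

lemma borel_measurable_axis:
  fixes X :: "'a \<Rightarrow> real ^ 'd"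
  assumes "X \<in> borel_measurable N" shows "(\<lambda>\<omega>. axis j (X \<omega> $ j) :: real ^ 'd) \<in> borel_measurable N"
proof (rule borel_measurable_vecI)
  fix i
  show "(\<lambda>\<omega>. (axis j (X \<omega> $ j) :: real ^ 'd) $ i) \<in> borel_measurable N"
    using borel_measurable_vec_nth[OF assms, of j] by (cases "i = j") (simp_all add: axis_def)
qed

lemma (in finite_measure) L2_truncation:
  fixes X :: "'a \<Rightarrow> 'b::euclidean_space"
  assumes [measurable]: "X \<in> borel_measurable M" "P \<in> borel_measurable M"
  shows "L2 M (\<lambda>\<omega>. indicator {\<omega>. norm (X \<omega>) \<le> real n \<and> norm (P \<omega> :: 'c::euclidean_space) \<le> real n} \<omega> *\<^sub>R X \<omega>)"
proof (rule L2_dominated[OF L2_const[OF finite_measure_axioms, of "real n"], where C = 1])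
  show "(\<lambda>\<omega>. indicator {\<omega>. norm (X \<omega>) \<le> real n \<and> norm (P \<omega>) \<le> real n} \<omega> *\<^sub>R X \<omega>) \<in> borel_measurable M"
    by measurable
qed (auto split: split_indicator)

context brownian_space
begin

lemma cond_exp_F: "real_cond_exp M (F s) D \<in> borel_measurable (F s)"
  by simp

lemma vec_cond_exp_F:
  fixes V :: "'a \<Rightarrow> real ^ 'n"
  shows "vec_cond_exp M (F s) V \<in> borel_measurable (F s)"
  by (rule borel_measurable_vecI) (simp add: vec_cond_exp_def)

lemma vec_cond_exp_test:
  fixes V \<zeta> :: "'a \<Rightarrow> real ^ 'n"
  assumes s: "s \<in> {0..T}" and \<zeta>: "\<zeta> \<in> borel_measurable (F s)" and V: "V \<in> borel_measurable M"
    and int: "\<And>j. integrable M (\<lambda>\<omega>. \<zeta> \<omega> $ j * V \<omega> $ j)"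
  shows "(\<integral>\<omega>. \<zeta> \<omega> \<bullet> vec_cond_exp M (F s) V \<omega> \<partial>M) = (\<integral>\<omega>. \<zeta> \<omega> \<bullet> V \<omega> \<partial>M)"
proof -
  interpret sigma_finite_subalgebra M "F s" by (rule cond_exp_space[OF s])
  note c = real_cond_exp_intg[OF int borel_measurable_vec_nth[OF \<zeta>] borel_measurable_vec_nth[OF V]]
  have "(\<integral>\<omega>. \<zeta> \<omega> \<bullet> vec_cond_exp M (F s) V \<omega> \<partial>M)
      = (\<Sum>j\<in>UNIV. \<integral>\<omega>. \<zeta> \<omega> $ j * real_cond_exp M (F s) (\<lambda>\<omega>. V \<omega> $ j) \<omega> \<partial>M)"
    unfolding inner_vec_def vec_cond_exp_def using c(1) by simp
  also have "\<dots> = (\<integral>\<omega>. \<zeta> \<omega> \<bullet> V \<omega> \<partial>M)"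
    unfolding inner_vec_def using c(2) int by simp
  finally show ?thesis .
qed

text \<open>A product such as \<open>U \<Delta>W\<close> need not be square integrable, but its conditional expectation is as soon as
  the pairing with \<open>L\<^sup>2\<close> functions of the past is bounded.\<close>

lemma vec_cond_exp_L2:
  fixes V :: "'a \<Rightarrow> real ^ 'n"
  assumes s: "s \<in> {0..T}" and V: "V \<in> borel_measurable M"
    and int: "\<And>\<zeta> j. \<zeta> \<in> borel_measurable (F s) \<Longrightarrow> L2 M \<zeta> \<Longrightarrow> integrable M (\<lambda>\<omega>. \<zeta> \<omega> $ j * V \<omega> $ j)"
    and bound: "\<And>\<zeta>. \<zeta> \<in> borel_measurable (F s) \<Longrightarrow> L2 M \<zeta> \<Longrightarrow> 2 * (\<integral>\<omega>. \<zeta> \<omega> \<bullet> V \<omega> \<partial>M) \<le> msq M \<zeta> + C"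
  shows "L2 M (vec_cond_exp M (F s) V)"
proof (rule L2_by_truncation[where A = "\<lambda>_. 0 :: real", OF _ _ finite_measure_axioms])
  let ?E = "vec_cond_exp M (F s) V"
  show m: "?E \<in> borel_measurable M" using F_borel_M[OF s vec_cond_exp_F] .
  fix n :: nat
  let ?S = "{\<omega>. norm (?E \<omega>) \<le> real n \<and> norm (0 :: real) \<le> real n}"
  let ?\<zeta> = "\<lambda>\<omega>. indicator ?S \<omega> *\<^sub>R ?E \<omega>"
  have F: "?\<zeta> \<in> borel_measurable (F s)" using vec_cond_exp_F[of s V] by measurable
  have L: "L2 M ?\<zeta>" by (rule L2_truncation[OF m]) simp
  have "msq M ?\<zeta> = (\<integral>\<omega>. ?\<zeta> \<omega> \<bullet> ?E \<omega> \<partial>M)"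
    unfolding msq_def by (intro Bochner_Integration.integral_cong) (auto simp: power2_norm_eq_inner split: split_indicator)
  also have "\<dots> = (\<integral>\<omega>. ?\<zeta> \<omega> \<bullet> V \<omega> \<partial>M)" by (rule vec_cond_exp_test[OF s F V int[OF F L]])
  finally show "msq M ?\<zeta> \<le> C" using bound[OF F L] by simp
qed simp

lemma cond_exp_test:
  assumes s: "s \<in> {0..T}" and A: "A \<in> borel_measurable (F s)" "L2 M A" and D: "L2 M D"
  shows "(\<integral>\<omega>. real_cond_exp M (F s) D \<omega> * A \<omega> \<partial>M) = (\<integral>\<omega>. D \<omega> * A \<omega> \<partial>M)"
proof -
  interpret sigma_finite_subalgebra M "F s" by (rule cond_exp_space[OF s])
  show ?thesis
    using real_cond_exp_intg(2)[OF L2_mult_integrable[OF A(2) D] A(1) L2_measurable[OF D]]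
    by (simp add: mult.commute)
qed

lemma cond_exp_L2:
  assumes s: "s \<in> {0..T}" and D: "L2 M D"
  shows "L2 M (real_cond_exp M (F s) D)"
proof (rule L2_by_truncation[where A = "\<lambda>_. 0 :: real", OF _ _ finite_measure_axioms])
  let ?E = "real_cond_exp M (F s) D"
  show m: "?E \<in> borel_measurable M" using F_borel_M[OF s cond_exp_F] .
  fix n :: nat
  let ?S = "{\<omega>. norm (?E \<omega>) \<le> real n \<and> norm (0 :: real) \<le> real n}"
  let ?\<zeta> = "\<lambda>\<omega>. indicator ?S \<omega> *\<^sub>R ?E \<omega>"
  have F: "?\<zeta> \<in> borel_measurable (F s)" using cond_exp_F[of s D] by measurable
  have L: "L2 M ?\<zeta>" by (rule L2_truncation[OF m]) simp
  have "msq M ?\<zeta> = (\<integral>\<omega>. ?E \<omega> * ?\<zeta> \<omega> \<partial>M)"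
    unfolding msq_def
    by (intro Bochner_Integration.integral_cong) (auto simp: power2_eq_square split: split_indicator)
  also have "\<dots> = (\<integral>\<omega>. D \<omega> * ?\<zeta> \<omega> \<partial>M)" by (rule cond_exp_test[OF s F L D])
  finally show "msq M ?\<zeta> \<le> msq M D" using inner_le_msq[OF D L, of 1] by simp
qed simp

lemma cond_exp_pythagoras:
  assumes s: "s \<in> {0..T}" and D: "L2 M D"
  shows "msq M (\<lambda>\<omega>. D \<omega> - real_cond_exp M (F s) D \<omega>) = msq M D - msq M (real_cond_exp M (F s) D)"
proof -
  note E = cond_exp_L2[OF s D]
  have "(\<integral>\<omega>. D \<omega> * real_cond_exp M (F s) D \<omega> \<partial>M) = msq M (real_cond_exp M (F s) D)"
    using cond_exp_test[OF s cond_exp_F E D] msq_inner_self[of M "real_cond_exp M (F s) D"] by simp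
  then show ?thesis using msq_diff[OF D E] by simp
qed

lemma increment_cond_exp:
  assumes st: "0 \<le> s" "s < t" "t \<le> T" and U: "L2 M U"
  defines "z \<equiv> \<lambda>\<omega>. (1 / (t - s)) *\<^sub>R vec_cond_exp M (F s) (\<lambda>\<omega>'. U \<omega>' *\<^sub>R (W t \<omega>' - W s \<omega>')) \<omega>"
  shows "z \<in> borel_measurable (F s)" "L2 M z"
    and "\<And>\<zeta>. \<zeta> \<in> borel_measurable (F s) \<Longrightarrow> L2 M \<zeta> \<Longrightarrow>
      (\<integral>\<omega>. U \<omega> * (\<zeta> \<omega> \<bullet> (W t \<omega> - W s \<omega>)) \<partial>M) = (t - s) * (\<integral>\<omega>. z \<omega> \<bullet> \<zeta> \<omega> \<partial>M)"
proof -
  let ?V = "\<lambda>\<omega>'. U \<omega>' *\<^sub>R (W t \<omega>' - W s \<omega>')"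
  have s: "s \<in> {0..T}" and le: "s \<le> t" using st by auto
  have [measurable]: "s \<in> {0..T}" "t \<in> {0..T}" using st by auto
  note [measurable] = L2_measurable[OF U]
  have V: "?V \<in> borel_measurable M" by measurable
  have i: "integrable M (\<lambda>\<omega>. \<zeta> \<omega> $ j * ?V \<omega> $ j)" if "\<zeta> \<in> borel_measurable (F s)" "L2 M \<zeta>" for \<zeta> j
    using L2_mult_integrable[OF U L2_inner_increment(1)[OF st(1) le st(3) borel_measurable_axis[OF that(1), of j] L2_axis[OF that(2), of j]]]
    by (simp add: inner_axis' mult_ac)
  have b: "2 * (\<integral>\<omega>. \<zeta> \<omega> \<bullet> ?V \<omega> \<partial>M) \<le> msq M \<zeta> + (t - s) * msq M U" if \<zeta>: "\<zeta> \<in> borel_measurable (F s)" "L2 M \<zeta>" for \<zeta>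
    using inner_le_msq[OF L2_inner_increment(1)[OF st(1) le st(3) \<zeta>] U, of "1 / (t - s)"]
      msq_inner_increment[OF st(1) le st(3) \<zeta>] st by (simp add: mult_ac)
  note L = vec_cond_exp_L2[OF s V i b]
  show "z \<in> borel_measurable (F s)" unfolding z_def using vec_cond_exp_F[of s ?V] by measurable
  show "L2 M z" unfolding z_def using L by (rule L2_scaleR)
  fix \<zeta> :: "'a \<Rightarrow> real ^ 'd" assume \<zeta>: "\<zeta> \<in> borel_measurable (F s)" "L2 M \<zeta>"
  show "(\<integral>\<omega>. U \<omega> * (\<zeta> \<omega> \<bullet> (W t \<omega> - W s \<omega>)) \<partial>M) = (t - s) * (\<integral>\<omega>. z \<omega> \<bullet> \<zeta> \<omega> \<partial>M)"
    using vec_cond_exp_test[OF s \<zeta>(1) V i[OF \<zeta>]] st by (simp add: z_def inner_commute)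
qed

lemma L2_vec_cond_exp:
  fixes V :: "'a \<Rightarrow> real ^ 'n"
  assumes s: "s \<in> {0..T}" and V: "L2 M V"
  shows "L2 M (vec_cond_exp M (F s) V)"
    and "\<And>\<zeta>. \<zeta> \<in> borel_measurable (F s) \<Longrightarrow> L2 M \<zeta> \<Longrightarrow>
      (\<integral>\<omega>. vec_cond_exp M (F s) V \<omega> \<bullet> \<zeta> \<omega> \<partial>M) = (\<integral>\<omega>. \<zeta> \<omega> \<bullet> V \<omega> \<partial>M)"
proof -
  have i: "integrable M (\<lambda>\<omega>. \<zeta> \<omega> $ j * V \<omega> $ j)" if "L2 M \<zeta>" for \<zeta> j
    by (intro L2_mult_integrable L2_component that V)
  have b: "2 * (\<integral>\<omega>. \<zeta> \<omega> \<bullet> V \<omega> \<partial>M) \<le> msq M \<zeta> + msq M V" if "L2 M \<zeta>" for \<zeta>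
    using inner_le_msq[OF that V, of 1] by simp
  show "L2 M (vec_cond_exp M (F s) V)" by (rule vec_cond_exp_L2[OF s L2_measurable[OF V] i b])
  show "(\<integral>\<omega>. vec_cond_exp M (F s) V \<omega> \<bullet> \<zeta> \<omega> \<partial>M) = (\<integral>\<omega>. \<zeta> \<omega> \<bullet> V \<omega> \<partial>M)"
    if "\<zeta> \<in> borel_measurable (F s)" "L2 M \<zeta>" for \<zeta>
    using vec_cond_exp_test[OF s that(1) L2_measurable[OF V] i[OF that(2)]] by (simp add: inner_commute)
qed

section \<open>The quadratic loss\<close>

lemma msq_past_increment:
  assumes st: "0 \<le> s" "s < t" "t \<le> T"
    and A: "A \<in> borel_measurable (F s)" "L2 M A" and \<zeta>: "\<zeta> \<in> borel_measurable (F s)" "L2 M \<zeta>"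
  shows "msq M (\<lambda>\<omega>. A \<omega> + \<zeta> \<omega> \<bullet> (W t \<omega> - W s \<omega>)) = msq M A + (t - s) * msq M \<zeta>"
  using msq_add[OF A(2) L2_inner_increment(1)[of s t, OF _ _ _ \<zeta>]] L2_inner_increment(3)[of s t, OF _ _ _ \<zeta> A]
    msq_inner_increment[of s t, OF _ _ _ \<zeta>] st
  by (simp add: mult.commute)

text \<open>Orthogonal decomposition of the loss: the residual of the projection of \<open>U\<close> onto
  \<open>{A + \<zeta> \<bullet> \<Delta>W}\<close>, with \<open>A\<close> and \<open>\<zeta>\<close> known at time \<open>s\<close>, does not depend on \<open>A\<close> and \<open>\<zeta>\<close>. The coefficients
  of the projection are the conditional expectations of \<open>U\<close> and of \<open>U \<Delta>W / (t - s)\<close>.\<close>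

lemma loss_decomposition:
  assumes st: "0 \<le> s" "s < t" "t \<le> T" and U: "L2 M U"
    and A: "A \<in> borel_measurable (F s)" "L2 M A" and \<zeta>: "\<zeta> \<in> borel_measurable (F s)" "L2 M \<zeta>"
  defines "z \<equiv> \<lambda>\<omega>. (1 / (t - s)) *\<^sub>R vec_cond_exp M (F s) (\<lambda>\<omega>'. U \<omega>' *\<^sub>R (W t \<omega>' - W s \<omega>')) \<omega>"
  shows "msq M (\<lambda>\<omega>. U \<omega> - (A \<omega> + \<zeta> \<omega> \<bullet> (W t \<omega> - W s \<omega>)))
    = msq M (\<lambda>\<omega>. U \<omega> - (real_cond_exp M (F s) U \<omega> + z \<omega> \<bullet> (W t \<omega> - W s \<omega>)))
      + (msq M (\<lambda>\<omega>. real_cond_exp M (F s) U \<omega> - A \<omega>) + (t - s) * msq M (\<lambda>\<omega>. z \<omega> - \<zeta> \<omega>))"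
proof -
  let ?D = "\<lambda>\<omega>. W t \<omega> - W s \<omega>" and ?a = "real_cond_exp M (F s) U"
  have s: "s \<in> {0..T}" and le: "s \<le> t" using st by auto
  note z = increment_cond_exp[OF st U, folded z_def]
  note aL = cond_exp_L2[OF s U]
  note inc = L2_inner_increment[OF st(1) le st(3)]
  have RL: "L2 M (\<lambda>\<omega>. U \<omega> - (?a \<omega> + z \<omega> \<bullet> ?D \<omega>))"
    by (intro L2_diff L2_add U aL inc z)
  let ?\<alpha> = "\<lambda>\<omega>. ?a \<omega> - A \<omega>" and ?\<beta> = "\<lambda>\<omega>. z \<omega> - \<zeta> \<omega>"
  have \<alpha>: "?\<alpha> \<in> borel_measurable (F s)" "L2 M ?\<alpha>"
    using cond_exp_F[of s U] A L2_diff[OF aL A(2)] by auto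
  have \<beta>: "?\<beta> \<in> borel_measurable (F s)" "L2 M ?\<beta>"
    using z \<zeta> L2_diff[OF z(2) \<zeta>(2)] by auto
  have \<beta>D: "L2 M (\<lambda>\<omega>. ?\<beta> \<omega> \<bullet> ?D \<omega>)" and zD: "L2 M (\<lambda>\<omega>. z \<omega> \<bullet> ?D \<omega>)"
    by (intro inc \<beta> z)+
  have "(\<integral>\<omega>. (U \<omega> - (?a \<omega> + z \<omega> \<bullet> ?D \<omega>)) * (?\<alpha> \<omega> + ?\<beta> \<omega> \<bullet> ?D \<omega>) \<partial>M)
      = (\<integral>\<omega>. U \<omega> * ?\<alpha> \<omega> \<partial>M) - (\<integral>\<omega>. ?a \<omega> * ?\<alpha> \<omega> \<partial>M) - (\<integral>\<omega>. (z \<omega> \<bullet> ?D \<omega>) * ?\<alpha> \<omega> \<partial>M)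
        + (\<integral>\<omega>. U \<omega> * (?\<beta> \<omega> \<bullet> ?D \<omega>) \<partial>M) - (\<integral>\<omega>. (?\<beta> \<omega> \<bullet> ?D \<omega>) * ?a \<omega> \<partial>M)
        - (\<integral>\<omega>. (z \<omega> \<bullet> ?D \<omega>) * (?\<beta> \<omega> \<bullet> ?D \<omega>) \<partial>M)"
  proof -
    have i: "integrable M (\<lambda>\<omega>. U \<omega> * ?\<alpha> \<omega>)" "integrable M (\<lambda>\<omega>. ?a \<omega> * ?\<alpha> \<omega>)"
      "integrable M (\<lambda>\<omega>. (z \<omega> \<bullet> ?D \<omega>) * ?\<alpha> \<omega>)" "integrable M (\<lambda>\<omega>. U \<omega> * (?\<beta> \<omega> \<bullet> ?D \<omega>))"
      "integrable M (\<lambda>\<omega>. (?\<beta> \<omega> \<bullet> ?D \<omega>) * ?a \<omega>)" "integrable M (\<lambda>\<omega>. (z \<omega> \<bullet> ?D \<omega>) * (?\<beta> \<omega> \<bullet> ?D \<omega>))"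
      by (intro L2_mult_integrable U aL \<alpha> zD \<beta>D)+
    have alg: "(u - (a + x)) * (p + q) = u * p - a * p - x * p + u * q - q * a - x * q" for u a x p q :: real
      by (simp add: algebra_simps)
    have "(U \<omega> - (?a \<omega> + z \<omega> \<bullet> ?D \<omega>)) * (?\<alpha> \<omega> + ?\<beta> \<omega> \<bullet> ?D \<omega>)
      = U \<omega> * ?\<alpha> \<omega> - ?a \<omega> * ?\<alpha> \<omega> - (z \<omega> \<bullet> ?D \<omega>) * ?\<alpha> \<omega> + U \<omega> * (?\<beta> \<omega> \<bullet> ?D \<omega>)
        - (?\<beta> \<omega> \<bullet> ?D \<omega>) * ?a \<omega> - (z \<omega> \<bullet> ?D \<omega>) * (?\<beta> \<omega> \<bullet> ?D \<omega>)" for \<omega>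
      by (rule alg)
    then show ?thesis
      by (simp only: Bochner_Integration.integral_diff Bochner_Integration.integral_add
          Bochner_Integration.integrable_diff Bochner_Integration.integrable_add i)
  qed
  also have "\<dots> = 0"
  proof -
    have "(\<integral>\<omega>. U \<omega> * (?\<beta> \<omega> \<bullet> ?D \<omega>) \<partial>M) = (t - s) * (\<integral>\<omega>. z \<omega> \<bullet> ?\<beta> \<omega> \<partial>M)"
      using z(3)[OF \<beta>] by (simp only: z_def)
    then show ?thesis
      by (simp only: cond_exp_test[OF s \<alpha> U] inc(3)[OF z(1,2) \<alpha>] inc(3)[OF \<beta> cond_exp_F aL] inc(2)[OF z(1,2) \<beta>])
  qed
  finally have orth: "(\<integral>\<omega>. (U \<omega> - (?a \<omega> + z \<omega> \<bullet> ?D \<omega>)) \<bullet> (?\<alpha> \<omega> + ?\<beta> \<omega> \<bullet> ?D \<omega>) \<partial>M) = 0"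
    by (simp only: inner_real_def)
  have eq: "U \<omega> - (A \<omega> + \<zeta> \<omega> \<bullet> ?D \<omega>) = (U \<omega> - (?a \<omega> + z \<omega> \<bullet> ?D \<omega>)) + (?\<alpha> \<omega> + ?\<beta> \<omega> \<bullet> ?D \<omega>)" for \<omega>
    by (simp only: inner_diff_left)
  have "msq M (\<lambda>\<omega>. U \<omega> - (A \<omega> + \<zeta> \<omega> \<bullet> ?D \<omega>))
      = msq M (\<lambda>\<omega>. (U \<omega> - (?a \<omega> + z \<omega> \<bullet> ?D \<omega>)) + (?\<alpha> \<omega> + ?\<beta> \<omega> \<bullet> ?D \<omega>))"
    by (simp only: eq)
  also have "\<dots> = msq M (\<lambda>\<omega>. U \<omega> - (?a \<omega> + z \<omega> \<bullet> ?D \<omega>)) + msq M (\<lambda>\<omega>. ?\<alpha> \<omega> + ?\<beta> \<omega> \<bullet> ?D \<omega>)"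
    using msq_add[OF RL L2_add[OF \<alpha>(2) \<beta>D]] orth by simp
  also have "msq M (\<lambda>\<omega>. ?\<alpha> \<omega> + ?\<beta> \<omega> \<bullet> ?D \<omega>) = msq M ?\<alpha> + (t - s) * msq M ?\<beta>"
    by (rule msq_past_increment[OF st \<alpha> \<beta>])
  finally show ?thesis .
qed

text \<open>A finite loss forces both coefficients to be square integrable; on the truncating events, which
  belong to the past, the isometry applies.\<close>

lemma L2_past_increment:
  assumes st: "0 \<le> s" "s < t" "t \<le> T" and A: "A \<in> borel_measurable (F s)" and \<zeta>: "\<zeta> \<in> borel_measurable (F s)"
    and Q: "L2 M (\<lambda>\<omega>. A \<omega> + \<zeta> \<omega> \<bullet> (W t \<omega> - W s \<omega>))"
  shows "L2 M (A :: 'a \<Rightarrow> real)" "L2 M \<zeta>"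
proof -
  let ?D = "\<lambda>\<omega>. W t \<omega> - W s \<omega>" and ?m = "msq M (\<lambda>\<omega>. A \<omega> + \<zeta> \<omega> \<bullet> (W t \<omega> - W s \<omega>))"
  let ?S = "\<lambda>n::nat. {\<omega>. norm (A \<omega>) \<le> real n \<and> norm (\<zeta> \<omega>) \<le> real n}"
  have s: "s \<in> {0..T}" using st by auto
  note AM = F_borel_M[OF s A] and \<zeta>M = F_borel_M[OF s \<zeta>]
  have sw: "{\<omega>. norm (\<zeta> \<omega>) \<le> real n \<and> norm (A \<omega>) \<le> real n} = ?S n" for n by auto
  have b: "msq M (\<lambda>\<omega>. indicator (?S n) \<omega> *\<^sub>R A \<omega>) + (t - s) * msq M (\<lambda>\<omega>. indicator (?S n) \<omega> *\<^sub>R \<zeta> \<omega>) \<le> ?m" for n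
  proof -
    have F1: "(\<lambda>\<omega>. indicator (?S n) \<omega> *\<^sub>R A \<omega>) \<in> borel_measurable (F s)" using A \<zeta> by measurable
    have F2: "(\<lambda>\<omega>. indicator (?S n) \<omega> *\<^sub>R \<zeta> \<omega>) \<in> borel_measurable (F s)" using A \<zeta> by measurable
    have L1: "L2 M (\<lambda>\<omega>. indicator (?S n) \<omega> *\<^sub>R A \<omega>)" by (rule L2_truncation[OF AM \<zeta>M])
    have L2: "L2 M (\<lambda>\<omega>. indicator (?S n) \<omega> *\<^sub>R \<zeta> \<omega>)" using L2_truncation[OF \<zeta>M AM, of n] by (simp only: sw)
    have "msq M (\<lambda>\<omega>. indicator (?S n) \<omega> *\<^sub>R A \<omega> + (indicator (?S n) \<omega> *\<^sub>R \<zeta> \<omega>) \<bullet> ?D \<omega>) \<le> ?m"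
      by (rule msq_mono[OF Q]) (auto split: split_indicator)
    then show ?thesis using msq_past_increment[OF st F1 L1 F2 L2] by simp
  qed
  have b1: "msq M (\<lambda>\<omega>. indicator (?S n) \<omega> *\<^sub>R A \<omega>) \<le> ?m" for n
  proof -
    have "0 \<le> (t - s) * msq M (\<lambda>\<omega>. indicator (?S n) \<omega> *\<^sub>R \<zeta> \<omega>)" using st by simp
    then show ?thesis using b[of n] by linarith
  qed
  show "L2 M A" by (rule L2_by_truncation[OF AM \<zeta>M finite_measure_axioms b1])
  have b2: "msq M (\<lambda>\<omega>. indicator (?S n) \<omega> *\<^sub>R \<zeta> \<omega>) \<le> ?m / (t - s)" for n
  proof -
    have "(t - s) * msq M (\<lambda>\<omega>. indicator (?S n) \<omega> *\<^sub>R \<zeta> \<omega>) \<le> ?m"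
      using b[of n] msq_nonneg[of M "\<lambda>\<omega>. indicator (?S n) \<omega> *\<^sub>R A \<omega>"] by linarith
    then show ?thesis using st by (simp add: pos_le_divide_eq mult.commute)
  qed
  show "L2 M \<zeta>"
    by (rule L2_by_truncation[OF \<zeta>M AM finite_measure_axioms]) (use b2 in \<open>simp only: sw\<close>)
qed

section \<open>One backward step\<close>

text \<open>The difference \<open>\<delta> = Ys - V\<close> is known at time \<open>s\<close>, so its pairing with itself replaces \<open>Y' - U\<close> by its
  conditional expectation. The gain \<open>msq (D - E D)\<close> is kept: it absorbs the error of the
  \<open>Z\<close>-component.\<close>

lemma backward_step_Y:
  assumes st: "0 \<le> s" "s < t" "t \<le> T"
    and Ys: "Ys \<in> borel_measurable (F s)" "L2 M Ys" and Y': "L2 M Y'" and U: "L2 M U"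
    and \<Phi>: "L2 M \<Phi>" and N: "L2 M N"
    and N_orth: "\<And>A. A \<in> borel_measurable (F s) \<Longrightarrow> L2 M A \<Longrightarrow> (\<integral>\<omega>. N \<omega> * A \<omega> \<partial>M) = 0"
    and eq: "AE \<omega> in M. Ys \<omega> = Y' \<omega> + \<Phi> \<omega> - N \<omega>"
    and V: "V \<in> borel_measurable (F s)" "L2 M V" and k: "L2 M k"
    and V_eq: "AE \<omega> in M. V \<omega> = real_cond_exp M (F s) U \<omega> + k \<omega>"
    and e: "e > 0"
  defines "D \<equiv> \<lambda>\<omega>. Y' \<omega> - U \<omega>"
  shows "msq M (\<lambda>\<omega>. Ys \<omega> - V \<omega>) \<le> (1 + e) * (msq M D - msq M (\<lambda>\<omega>. D \<omega> - real_cond_exp M (F s) D \<omega>))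
    + (1 + 1 / e) * msq M (\<lambda>\<omega>. \<Phi> \<omega> - k \<omega>)"
proof -
  have s: "s \<in> {0..T}" using st by auto
  let ?\<delta> = "\<lambda>\<omega>. Ys \<omega> - V \<omega>" and ?E = "real_cond_exp M (F s) D" and ?\<Psi> = "\<lambda>\<omega>. \<Phi> \<omega> - k \<omega>"
  have \<delta>: "?\<delta> \<in> borel_measurable (F s)" "L2 M ?\<delta>"
    using Ys V L2_diff[OF Ys(2) V(2)] by auto
  have DL: "L2 M D" unfolding D_def by (rule L2_diff[OF Y' U])
  note EL = cond_exp_L2[OF s DL] and aL = cond_exp_L2[OF s U]
  have \<Psi>L: "L2 M ?\<Psi>" by (rule L2_diff[OF \<Phi> k])
  note i = L2_mult_integrable[OF _ \<delta>(2)]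
  have "msq M ?\<delta> = (\<integral>\<omega>. ?\<delta> \<omega> * ?\<delta> \<omega> \<partial>M)" by (simp add: msq_def power2_eq_square)
  also have "\<dots> = (\<integral>\<omega>. Y' \<omega> * ?\<delta> \<omega> - N \<omega> * ?\<delta> \<omega> - real_cond_exp M (F s) U \<omega> * ?\<delta> \<omega> + ?\<Psi> \<omega> * ?\<delta> \<omega> \<partial>M)"
  proof (rule integral_cong_AE)
    show "AE \<omega> in M. ?\<delta> \<omega> * ?\<delta> \<omega> = Y' \<omega> * ?\<delta> \<omega> - N \<omega> * ?\<delta> \<omega> - real_cond_exp M (F s) U \<omega> * ?\<delta> \<omega> + ?\<Psi> \<omega> * ?\<delta> \<omega>"
      using eq V_eq
    proof eventually_elim
      case (elim \<omega>)
      have "?\<delta> \<omega> = Y' \<omega> - N \<omega> - real_cond_exp M (F s) U \<omega> + ?\<Psi> \<omega>" using elim by simp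
      then have "?\<delta> \<omega> * x = (Y' \<omega> - N \<omega> - real_cond_exp M (F s) U \<omega> + ?\<Psi> \<omega>) * x" for x by simp
      then show ?case by (simp only: left_diff_distrib distrib_right)
    qed
  qed (use i[OF \<delta>(2)] i[OF Y'] i[OF N] i[OF aL] i[OF \<Psi>L] in \<open>simp_all add: borel_measurable_integrable\<close>)
  also have "\<dots> = (\<integral>\<omega>. Y' \<omega> * ?\<delta> \<omega> \<partial>M) - (\<integral>\<omega>. N \<omega> * ?\<delta> \<omega> \<partial>M) - (\<integral>\<omega>. real_cond_exp M (F s) U \<omega> * ?\<delta> \<omega> \<partial>M)
      + (\<integral>\<omega>. ?\<Psi> \<omega> * ?\<delta> \<omega> \<partial>M)"
    by (simp only: Bochner_Integration.integral_diff Bochner_Integration.integral_add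
        Bochner_Integration.integrable_diff Bochner_Integration.integrable_add i[OF Y'] i[OF N] i[OF aL] i[OF \<Psi>L])
  also have "\<dots> = (\<integral>\<omega>. Y' \<omega> * ?\<delta> \<omega> \<partial>M) - (\<integral>\<omega>. U \<omega> * ?\<delta> \<omega> \<partial>M) + (\<integral>\<omega>. ?\<Psi> \<omega> * ?\<delta> \<omega> \<partial>M)"
    using N_orth[OF \<delta>] cond_exp_test[OF s \<delta> U] by simp
  also have "(\<integral>\<omega>. Y' \<omega> * ?\<delta> \<omega> \<partial>M) - (\<integral>\<omega>. U \<omega> * ?\<delta> \<omega> \<partial>M) = (\<integral>\<omega>. D \<omega> * ?\<delta> \<omega> \<partial>M)"
    unfolding D_def left_diff_distrib[of "Y' _"] by (rule Bochner_Integration.integral_diff[OF i[OF Y'] i[OF U], symmetric])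
  also have "(\<integral>\<omega>. D \<omega> * ?\<delta> \<omega> \<partial>M) = (\<integral>\<omega>. ?E \<omega> * ?\<delta> \<omega> \<partial>M)"
    by (rule cond_exp_test[OF s \<delta> DL, symmetric])
  also have "(\<integral>\<omega>. ?E \<omega> * ?\<delta> \<omega> \<partial>M) + (\<integral>\<omega>. ?\<Psi> \<omega> * ?\<delta> \<omega> \<partial>M) = (\<integral>\<omega>. (?E \<omega> + ?\<Psi> \<omega>) \<bullet> ?\<delta> \<omega> \<partial>M)"
    by (simp only: inner_real_def distrib_right Bochner_Integration.integral_add[OF i[OF EL] i[OF \<Psi>L]])
  finally have "msq M ?\<delta> \<le> msq M (\<lambda>\<omega>. ?E \<omega> + ?\<Psi> \<omega>)"
    using inner_le_msq[OF L2_add[OF EL \<Psi>L] \<delta>(2), of 1] by simp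
  also have "\<dots> \<le> (1 + e) * msq M ?E + (1 + 1 / e) * msq M ?\<Psi>"
    by (rule msq_add_young[OF EL \<Psi>L e])
  finally show ?thesis using cond_exp_pythagoras[OF s DL] by simp
qed

text \<open>By duality again: with \<open>q = Zb - z\<close>, the pairing of \<open>(t - s) q\<close> with itself is the expectation of
  \<open>(N - U) (q \<bullet> \<Delta>W)\<close>, and everything in \<open>N - U\<close> that is known at time \<open>s\<close> is orthogonal to \<open>q \<bullet> \<Delta>W\<close>. What is
  left is \<open>D - E D + \<Phi>\<close>.\<close>

lemma backward_step_Z:
  assumes st: "0 \<le> s" "s < t" "t \<le> T"
    and Ys: "Ys \<in> borel_measurable (F s)" "L2 M Ys" and Y': "L2 M Y'" and U: "L2 M U"
    and \<Phi>: "L2 M \<Phi>" and N: "L2 M N" and eq: "AE \<omega> in M. Ys \<omega> = Y' \<omega> + \<Phi> \<omega> - N \<omega>"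
    and Zb: "Zb \<in> borel_measurable (F s)" "L2 M Zb"
    and Zb_test: "\<And>\<zeta>. \<zeta> \<in> borel_measurable (F s) \<Longrightarrow> L2 M \<zeta> \<Longrightarrow>
      (\<integral>\<omega>. N \<omega> * (\<zeta> \<omega> \<bullet> (W t \<omega> - W s \<omega>)) \<partial>M) = (t - s) * (\<integral>\<omega>. Zb \<omega> \<bullet> \<zeta> \<omega> \<partial>M)"
  defines "D \<equiv> \<lambda>\<omega>. Y' \<omega> - U \<omega>"
    and "z \<equiv> \<lambda>\<omega>. (1 / (t - s)) *\<^sub>R vec_cond_exp M (F s) (\<lambda>\<omega>'. U \<omega>' *\<^sub>R (W t \<omega>' - W s \<omega>')) \<omega>"
  shows "(t - s) * msq M (\<lambda>\<omega>. Zb \<omega> - z \<omega>)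
    \<le> 2 * msq M (\<lambda>\<omega>. D \<omega> - real_cond_exp M (F s) D \<omega>) + 2 * msq M \<Phi>"
proof -
  have s: "s \<in> {0..T}" and le: "s \<le> t" using st by auto
  note z = increment_cond_exp[OF st U, folded z_def]
  let ?q = "\<lambda>\<omega>. Zb \<omega> - z \<omega>" and ?E = "real_cond_exp M (F s) D"
  let ?w = "\<lambda>\<omega>. ?q \<omega> \<bullet> (W t \<omega> - W s \<omega>)"
  have q: "?q \<in> borel_measurable (F s)" "L2 M ?q"
    using Zb z L2_diff[OF Zb(2) z(2)] by auto
  have w: "L2 M ?w" by (rule L2_inner_increment(1)[OF st(1) le st(3) q])
  have DL: "L2 M D" unfolding D_def by (rule L2_diff[OF Y' U])
  note EL = cond_exp_L2[OF s DL]
  have D\<Phi>: "L2 M (\<lambda>\<omega>. (D \<omega> - ?E \<omega>) + \<Phi> \<omega>)" by (intro L2_add L2_diff DL EL \<Phi>)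
  note i = L2_mult_integrable[OF _ w]
  have past: "(\<integral>\<omega>. A \<omega> * ?w \<omega> \<partial>M) = 0" if "A \<in> borel_measurable (F s)" "L2 M A" for A
    using L2_inner_increment(3)[OF st(1) le st(3) q that] by (simp only: mult.commute)
  have "(t - s) * msq M ?q = (t - s) * (\<integral>\<omega>. Zb \<omega> \<bullet> ?q \<omega> \<partial>M) - (t - s) * (\<integral>\<omega>. z \<omega> \<bullet> ?q \<omega> \<partial>M)"
    unfolding msq_inner_self[symmetric] inner_diff_left[of "Zb _"]
    by (subst Bochner_Integration.integral_diff[OF L2_inner_integrable[OF Zb(2) q(2)] L2_inner_integrable[OF z(2) q(2)]])
       (rule right_diff_distrib)
  also have "\<dots> = (\<integral>\<omega>. N \<omega> * ?w \<omega> \<partial>M) - (\<integral>\<omega>. U \<omega> * ?w \<omega> \<partial>M)"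
    unfolding Zb_test[OF q] z(3)[OF q] by (simp only: z_def)
  also have "(\<integral>\<omega>. N \<omega> * ?w \<omega> \<partial>M) = (\<integral>\<omega>. Y' \<omega> * ?w \<omega> + \<Phi> \<omega> * ?w \<omega> - Ys \<omega> * ?w \<omega> \<partial>M)"
  proof (rule integral_cong_AE)
    show "AE \<omega> in M. N \<omega> * ?w \<omega> = Y' \<omega> * ?w \<omega> + \<Phi> \<omega> * ?w \<omega> - Ys \<omega> * ?w \<omega>"
      using eq
    proof eventually_elim
      case (elim \<omega>)
      then have "N \<omega> = Y' \<omega> + \<Phi> \<omega> - Ys \<omega>" by simp
      then show ?case by (simp only: left_diff_distrib distrib_right)
    qed
  qed (use i[OF Ys(2)] i[OF Y'] i[OF N] i[OF \<Phi>] in \<open>simp_all add: borel_measurable_integrable\<close>)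
  also have "\<dots> = (\<integral>\<omega>. Y' \<omega> * ?w \<omega> \<partial>M) + (\<integral>\<omega>. \<Phi> \<omega> * ?w \<omega> \<partial>M)"
    by (simp only: Bochner_Integration.integral_diff Bochner_Integration.integral_add
        Bochner_Integration.integrable_diff Bochner_Integration.integrable_add i[OF Ys(2)] i[OF Y'] i[OF \<Phi>] past[OF Ys] diff_zero)
  also have "\<dots> - (\<integral>\<omega>. U \<omega> * ?w \<omega> \<partial>M) = (\<integral>\<omega>. ((D \<omega> - ?E \<omega>) + \<Phi> \<omega>) \<bullet> ?w \<omega> \<partial>M)"
    using past[OF cond_exp_F EL]
    by (simp only: inner_real_def distrib_right left_diff_distrib D_def Bochner_Integration.integral_diff Bochner_Integration.integral_add
        Bochner_Integration.integrable_diff Bochner_Integration.integrable_add i[OF U] i[OF Y'] i[OF \<Phi>] i[OF EL, unfolded D_def])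
  finally have "2 * ((t - s) * msq M ?q) \<le> msq M (\<lambda>\<omega>. (D \<omega> - ?E \<omega>) + \<Phi> \<omega>) + (t - s) * msq M ?q"
    using inner_le_msq[OF D\<Phi> w, of 1] msq_inner_increment[OF st(1) le st(3) q] by simp
  then have "(t - s) * msq M ?q \<le> msq M (\<lambda>\<omega>. (D \<omega> - ?E \<omega>) + \<Phi> \<omega>)" by simp
  also have "\<dots> \<le> 2 * msq M (\<lambda>\<omega>. D \<omega> - ?E \<omega>) + 2 * msq M \<Phi>"
    by (intro msq_add_le L2_diff DL EL \<Phi>)
  finally show ?thesis .
qed

end

section \<open>The solution of the BSDE on a short interval\<close>

text \<open>Tonelli with the time integral outside. It turns moment bounds at each fixed time, which do not
  involve a supremum over paths, into bounds over the slab.\<close>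

lemma (in prob_space) slab_fixed_time_bound:
  fixes H :: "real \<times> 'a \<Rightarrow> 'b::euclidean_space"
  assumes ab: "a \<le> b" and H: "H \<in> borel_measurable (slab a b M)" and B: "0 \<le> B"
    and bound: "\<And>s. s \<in> {a<..b} \<Longrightarrow> (\<integral>\<^sup>+\<omega>. ennreal ((norm (H (s, \<omega>)))\<^sup>2) \<partial>M) \<le> ennreal B"
  shows "L2 (slab a b M) H" "msq (slab a b M) H \<le> (b - a) * B"
proof -
  let ?h = "\<lambda>q. ennreal ((norm (H q))\<^sup>2)"
  have hm: "?h \<in> borel_measurable (slab a b M)" using H by measurable
  have m: "(\<lambda>q. ?h q * indicator ({a<..b} \<times> space M) q) \<in> borel_measurable (lborel \<Otimes>\<^sub>M M)"
    using hm unfolding slab_def by (subst (asm) borel_measurable_restrict_space_iff_ennreal[OF slab_set])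
  have "(\<integral>\<^sup>+q. ?h q \<partial>slab a b M) = (\<integral>\<^sup>+q. ?h q * indicator ({a<..b} \<times> space M) q \<partial>(lborel \<Otimes>\<^sub>M M))"
    unfolding slab_def by (rule nn_integral_restrict_space[OF slab_set])
  also have "\<dots> = (\<integral>\<^sup>+s. (\<integral>\<^sup>+\<omega>. ?h (s, \<omega>) * indicator ({a<..b} \<times> space M) (s, \<omega>) \<partial>M) \<partial>lborel)"
    by (rule nn_integral_fst[OF m, symmetric])
  also have "\<dots> \<le> (\<integral>\<^sup>+s. ennreal B * indicator {a<..b} s \<partial>lborel)"
  proof (rule nn_integral_mono)
    fix s
    show "(\<integral>\<^sup>+\<omega>. ?h (s, \<omega>) * indicator ({a<..b} \<times> space M) (s, \<omega>) \<partial>M) \<le> ennreal B * indicator {a<..b} s"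
    proof (cases "s \<in> {a<..b}")
      case True
      then have "(\<integral>\<^sup>+\<omega>. ?h (s, \<omega>) * indicator ({a<..b} \<times> space M) (s, \<omega>) \<partial>M) = (\<integral>\<^sup>+\<omega>. ?h (s, \<omega>) \<partial>M)"
        by (intro nn_integral_cong) (simp add: indicator_def)
      then show ?thesis using bound[OF True] True by simp
    next
      case False
      then have "(\<lambda>\<omega>. ?h (s, \<omega>) * indicator ({a<..b} \<times> space M) (s, \<omega>)) = (\<lambda>\<omega>. 0)"
        by (auto simp: indicator_def)
      then show ?thesis by simp
    qed
  qed
  also have "\<dots> = ennreal ((b - a) * B)"
    using ab B by (simp add: nn_integral_cmult_indicator ennreal_mult mult.commute)
  finally have le: "(\<integral>\<^sup>+q. ?h q \<partial>slab a b M) \<le> ennreal ((b - a) * B)" .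
  then show L: "L2 (slab a b M) H"
    using H by (subst L2_iff_nn_integral) (auto simp: less_top[symmetric] top_unique)
  show "msq (slab a b M) H \<le> (b - a) * B"
    using le ab B by (simp add: nn_integral_L2[OF L])
qed

lemma progressive_adapted:
  assumes H: "progressive T F H" and t: "t \<in> {0..T}"
  shows "H t \<in> borel_measurable (F t)"
proof -
  have 1: "(\<lambda>(s, \<omega>). H s \<omega>) \<in> borel_measurable (restrict_space borel {0..t} \<Otimes>\<^sub>M F t)"
    using H t by (simp add: progressive_def)
  have 2: "Pair t \<in> measurable (F t) (restrict_space borel {0..t} \<Otimes>\<^sub>M F t)"
    using t by (intro measurable_Pair1') (auto simp: space_restrict_space)
  show ?thesis using measurable_compose[OF 2 1] by simp
qed

text \<open>The continuous-time part of the setting. The moment bound is stated at fixed times, since the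
  supremum over an interval need not be measurable.\<close>

locale bsde_space = brownian_space M T F W
  for M :: "'a measure" and T :: real and F :: "real \<Rightarrow> 'a measure" and W :: "real \<Rightarrow> 'a \<Rightarrow> real ^ 'd" +
  fixes f :: "real \<Rightarrow> real ^ 'd \<Rightarrow> real \<Rightarrow> real ^ 'd \<Rightarrow> real" and g :: "real ^ 'd \<Rightarrow> real" and f_L :: real
    and \<X> :: "real \<Rightarrow> 'a \<Rightarrow> real ^ 'd" and Y :: "real \<Rightarrow> 'a \<Rightarrow> real" and Z :: "real \<Rightarrow> 'a \<Rightarrow> real ^ 'd"
    and B\<^sub>X :: real
  assumes f_L_pos: "0 < f_L"
    and f_lip: "\<And>t1 t2 x1 x2 y1 y2 z1 z2. t1 \<in> {0..T} \<Longrightarrow> t2 \<in> {0..T} \<Longrightarrow>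
           \<bar>f t2 x2 y2 z2 - f t1 x1 y1 z1\<bar>
             \<le> f_L * (sqrt \<bar>t2 - t1\<bar> + norm (x2 - x1) + \<bar>y2 - y1\<bar> + norm (z2 - z1))"
    and \<X>_prog: "progressive T F \<X>"
    and \<X>_moment: "\<And>t. t \<in> {0..T} \<Longrightarrow> (\<integral>\<^sup>+\<omega>. ennreal ((norm (\<X> t \<omega>))\<^sup>2) \<partial>M) \<le> ennreal B\<^sub>X"
    and B\<^sub>X_nonneg: "0 \<le> B\<^sub>X"
    and YZ: "bsde_solution T M F W f g \<X> Y Z"
begin

definition driver :: "real \<Rightarrow> 'a \<Rightarrow> real" where
  "driver s \<omega> = f s (\<X> s \<omega>) (Y s \<omega>) (Z s \<omega>)"

definition ito_Z :: "real \<Rightarrow> 'a \<Rightarrow> real" where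
  "ito_Z t \<omega> = g (\<X> T \<omega>) + time_integral t T driver \<omega> - Y t \<omega>"

text \<open>Clamping the time to \<open>{0..T}\<close> makes \<open>f\<close> continuous on the whole space without changing it where it is
  evaluated; measurability of compositions follows.\<close>

lemma continuous_clamped_driver:
  "continuous_on UNIV (\<lambda>(t, x, y, z). f (max 0 (min T t)) x y z)"
proof (rule continuous_at_imp_continuous_on, rule ballI, unfold isCont_def)
  fix p :: "real \<times> (real ^ 'd) \<times> real \<times> (real ^ 'd)"
  let ?h = "\<lambda>(t, x, y, z). f (max 0 (min T t)) x y z"
  let ?b = "\<lambda>p'. f_L * (sqrt \<bar>fst p' - fst p\<bar> + norm (fst (snd p') - fst (snd p))
      + \<bar>fst (snd (snd p')) - fst (snd (snd p))\<bar> + norm (snd (snd (snd p')) - snd (snd (snd p))))"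
  have "((\<lambda>p'. ?h p' - ?h p) \<longlongrightarrow> 0) (at p)"
  proof (rule Lim_null_comparison)
    show "eventually (\<lambda>p'. norm (?h p' - ?h p) \<le> ?b p') (at p)"
    proof (rule always_eventually, rule allI)
      fix p' :: "real \<times> (real ^ 'd) \<times> real \<times> (real ^ 'd)"
      obtain t' x' y' z' where p': "p' = (t', x', y', z')" by (rule prod_cases4)
      obtain t x y z where p: "p = (t, x, y, z)" by (rule prod_cases4)
      have T0: "0 \<le> T" using T_pos by simp
      have cl: "max 0 (min T r) \<in> {0..T}" for r using T0 by simp
      have c1: "\<bar>max 0 u' - max 0 u\<bar> \<le> \<bar>u' - u\<bar>" for u u' :: real by (auto simp: max_def)
      have c2: "\<bar>min T u' - min T u\<bar> \<le> \<bar>u' - u\<bar>" for u u' :: real by (auto simp: min_def)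
      have "\<bar>max 0 (min T t') - max 0 (min T t)\<bar> \<le> \<bar>t' - t\<bar>" by (rule order_trans[OF c1 c2])
      then have sq: "sqrt \<bar>max 0 (min T t') - max 0 (min T t)\<bar> \<le> sqrt \<bar>t' - t\<bar>" by simp
      have "\<bar>f (max 0 (min T t')) x' y' z' - f (max 0 (min T t)) x y z\<bar>
          \<le> f_L * (sqrt \<bar>max 0 (min T t') - max 0 (min T t)\<bar> + norm (x' - x) + \<bar>y' - y\<bar> + norm (z' - z))"
        by (rule f_lip[OF cl cl])
      also have "\<dots> \<le> f_L * (sqrt \<bar>t' - t\<bar> + norm (x' - x) + \<bar>y' - y\<bar> + norm (z' - z))"
        using f_L_pos sq by (intro mult_left_mono) simp_all
      finally have "\<bar>f (max 0 (min T t')) x' y' z' - f (max 0 (min T t)) x y z\<bar>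
          \<le> f_L * (sqrt \<bar>t' - t\<bar> + norm (x' - x) + \<bar>y' - y\<bar> + norm (z' - z))" .
      then show "norm (?h p' - ?h p) \<le> ?b p'" by (simp only: p p' split_conv fst_conv snd_conv real_norm_def)
    qed
    have "isCont ?b p" by (intro continuous_intros)
    then have "(?b \<longlongrightarrow> ?b p) (at p)" unfolding isCont_def .
    then show "(?b \<longlongrightarrow> 0) (at p)" by simp
  qed
  then show "(?h \<longlongrightarrow> ?h p) (at p)" by (rule LIM_zero_cancel)
qed

lemma f_measurable:
  assumes [measurable]: "t \<in> borel_measurable N" "x \<in> borel_measurable N" "y \<in> borel_measurable N" "z \<in> borel_measurable N"
    and t: "\<And>q. q \<in> space N \<Longrightarrow> t q \<in> {0..T}"
  shows "(\<lambda>q. f (t q) (x q) (y q) (z q)) \<in> borel_measurable N"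
proof -
  have m: "(\<lambda>q. (t q, x q, y q, z q)) \<in> borel_measurable N"
    by (intro borel_measurable_Pair assms)
  have "(\<lambda>q. (\<lambda>(t, x, y, z). f (max 0 (min T t)) x y z) (t q, x q, y q, z q)) \<in> borel_measurable N"
    by (rule borel_measurable_continuous_on[OF continuous_clamped_driver m])
  then show ?thesis
    using t by (subst measurable_cong[where g = "\<lambda>q. (\<lambda>(t, x, y, z). f (max 0 (min T t)) x y z) (t q, x q, y q, z q)"]) auto
qed

lemma f_L2:
  assumes N: "finite_measure N" and t: "t \<in> borel_measurable N" "\<And>q. q \<in> space N \<Longrightarrow> t q \<in> {0..T}"
    and x: "L2 N x" and y: "L2 N y" and z: "L2 N z"
  shows "L2 N (\<lambda>q. f (t q) (x q) (y q) (z q))"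
proof -
  have m: "(\<lambda>q. f (t q) (x q) (y q) (z q)) \<in> borel_measurable N"
    by (intro f_measurable t L2_measurable[OF x] L2_measurable[OF y] L2_measurable[OF z])
  let ?b = "\<lambda>q. \<bar>f 0 0 0 0\<bar> + f_L * (sqrt T + norm (x q) + norm (y q) + norm (z q))"
  have b: "L2 N ?b"
    by (intro L2_add L2_const[OF N] L2_mult_left L2_norm x y z)
  show ?thesis
  proof (rule L2_dominated[OF b m, where C = 1], rule AE_I2)
    fix q assume "q \<in> space N"
    then have tq: "t q \<in> {0..T}" by (rule t)
    have "\<bar>f (t q) (x q) (y q) (z q) - f 0 0 0 0\<bar>
        \<le> f_L * (sqrt \<bar>t q - 0\<bar> + norm (x q - 0) + \<bar>y q - 0\<bar> + norm (z q - 0))"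
      using T_pos tq by (intro f_lip) auto
    also have "\<dots> \<le> f_L * (sqrt T + norm (x q) + norm (y q) + norm (z q))"
      using f_L_pos tq by (intro mult_left_mono) auto
    finally have "\<bar>f (t q) (x q) (y q) (z q)\<bar> \<le> ?b q" by linarith
    then show "norm (f (t q) (x q) (y q) (z q)) \<le> 1 * norm (?b q)" by simp
  qed
qed

lemma
  shows Y_prog: "progressive T F Y" and Z_prog: "progressive T F Z"
    and YZ_moment: "(\<integral>\<^sup>+\<omega>. (\<Squnion>t\<in>{0..T}. ennreal (\<bar>Y t \<omega>\<bar>\<^sup>2)) + (\<integral>\<^sup>+t\<in>{0..T}. ennreal ((norm (Z t \<omega>))\<^sup>2) \<partial>lborel) \<partial>M) < \<infinity>"
    and ito_Z: "\<And>t. t \<in> {0..T} \<Longrightarrow> has_ito_integral M F W t T Z (ito_Z t)"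
  using YZ unfolding bsde_solution_def ito_Z_def[abs_def] time_integral_def driver_def by auto

lemma T_in: "T \<in> {0..T}" "0 \<in> {0..T}"
  using T_pos by auto

lemma slab_measurable:
  "(\<lambda>(s, \<omega>). \<X> s \<omega>) \<in> borel_measurable (slab 0 T M)"
  "(\<lambda>(s, \<omega>). Y s \<omega>) \<in> borel_measurable (slab 0 T M)"
  "(\<lambda>(s, \<omega>). Z s \<omega>) \<in> borel_measurable (slab 0 T M)"
  using progressive_measurable_slab[OF \<X>_prog subalg[OF T_in(1)]] progressive_measurable_slab[OF Y_prog subalg[OF T_in(1)]]
    progressive_measurable_slab[OF Z_prog subalg[OF T_in(1)]] T_pos by auto

lemma \<X>_F: "t \<in> {0..T} \<Longrightarrow> \<X> t \<in> borel_measurable (F t)"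
  and Y_F: "t \<in> {0..T} \<Longrightarrow> Y t \<in> borel_measurable (F t)"
  using progressive_adapted \<X>_prog Y_prog by auto

lemma \<X>_L2: "t \<in> {0..T} \<Longrightarrow> L2 M (\<X> t)"
  using F_borel_M[OF _ \<X>_F] le_less_trans[OF \<X>_moment] by (subst L2_iff_nn_integral) auto

lemma slab_\<X>: "L2 (slab 0 T M) (\<lambda>(s, \<omega>). \<X> s \<omega>)"
  by (rule slab_fixed_time_bound(1)[OF _ slab_measurable(1) B\<^sub>X_nonneg]) (use T_pos \<X>_moment in auto)

lemma Y_moment: "\<exists>B\<ge>0. \<forall>t\<in>{0..T}. (\<integral>\<^sup>+\<omega>. ennreal ((norm (Y t \<omega>))\<^sup>2) \<partial>M) \<le> ennreal B"
proof -
  let ?E = "\<integral>\<^sup>+\<omega>. (\<Squnion>t\<in>{0..T}. ennreal (\<bar>Y t \<omega>\<bar>\<^sup>2)) + (\<integral>\<^sup>+t\<in>{0..T}. ennreal ((norm (Z t \<omega>))\<^sup>2) \<partial>lborel) \<partial>M"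
  have "(\<integral>\<^sup>+\<omega>. ennreal ((norm (Y t \<omega>))\<^sup>2) \<partial>M) \<le> ennreal (enn2real ?E)" if "t \<in> {0..T}" for t
  proof -
    have "(\<integral>\<^sup>+\<omega>. ennreal ((norm (Y t \<omega>))\<^sup>2) \<partial>M) \<le> ?E"
    proof (rule nn_integral_mono)
      fix \<omega>
      have "ennreal ((norm (Y t \<omega>))\<^sup>2) \<le> (\<Squnion>t\<in>{0..T}. ennreal (\<bar>Y t \<omega>\<bar>\<^sup>2))"
        using that by (intro SUP_upper2[of t]) auto
      also have "\<dots> \<le> (\<Squnion>t\<in>{0..T}. ennreal (\<bar>Y t \<omega>\<bar>\<^sup>2)) + (\<integral>\<^sup>+t\<in>{0..T}. ennreal ((norm (Z t \<omega>))\<^sup>2) \<partial>lborel)"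
        by simp
      finally show "ennreal ((norm (Y t \<omega>))\<^sup>2) \<le> (\<Squnion>t\<in>{0..T}. ennreal (\<bar>Y t \<omega>\<bar>\<^sup>2)) + (\<integral>\<^sup>+t\<in>{0..T}. ennreal ((norm (Z t \<omega>))\<^sup>2) \<partial>lborel)" .
    qed
    then show ?thesis using YZ_moment by simp
  qed
  then show ?thesis by (intro exI[of _ "enn2real ?E"]) auto
qed

lemma Y_L2: "t \<in> {0..T} \<Longrightarrow> L2 M (Y t)"
proof -
  assume t: "t \<in> {0..T}"
  obtain B where B: "0 \<le> B" "\<forall>t\<in>{0..T}. (\<integral>\<^sup>+\<omega>. ennreal ((norm (Y t \<omega>))\<^sup>2) \<partial>M) \<le> ennreal B"
    using Y_moment by blast
  then show ?thesis
    using F_borel_M[OF t Y_F[OF t]] le_less_trans[OF B(2)[rule_format, OF t]] by (subst L2_iff_nn_integral) auto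
qed

lemma slab_Y: "L2 (slab 0 T M) (\<lambda>(s, \<omega>). Y s \<omega>)"
proof -
  obtain B where B: "0 \<le> B" "\<forall>t\<in>{0..T}. (\<integral>\<^sup>+\<omega>. ennreal ((norm (Y t \<omega>))\<^sup>2) \<partial>M) \<le> ennreal B"
    using Y_moment by blast
  show ?thesis
    by (rule slab_fixed_time_bound(1)[OF _ slab_measurable(2) B(1)]) (use T_pos B(2) in auto)
qed

lemma slab_Z: "L2 (slab 0 T M) (\<lambda>(s, \<omega>). Z s \<omega>)"
proof -
  have m: "(\<lambda>q. ennreal ((norm ((\<lambda>(s, \<omega>). Z s \<omega>) q))\<^sup>2)) \<in> borel_measurable (slab 0 T M)"
    using slab_measurable(3) by measurable
  have "(\<integral>\<^sup>+q. ennreal ((norm ((\<lambda>(s, \<omega>). Z s \<omega>) q))\<^sup>2) \<partial>slab 0 T M)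
      = (\<integral>\<^sup>+\<omega>. (\<integral>\<^sup>+t\<in>{0..T}. ennreal ((norm (Z t \<omega>))\<^sup>2) \<partial>lborel) \<partial>M)"
    unfolding nn_integral_slab_Icc(1)[OF m, symmetric] by simp
  also have "\<dots> \<le> (\<integral>\<^sup>+\<omega>. (\<Squnion>t\<in>{0..T}. ennreal (\<bar>Y t \<omega>\<bar>\<^sup>2)) + (\<integral>\<^sup>+t\<in>{0..T}. ennreal ((norm (Z t \<omega>))\<^sup>2) \<partial>lborel) \<partial>M)"
    by (intro nn_integral_mono) simp
  also have "\<dots> < \<infinity>" by (rule YZ_moment)
  finally show ?thesis using slab_measurable(3) by (subst L2_iff_nn_integral) auto
qed

lemma slab_driver: "L2 (slab 0 T M) (\<lambda>(s, \<omega>). driver s \<omega>)"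
proof -
  have "L2 (slab 0 T M) (\<lambda>q. f (fst q) ((\<lambda>(s, \<omega>). \<X> s \<omega>) q) ((\<lambda>(s, \<omega>). Y s \<omega>) q) ((\<lambda>(s, \<omega>). Z s \<omega>) q))"
    by (rule f_L2[OF finite_measure_slab slab_fst _ slab_\<X> slab_Y slab_Z]) (auto simp: space_slab)
  then show ?thesis by (simp add: driver_def case_prod_unfold)
qed

text \<open>The equation on a subinterval, with the increment of the stochastic integral expressed through
  the two integrals up to the horizon.\<close>

lemma bsde_increment:
  assumes "0 \<le> a" "a \<le> b" "b \<le> T"
  shows "AE \<omega> in M. Y a \<omega> = Y b \<omega> + time_integral a b driver \<omega> - (ito_Z a \<omega> - ito_Z b \<omega>)"
proof -
  have "AE \<omega> in M. set_integrable lborel {0..T} (\<lambda>s. driver s \<omega>)"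
    by (rule time_integral_basic(2)[OF slab_driver])
  then show ?thesis
  proof eventually_elim
    case (elim \<omega>)
    have i: "set_integrable lborel {a..b} (\<lambda>s. driver s \<omega>)" "set_integrable lborel {b..T} (\<lambda>s. driver s \<omega>)"
      "set_integrable lborel {a..T} (\<lambda>s. driver s \<omega>)"
      using assms by (auto intro: set_integrable_subset[OF elim])
    have "time_integral a T driver \<omega> = (\<integral>s. indicator {a..b} s *\<^sub>R driver s \<omega> + indicator {b..T} s *\<^sub>R driver s \<omega> \<partial>lborel)"
      unfolding time_integral_def set_lebesgue_integral_def
    proof (rule integral_cong_AE)
      show "AE s in lborel. indicator {a..T} s *\<^sub>R driver s \<omega> = indicator {a..b} s *\<^sub>R driver s \<omega> + indicator {b..T} s *\<^sub>R driver s \<omega>"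
        using AE_lborel_singleton[of b]
        by eventually_elim (use assms in \<open>auto split: split_indicator\<close>)
      show "(\<lambda>s. indicator {a..T} s *\<^sub>R driver s \<omega>) \<in> borel_measurable lborel"
        using i(3) by (auto simp: set_integrable_def)
      show "(\<lambda>s. indicator {a..b} s *\<^sub>R driver s \<omega> + indicator {b..T} s *\<^sub>R driver s \<omega>) \<in> borel_measurable lborel"
        using i(1,2) by (auto simp: set_integrable_def intro!: borel_measurable_add)
    qed
    also have "\<dots> = time_integral a b driver \<omega> + time_integral b T driver \<omega>"
      using i unfolding time_integral_def set_lebesgue_integral_def set_integrable_def
      by (intro Bochner_Integration.integral_add)
    finally show ?case by (simp add: ito_Z_def)
  qed
qed

text \<open>The BSDE at time \<open>T\<close> leaves the It\^o integral over the single point \<open>T\<close>, whose second moment vanishes by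
  the isometry.\<close>

lemma terminal_value: "AE \<omega> in M. Y T \<omega> = g (\<X> T \<omega>)"
proof -
  have T0: "0 \<le> T" using T_pos by simp
  note I = ito_Z[OF T_in(1)]
  have "(\<integral>\<omega>. ito_Z T \<omega> * ito_Z T \<omega> \<partial>M) = 0"
    using ito_product[OF I T0 order_refl I T0 order_refl slab_Z] by (simp add: tail_def)
  moreover have "integrable M (\<lambda>\<omega>. ito_Z T \<omega> * ito_Z T \<omega>)"
    using has_ito_integral_pair[OF I T0 order_refl slab_Z] by (intro L2_mult_integrable) (auto dest: ito_pair_L2)
  ultimately have "AE \<omega> in M. ito_Z T \<omega> * ito_Z T \<omega> = 0"
    by (subst (asm) integral_nonneg_eq_0_iff_AE) auto
  then show ?thesis
  proof eventually_elim
    case (elim \<omega>)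
    have "AE s in lborel. indicator {T..T} s *\<^sub>R driver s \<omega> = 0"
      using AE_lborel_singleton[of T] by eventually_elim auto
    then have "time_integral T T driver \<omega> = 0"
      unfolding time_integral_def set_lebesgue_integral_def by (rule integral_eq_zero_AE)
    then show ?case using elim by (simp add: ito_Z_def)
  qed
qed

text \<open>At a fixed time the increment of \<open>Y\<close> is a stochastic integral, whose mean square is that of \<open>Z\<close> over
  the slab, minus a path integral of the driver. Because of the factor \<open>b - a\<close>, the sum of these bounds
  over a grid is of the order of the mesh.\<close>

lemma Y_regularity:
  assumes ab: "0 \<le> a" "a < b" "b \<le> T"
  shows "L2 (slab a b M) (\<lambda>(s, \<omega>). Y s \<omega> - Y a \<omega>)"
    and "msq (slab a b M) (\<lambda>(s, \<omega>). Y s \<omega> - Y a \<omega>)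
      \<le> (b - a) * (2 * (b - a) * msq (slab a b M) (\<lambda>(s, \<omega>). driver s \<omega>) + 2 * msq (slab a b M) (\<lambda>(s, \<omega>). Z s \<omega>))"
proof -
  let ?\<Phi> = "msq (slab a b M) (\<lambda>(s, \<omega>). driver s \<omega>)" and ?\<zeta> = "msq (slab a b M) (\<lambda>(s, \<omega>). Z s \<omega>)"
  let ?B = "2 * (b - a) * ?\<Phi> + 2 * ?\<zeta>"
  have a: "a \<in> {0..T}" using ab by auto
  have le: "msq M (\<lambda>\<omega>. Y s \<omega> - Y a \<omega>) \<le> ?B" if s: "s \<in> {a<..b}" for s
  proof -
    have s': "a < s" "s \<le> b" "0 \<le> a" "a \<le> s" "s \<le> T" "s \<in> {0..T}" using s ab by auto
    note Ia = ito_Z[OF a] and Is = ito_Z[OF s'(6)]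
    note d = ito_difference[OF Ia Is s'(3-5) slab_Z]
    note Ls = slab_L2_sub[OF s'(3,5) slab_driver]
    note TI = time_integral_L2[OF s'(1) Ls]
    have "msq M (\<lambda>\<omega>. Y s \<omega> - Y a \<omega>) = msq M (\<lambda>\<omega>. (ito_Z a \<omega> - ito_Z s \<omega>) - time_integral a s driver \<omega>)"
    proof (rule msq_cong_AE)
      show "(\<lambda>\<omega>. Y s \<omega> - Y a \<omega>) \<in> borel_measurable M"
        by (intro L2_measurable L2_diff Y_L2 a s')
      show "(\<lambda>\<omega>. (ito_Z a \<omega> - ito_Z s \<omega>) - time_integral a s driver \<omega>) \<in> borel_measurable M"
        by (intro L2_measurable L2_diff[OF d(1) TI(1)])
      show "AE \<omega> in M. Y s \<omega> - Y a \<omega> = (ito_Z a \<omega> - ito_Z s \<omega>) - time_integral a s driver \<omega>"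
        using bsde_increment[OF s'(3-5)] by eventually_elim simp
    qed
    also have "\<dots> \<le> 2 * msq M (\<lambda>\<omega>. ito_Z a \<omega> - ito_Z s \<omega>) + 2 * msq M (time_integral a s driver)"
      by (rule msq_diff_le[OF d(1) TI(1)])
    also have "\<dots> \<le> 2 * ?\<zeta> + 2 * ((b - a) * ?\<Phi>)"
    proof (intro add_mono mult_left_mono)
      show "msq M (\<lambda>\<omega>. ito_Z a \<omega> - ito_Z s \<omega>) \<le> ?\<zeta>"
        unfolding d(2) using slab_msq_mono[OF order_refl s'(2) slab_L2_sub[OF ab(1,3) slab_Z]] .
      have "msq M (time_integral a s driver) \<le> (s - a) * msq (slab a s M) (\<lambda>(s, \<omega>). driver s \<omega>)" by (rule TI(2))
      also have "\<dots> \<le> (b - a) * ?\<Phi>"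
        using slab_msq_mono[OF order_refl s'(2) slab_L2_sub[OF ab(1,3) slab_driver]] s'
        by (intro mult_mono) auto
      finally show "msq M (time_integral a s driver) \<le> (b - a) * ?\<Phi>" .
    qed simp_all
    finally show ?thesis by (simp add: algebra_simps)
  qed
  have m: "(\<lambda>(s, \<omega>). Y s \<omega> - Y a \<omega>) \<in> borel_measurable (slab a b M)"
  proof -
    have "(\<lambda>q. (\<lambda>(s, \<omega>). Y s \<omega>) q - Y a (snd q)) \<in> borel_measurable (slab a b M)"
      by (intro borel_measurable_diff measurable_compose[OF slab_snd L2_measurable[OF Y_L2[OF a]]]
          L2_measurable[OF slab_L2_sub[OF ab(1,3) slab_Y]])
    then show ?thesis by (simp add: case_prod_unfold)
  qed
  have B: "0 \<le> ?B" using ab by simp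
  have b: "(\<integral>\<^sup>+\<omega>. ennreal ((norm ((\<lambda>(s, \<omega>). Y s \<omega> - Y a \<omega>) (s, \<omega>)))\<^sup>2) \<partial>M) \<le> ennreal ?B" if "s \<in> {a<..b}" for s
  proof -
    have "L2 M (\<lambda>\<omega>. Y s \<omega> - Y a \<omega>)" using that ab a by (intro L2_diff Y_L2) auto
    from nn_integral_L2[OF this] show ?thesis using le[OF that] by (simp add: ennreal_leI)
  qed
  show "L2 (slab a b M) (\<lambda>(s, \<omega>). Y s \<omega> - Y a \<omega>)"
    by (rule slab_fixed_time_bound(1)[OF _ m B b]) (use ab in auto)
  show "msq (slab a b M) (\<lambda>(s, \<omega>). Y s \<omega> - Y a \<omega>) \<le> (b - a) * ?B"
    by (rule slab_fixed_time_bound(2)[OF _ m B b]) (use ab in auto)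
qed

end

section \<open>One step of the scheme\<close>

lemma sum4_sq_le: "(a + b + c + d :: real)\<^sup>2 \<le> 4 * (a\<^sup>2 + b\<^sup>2 + c\<^sup>2 + d\<^sup>2)"
proof -
  have "0 \<le> (a - b)\<^sup>2 + (a - c)\<^sup>2 + (a - d)\<^sup>2 + (b - c)\<^sup>2 + (b - d)\<^sup>2 + (c - d)\<^sup>2" by simp
  then show ?thesis by (simp add: power2_eq_square algebra_simps)
qed

text \<open>The arithmetic of the backward step. The weight \<open>e = \<gamma> h\<close> of Young's inequality is chosen as
  \<open>e = 32 L\<^sup>2 h\<close>; then \<open>(1 + 1 / e) * 4 * L\<^sup>2 * h = (1 + e) / 8\<close>, and the term \<open>4 * G\<close> that comes from the
  \<open>Z\<close>-component is absorbed by the gain \<open>- (1 + e) * G\<close>, with half of the gain left over.\<close>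

lemma backward_step_arith:
  fixes h e L dl Dq G P S R Fi ze ep MY MZ :: real
  assumes h: "0 < h" "h \<le> 1" and e: "e = 32 * L\<^sup>2 * h" "0 < e" "e \<le> 1"
    and nn: "0 \<le> dl" "0 \<le> G" "0 \<le> R" "0 \<le> Fi" "0 \<le> ze" "0 \<le> ep"
    and step: "dl \<le> (1 + e) * (Dq - G) + (1 + 1 / e) * P"
    and P: "P \<le> h * (4 * L\<^sup>2 * (h\<^sup>2 + h * R + MY + MZ))"
    and MY: "MY \<le> 2 * (h * (2 * h * Fi + 2 * ze)) + 2 * (h * dl)"
    and MZ: "MZ \<le> 2 * ep + 2 * (2 * G + 2 * (h * Fi))"
  shows "(1 - h / 2) * dl + G / 2 \<le> (1 + e) * Dq + (h\<^sup>2 + h * R + 2 * h * Fi + h * ze + ep)"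
proof -
  define S' where "S' = h\<^sup>2 + h * R + 4 * (h * (h * Fi)) + 4 * (h * ze) + 2 * (h * dl) + 2 * ep + 4 * (h * Fi)"
  have S'0: "0 \<le> S'" using h nn by (simp add: S'_def)
  have S: "h\<^sup>2 + h * R + MY + MZ \<le> S' + 4 * G"
    using MY MZ by (simp add: S'_def algebra_simps)
  have "(1 + 1 / e) * P \<le> (1 + 1 / e) * (h * (4 * L\<^sup>2 * (h\<^sup>2 + h * R + MY + MZ)))"
    using P e(2) by (intro mult_left_mono) auto
  also have "\<dots> = (1 + 1 / e) * (e / 8) * (h\<^sup>2 + h * R + MY + MZ)"
    using e(1) by simp
  also have "(1 + 1 / e) * (e / 8) = (1 + e) / 8"
    using e(2) by (simp add: field_simps)
  also have "(1 + e) / 8 * (h\<^sup>2 + h * R + MY + MZ) \<le> (1 + e) / 8 * (S' + 4 * G)"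
    using S e(2) by (intro mult_left_mono) auto
  also have "\<dots> = (1 + e) / 8 * S' + (1 + e) * G / 2" by (simp add: field_simps)
  also have "(1 + e) / 8 * S' \<le> 1 / 4 * S'" using e(3) S'0 by (intro mult_right_mono) auto
  finally have "dl \<le> (1 + e) * (Dq - G) + (1 / 4 * S' + (1 + e) * G / 2)" using step by linarith
  moreover have "(1 + e) * (Dq - G) = (1 + e) * Dq - (1 + e) * G" by (rule right_diff_distrib)
  ultimately have 1: "dl \<le> (1 + e) * Dq - (1 + e) * G / 2 + 1 / 4 * S'" by linarith
  have 2: "G / 2 \<le> (1 + e) * G / 2" using mult_right_mono[of 1 "1 + e" G] e(2) nn by simp
  have 3: "h * (h * Fi) \<le> h * Fi" using h nn by (simp add: mult_left_le_one_le)
  have 4: "0 \<le> h\<^sup>2" "0 \<le> h * R" "0 \<le> h * ze" using h nn by auto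
  have 5: "(1 - h / 2) * dl = dl - h * dl / 2" "2 * h * Fi = 2 * (h * Fi)" by (simp_all add: algebra_simps)
  have lin: "d - hd / 2 + g \<le> a + (hh + hR + 2 * hF + hz + p)"
    if "d \<le> a - b + 1 / 4 * (hh + hR + 4 * hhF + 4 * hz + 2 * hd + 2 * p + 4 * hF)"
      "g \<le> b" "hhF \<le> hF" "0 \<le> hh" "0 \<le> hR" "0 \<le> hz" "0 \<le> p"
    for d hd g a b hh hR hhF hF hz p :: real
    using that by (simp add: field_simps)
  show ?thesis unfolding 5 by (rule lin[OF 1[unfolded S'_def] 2 3 4 nn(6)])
qed

context bsde_space
begin

lemma driver_diff_msq:
  assumes s: "s \<in> {0..T}" and X: "L2 M X" and V: "L2 M V" and z: "L2 M z" and u: "L2 M u" and q: "L2 M q"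
  shows "msq M (\<lambda>\<omega>. f s (X \<omega>) (V \<omega>) (z \<omega>) - f s (X \<omega>) (u \<omega>) (q \<omega>))
    \<le> f_L\<^sup>2 * (2 * msq M (\<lambda>\<omega>. V \<omega> - u \<omega>) + 2 * msq M (\<lambda>\<omega>. z \<omega> - q \<omega>))"
proof -
  let ?B = "\<lambda>\<omega>. f_L * (norm (V \<omega> - u \<omega>) + norm (z \<omega> - q \<omega>))"
  note n = L2_norm[OF L2_diff[OF V u]] L2_norm[OF L2_diff[OF z q]]
  have B: "L2 M ?B" by (intro L2_mult_left L2_add n)
  have "msq M (\<lambda>\<omega>. f s (X \<omega>) (V \<omega>) (z \<omega>) - f s (X \<omega>) (u \<omega>) (q \<omega>)) \<le> msq M ?B"
  proof (rule msq_mono[OF B], rule AE_I2)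
    fix \<omega>
    show "norm (f s (X \<omega>) (V \<omega>) (z \<omega>) - f s (X \<omega>) (u \<omega>) (q \<omega>)) \<le> norm (?B \<omega>)"
      using f_lip[OF s s, of "X \<omega>" "V \<omega>" "z \<omega>" "X \<omega>" "u \<omega>" "q \<omega>"] by simp
  qed
  also have "\<dots> = f_L\<^sup>2 * msq M (\<lambda>\<omega>. norm (V \<omega> - u \<omega>) + norm (z \<omega> - q \<omega>))"
    using msq_scaleR[of M f_L "\<lambda>\<omega>. norm (V \<omega> - u \<omega>) + norm (z \<omega> - q \<omega>)"] by simp
  also have "\<dots> \<le> f_L\<^sup>2 * (2 * msq M (\<lambda>\<omega>. V \<omega> - u \<omega>) + 2 * msq M (\<lambda>\<omega>. z \<omega> - q \<omega>))"
    using msq_add_le[OF n] by (intro mult_left_mono) (auto simp: msq_def)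
  finally show ?thesis .
qed

lemma step_small:
  assumes "0 < h" "h \<le> 1" "32 * f_L\<^sup>2 * h \<le> 1"
  shows "f_L * h \<le> 1 / 4"
proof -
  have "(f_L * h)\<^sup>2 = f_L\<^sup>2 * h * h" by (simp add: power2_eq_square)
  also have "\<dots> \<le> 1 / 32 * 1" using assms by (intro mult_mono) auto
  also have "\<dots> \<le> (1 / 4)\<^sup>2" by (simp add: power2_eq_square)
  finally show ?thesis by (rule power2_le_imp_le) simp
qed

text \<open>For a short step the implicit equation \<open>u - f(s, X, u, q) h = A\<close> is a contraction in \<open>u\<close>.\<close>

lemma implicit_L2:
  assumes s: "s \<in> {0..T}" and h: "0 < h" "f_L * h \<le> 1 / 4"
    and u: "u \<in> borel_measurable M" and A: "L2 M A" and X: "L2 M X" and q: "L2 M q"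
    and eq: "AE \<omega> in M. u \<omega> - f s (X \<omega>) (u \<omega>) (q \<omega>) * h = A \<omega>"
  shows "L2 M u"
proof -
  let ?b = "\<lambda>\<omega>. norm (A \<omega>) + (\<bar>f s 0 0 0\<bar> + f_L * (norm (X \<omega>) + norm (q \<omega>))) * h"
  have b: "L2 M ?b"
    by (intro L2_add L2_mult_left L2_mult_right L2_norm A X q L2_const finite_measure_axioms)
  show ?thesis
  proof (rule L2_dominated[OF b u, where C = 2])
    show "AE \<omega> in M. norm (u \<omega>) \<le> 2 * norm (?b \<omega>)"
      using eq
    proof eventually_elim
      case (elim \<omega>)
      have "\<bar>f s (X \<omega>) (u \<omega>) (q \<omega>)\<bar> \<le> \<bar>f s 0 0 0\<bar> + f_L * (norm (X \<omega>) + norm (q \<omega>)) + f_L * \<bar>u \<omega>\<bar>"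
        using f_lip[OF s s, of "X \<omega>" "u \<omega>" "q \<omega>" 0 0 0] by (simp add: algebra_simps)
      then have "\<bar>f s (X \<omega>) (u \<omega>) (q \<omega>)\<bar> * h \<le> (\<bar>f s 0 0 0\<bar> + f_L * (norm (X \<omega>) + norm (q \<omega>)) + f_L * \<bar>u \<omega>\<bar>) * h"
        using h by (intro mult_right_mono) auto
      also have "\<dots> = (\<bar>f s 0 0 0\<bar> + f_L * (norm (X \<omega>) + norm (q \<omega>))) * h + (f_L * h) * \<bar>u \<omega>\<bar>"
        by (simp add: algebra_simps)
      also have "(f_L * h) * \<bar>u \<omega>\<bar> \<le> 1 / 4 * \<bar>u \<omega>\<bar>" using h by (intro mult_right_mono) auto
      finally have 1: "\<bar>f s (X \<omega>) (u \<omega>) (q \<omega>) * h\<bar> \<le> (\<bar>f s 0 0 0\<bar> + f_L * (norm (X \<omega>) + norm (q \<omega>))) * h + 1 / 4 * \<bar>u \<omega>\<bar>"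
        using h by (simp add: abs_mult)
      have 2: "norm (?b \<omega>) = ?b \<omega>" using h f_L_pos by simp
      have "norm (u \<omega>) \<le> norm (A \<omega>) + \<bar>f s (X \<omega>) (u \<omega>) (q \<omega>) * h\<bar>" using elim by simp
      then show ?case unfolding 2 using 1 by simp
    qed
  qed
qed

lemma loss_finite_L2:
  assumes st: "0 \<le> s" "s < t" "t \<le> T" and small: "f_L * (t - s) \<le> 1 / 4"
    and X: "X \<in> borel_measurable (F s)" "L2 M X" and U: "L2 M U"
    and u: "u \<in> borel_measurable (F s)" and q: "q \<in> borel_measurable (F s)"
    and fin: "(\<integral>\<^sup>+\<omega>. ennreal (\<bar>U \<omega> - F_gen f s (X \<omega>) (u \<omega>) (q \<omega>) (t - s) (W t \<omega> - W s \<omega>)\<bar>\<^sup>2) \<partial>M) < \<infinity>"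
  shows "L2 M u" "L2 M q"
proof -
  have s: "s \<in> {0..T}" "t \<in> {0..T}" using st by auto
  let ?A = "\<lambda>\<omega>. u \<omega> - f s (X \<omega>) (u \<omega>) (q \<omega>) * (t - s)"
  let ?Q = "\<lambda>\<omega>. ?A \<omega> + q \<omega> \<bullet> (W t \<omega> - W s \<omega>)"
  have A: "?A \<in> borel_measurable (F s)"
    by (intro borel_measurable_diff borel_measurable_times u f_measurable X(1) q borel_measurable_const) (rule s)
  note [measurable] = F_borel_M[OF s(1) A] F_borel_M[OF s(1) q] L2_measurable[OF U] W_M[OF s(1)] W_M[OF s(2)]
  have Qm: "?Q \<in> borel_measurable M" by measurable
  have "L2 M (\<lambda>\<omega>. U \<omega> - ?Q \<omega>)"
  proof (rule L2_iff_nn_integral[THEN iffD2])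
    show "(\<integral>\<^sup>+\<omega>. ennreal ((norm (U \<omega> - ?Q \<omega>))\<^sup>2) \<partial>M) < \<infinity>" using fin by (simp add: F_gen_def)
  qed (use Qm in measurable)
  note d = L2_diff[OF U this]
  have "U \<omega> - (U \<omega> - ?Q \<omega>) = ?Q \<omega>" for \<omega> by simp
  with d have QL: "L2 M ?Q" by (simp only:)
  show qL: "L2 M q" by (rule L2_past_increment(2)[OF st A q QL])
  have AL: "L2 M ?A" by (rule L2_past_increment(1)[OF st A q QL])
  show "L2 M u"
    by (rule implicit_L2[OF s(1) _ small F_borel_M[OF s(1) u] AL X(2) qL]) (use st in auto)
qed

text \<open>Minimality of the loss carries over, up to a constant, to the distance from the coefficients
  \<open>V\<close> and \<open>z\<close>: the residual of the projection cancels, and the driver contributes only terms of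
  relative order \<open>h\<close>.\<close>

lemma optimal_coefficients:
  assumes st: "0 \<le> s" "s < t" "t \<le> T" and small: "t - s \<le> 1" "32 * f_L\<^sup>2 * (t - s) \<le> 1"
    and X: "X \<in> borel_measurable (F s)" "L2 M X" and U: "L2 M U"
    and V: "V \<in> borel_measurable M" "L2 M V"
    and V_eq: "AE \<omega> in M. V \<omega> = real_cond_exp M (F s) U \<omega> + f s (X \<omega>) (V \<omega>) (z \<omega>) * (t - s)"
    and z_eq: "z = (\<lambda>\<omega>. (1 / (t - s)) *\<^sub>R vec_cond_exp M (F s) (\<lambda>\<omega>'. U \<omega>' *\<^sub>R (W t \<omega>' - W s \<omega>')) \<omega>)"
    and u: "u \<in> borel_measurable (F s)" "L2 M u" and q: "q \<in> borel_measurable (F s)" "L2 M q"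
    and u': "u' \<in> borel_measurable (F s)" "L2 M u'" and q': "q' \<in> borel_measurable (F s)" "L2 M q'"
    and opt: "(\<integral>\<^sup>+\<omega>. ennreal (\<bar>U \<omega> - F_gen f s (X \<omega>) (u \<omega>) (q \<omega>) (t - s) (W t \<omega> - W s \<omega>)\<bar>\<^sup>2) \<partial>M)
      \<le> (\<integral>\<^sup>+\<omega>. ennreal (\<bar>U \<omega> - F_gen f s (X \<omega>) (u' \<omega>) (q' \<omega>) (t - s) (W t \<omega> - W s \<omega>)\<bar>\<^sup>2) \<partial>M)"
  shows "msq M (\<lambda>\<omega>. V \<omega> - u \<omega>) + (t - s) * msq M (\<lambda>\<omega>. z \<omega> - q \<omega>)
    \<le> 8 * (msq M (\<lambda>\<omega>. V \<omega> - u' \<omega>) + (t - s) * msq M (\<lambda>\<omega>. z \<omega> - q' \<omega>))"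
proof -
  define h where "h = t - s"
  have h: "0 < h" "h \<le> 1" "32 * f_L\<^sup>2 * h \<le> 1" using st small by (auto simp: h_def)
  have s: "s \<in> {0..T}" using st by auto
  let ?a = "real_cond_exp M (F s) U"
  have zL: "L2 M z" unfolding z_eq by (rule increment_cond_exp(2)[OF st U])
  note aL = cond_exp_L2[OF s U]
  define A where "A = (\<lambda>u q \<omega>. u \<omega> - f s (X \<omega>) (u \<omega>) (q \<omega>) * h)"
  define res where "res = msq M (\<lambda>\<omega>. U \<omega> - (?a \<omega> + z \<omega> \<bullet> (W t \<omega> - W s \<omega>)))"
  have fL: "L2 M (\<lambda>\<omega>. f s (X \<omega>) (u \<omega>) (q \<omega>))" if "L2 M u" "L2 M q" for u q
    by (rule f_L2[OF finite_measure_axioms _ _ X(2) that]) (use s in auto)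
  have loss: "(\<integral>\<^sup>+\<omega>. ennreal (\<bar>U \<omega> - F_gen f s (X \<omega>) (u \<omega>) (q \<omega>) (t - s) (W t \<omega> - W s \<omega>)\<bar>\<^sup>2) \<partial>M)
      = ennreal (res + (msq M (\<lambda>\<omega>. ?a \<omega> - A u q \<omega>) + h * msq M (\<lambda>\<omega>. z \<omega> - q \<omega>)))"
    if u: "u \<in> borel_measurable (F s)" "L2 M u" and q: "q \<in> borel_measurable (F s)" "L2 M q" for u q
  proof -
    have Am: "A u q \<in> borel_measurable (F s)"
      unfolding A_def
      by (intro borel_measurable_diff borel_measurable_times u f_measurable X(1) q borel_measurable_const) (rule s)
    have AL: "L2 M (A u q)"
      unfolding A_def by (intro L2_diff L2_mult_right u fL q)
    have "L2 M (\<lambda>\<omega>. U \<omega> - (A u q \<omega> + q \<omega> \<bullet> (W t \<omega> - W s \<omega>)))"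
      by (intro L2_diff L2_add U AL L2_inner_increment(1) q) (use st in auto)
    from nn_integral_L2[OF this] show ?thesis
      unfolding loss_decomposition[OF st U Am AL q, folded z_eq]
      by (simp add: F_gen_def A_def h_def res_def z_eq)
  qed
  have cmp: "msq M (\<lambda>\<omega>. ?a \<omega> - A u q \<omega>) + h * msq M (\<lambda>\<omega>. z \<omega> - q \<omega>)
      \<le> msq M (\<lambda>\<omega>. ?a \<omega> - A u' q' \<omega>) + h * msq M (\<lambda>\<omega>. z \<omega> - q' \<omega>)"
  proof -
    have "0 \<le> res + (msq M (\<lambda>\<omega>. ?a \<omega> - A u' q' \<omega>) + h * msq M (\<lambda>\<omega>. z \<omega> - q' \<omega>))"
      using h by (simp add: res_def)
    then show ?thesis using opt unfolding loss[OF u q] loss[OF u' q'] by simp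
  qed
  have hf: "2 * (h\<^sup>2 * (f_L\<^sup>2 * (2 * P + 2 * Q))) \<le> P / 8 + h * Q / 8" if "0 \<le> P" "0 \<le> Q" for P Q
  proof -
    have "2 * (h\<^sup>2 * (f_L\<^sup>2 * (2 * P + 2 * Q))) = (32 * f_L\<^sup>2 * h) * (h * (P + Q) / 8)"
      by (simp add: power2_eq_square algebra_simps)
    also have "\<dots> \<le> 1 * (h * (P + Q) / 8)" using h that by (intro mult_right_mono) auto
    also have "\<dots> = h * P / 8 + h * Q / 8" by (simp add: algebra_simps)
    also have "\<dots> \<le> P / 8 + h * Q / 8" using h that by (simp add: mult_left_le_one_le)
    finally show ?thesis .
  qed
  have both: "msq M (\<lambda>\<omega>. ?a \<omega> - A u q \<omega>) \<le> 2 * msq M (\<lambda>\<omega>. V \<omega> - u \<omega>)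
        + (msq M (\<lambda>\<omega>. V \<omega> - u \<omega>) / 8 + h * msq M (\<lambda>\<omega>. z \<omega> - q \<omega>) / 8)"
      "msq M (\<lambda>\<omega>. V \<omega> - u \<omega>) \<le> 2 * msq M (\<lambda>\<omega>. ?a \<omega> - A u q \<omega>)
        + (msq M (\<lambda>\<omega>. V \<omega> - u \<omega>) / 8 + h * msq M (\<lambda>\<omega>. z \<omega> - q \<omega>) / 8)"
    if u: "L2 M u" and q: "L2 M q" for u q
  proof -
    let ?d = "\<lambda>\<omega>. h *\<^sub>R (f s (X \<omega>) (V \<omega>) (z \<omega>) - f s (X \<omega>) (u \<omega>) (q \<omega>))"
    have dL: "L2 M ?d" by (intro L2_scaleR L2_diff fL V zL u q)
    have VuL: "L2 M (\<lambda>\<omega>. V \<omega> - u \<omega>)" by (rule L2_diff[OF V(2) u])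
    have aAL: "L2 M (\<lambda>\<omega>. ?a \<omega> - A u q \<omega>)"
      unfolding A_def by (intro L2_diff L2_mult_right aL u fL q)
    have "2 * msq M ?d \<le> 2 * (h\<^sup>2 * (f_L\<^sup>2 * (2 * msq M (\<lambda>\<omega>. V \<omega> - u \<omega>) + 2 * msq M (\<lambda>\<omega>. z \<omega> - q \<omega>))))"
      unfolding msq_scaleR using driver_diff_msq[OF s X(2) V(2) zL u q] by (intro mult_left_mono) auto
    also have "\<dots> \<le> msq M (\<lambda>\<omega>. V \<omega> - u \<omega>) / 8 + h * msq M (\<lambda>\<omega>. z \<omega> - q \<omega>) / 8" by (rule hf) simp_all
    finally have d: "2 * msq M ?d \<le> msq M (\<lambda>\<omega>. V \<omega> - u \<omega>) / 8 + h * msq M (\<lambda>\<omega>. z \<omega> - q \<omega>) / 8" .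
    have e: "AE \<omega> in M. ?a \<omega> - A u q \<omega> = (V \<omega> - u \<omega>) - ?d \<omega>"
      using V_eq by eventually_elim (simp add: A_def h_def algebra_simps)
    have "msq M (\<lambda>\<omega>. ?a \<omega> - A u q \<omega>) = msq M (\<lambda>\<omega>. (V \<omega> - u \<omega>) - ?d \<omega>)"
      by (rule msq_cong_AE[OF L2_measurable[OF aAL] L2_measurable[OF L2_diff[OF VuL dL]] e])
    also have "\<dots> \<le> 2 * msq M (\<lambda>\<omega>. V \<omega> - u \<omega>) + 2 * msq M ?d" by (rule msq_diff_le[OF VuL dL])
    finally show "msq M (\<lambda>\<omega>. ?a \<omega> - A u q \<omega>) \<le> 2 * msq M (\<lambda>\<omega>. V \<omega> - u \<omega>)
        + (msq M (\<lambda>\<omega>. V \<omega> - u \<omega>) / 8 + h * msq M (\<lambda>\<omega>. z \<omega> - q \<omega>) / 8)" using d by linarith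
    have "msq M (\<lambda>\<omega>. V \<omega> - u \<omega>) = msq M (\<lambda>\<omega>. (?a \<omega> - A u q \<omega>) + ?d \<omega>)"
      by (rule msq_cong_AE[OF L2_measurable[OF VuL] L2_measurable[OF L2_add[OF aAL dL]]])
         (use e in eventually_elim, simp)
    also have "\<dots> \<le> 2 * msq M (\<lambda>\<omega>. ?a \<omega> - A u q \<omega>) + 2 * msq M ?d" by (rule msq_add_le[OF aAL dL])
    finally show "msq M (\<lambda>\<omega>. V \<omega> - u \<omega>) \<le> 2 * msq M (\<lambda>\<omega>. ?a \<omega> - A u q \<omega>)
        + (msq M (\<lambda>\<omega>. V \<omega> - u \<omega>) / 8 + h * msq M (\<lambda>\<omega>. z \<omega> - q \<omega>) / 8)" using d by linarith
  qed
  have "0 \<le> h * msq M (\<lambda>\<omega>. z \<omega> - q \<omega>)" "0 \<le> h * msq M (\<lambda>\<omega>. z \<omega> - q' \<omega>)" using h by auto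
  then show ?thesis
    using cmp both(2)[OF u(2) q(2)] both(1)[OF u'(2) q'(2)]
      msq_nonneg[of M "\<lambda>\<omega>. V \<omega> - u' \<omega>"] msq_nonneg[of M "\<lambda>\<omega>. V \<omega> - u \<omega>"]
    unfolding h_def[symmetric] by argo
qed

lemma time_integral_diff_const:
  fixes H :: "real \<Rightarrow> 'a \<Rightarrow> real"
  assumes ab: "a \<le> b" and i: "set_integrable lborel {a..b} (\<lambda>s. H s \<omega>)"
  shows "time_integral a b (\<lambda>s \<omega>. H s \<omega> - c \<omega>) \<omega> = time_integral a b H \<omega> - c \<omega> * (b - a)"
proof -
  have c: "set_integrable lborel {a..b} (\<lambda>s. c \<omega>)"
    using ab by (simp add: set_integrable_def)
  have "(LINT s:{a..b}|lborel. c \<omega>) = c \<omega> * (b - a)"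
    using ab by (simp add: set_lebesgue_integral_def mult.commute)
  then show ?thesis unfolding time_integral_def using set_integral_diff(2)[OF i c] by simp
qed

text \<open>\<open>Zb\<close> is the coefficient of \<open>\<Delta>W\<close> in the projection of the stochastic integral of \<open>Z\<close>, just as \<open>z\<close> is the one
  in the projection of \<open>U\<close>.\<close>

lemma Z_mean:
  assumes st: "0 \<le> s" "s < t" "t \<le> T"
  defines "Zb \<equiv> \<lambda>\<omega>. (1 / (t - s)) *\<^sub>R vec_cond_exp M (F s) (time_integral s t Z) \<omega>"
  shows "Zb \<in> borel_measurable (F s)" "L2 M Zb"
    and "\<And>\<zeta>. \<zeta> \<in> borel_measurable (F s) \<Longrightarrow> L2 M \<zeta> \<Longrightarrow>
      (\<integral>\<omega>. (ito_Z s \<omega> - ito_Z t \<omega>) * (\<zeta> \<omega> \<bullet> (W t \<omega> - W s \<omega>)) \<partial>M) = (t - s) * (\<integral>\<omega>. Zb \<omega> \<bullet> \<zeta> \<omega> \<partial>M)"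
    and "L2 (slab s t M) (\<lambda>(u, \<omega>). Z u \<omega> - Zb \<omega>)"
proof -
  have s: "s \<in> {0..T}" "t \<in> {0..T}" and le: "s \<le> t" using st by auto
  have ZL: "L2 (slab s t M) (\<lambda>(u, \<omega>). Z u \<omega>)" by (rule slab_L2_sub[OF st(1,3) slab_Z])
  note TI = time_integral_L2(1)[OF st(2) ZL]
  note v = L2_vec_cond_exp[OF s(1) TI]
  show m: "Zb \<in> borel_measurable (F s)"
    unfolding Zb_def using vec_cond_exp_F[of s "time_integral s t Z"] by measurable
  show ZbL: "L2 M Zb" unfolding Zb_def using v(1) by (rule L2_scaleR)
  show "(\<integral>\<omega>. (ito_Z s \<omega> - ito_Z t \<omega>) * (\<zeta> \<omega> \<bullet> (W t \<omega> - W s \<omega>)) \<partial>M) = (t - s) * (\<integral>\<omega>. Zb \<omega> \<bullet> \<zeta> \<omega> \<partial>M)"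
    if \<zeta>: "\<zeta> \<in> borel_measurable (F s)" "L2 M \<zeta>" for \<zeta>
  proof -
    have "(\<integral>\<omega>. (ito_Z s \<omega> - ito_Z t \<omega>) * (\<zeta> \<omega> \<bullet> (W t \<omega> - W s \<omega>)) \<partial>M)
        = (\<integral>q. \<zeta> (snd q) \<bullet> Z (fst q) (snd q) \<partial>slab s t M)"
      by (rule ito_difference(4)[OF ito_Z[OF s(1)] ito_Z[OF s(2)] st(1) le st(3) slab_Z \<zeta>])
    also have "\<dots> = (\<integral>\<omega>. \<zeta> \<omega> \<bullet> time_integral s t Z \<omega> \<partial>M)"
      by (rule time_integral_basic(4)[OF ZL \<zeta>(2), symmetric])
    also have "\<dots> = (\<integral>\<omega>. vec_cond_exp M (F s) (time_integral s t Z) \<omega> \<bullet> \<zeta> \<omega> \<partial>M)"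
      by (rule v(2)[OF \<zeta>, symmetric])
    also have "\<dots> = (t - s) * (\<integral>\<omega>. Zb \<omega> \<bullet> \<zeta> \<omega> \<partial>M)" using st by (simp add: Zb_def)
    finally show ?thesis .
  qed
  show "L2 (slab s t M) (\<lambda>(u, \<omega>). Z u \<omega> - Zb \<omega>)"
    using L2_diff[OF ZL slab_L2_const(1)[OF le ZbL]] by (simp add: case_prod_unfold)
qed

text \<open>The backward step for the solution itself. The first estimate keeps half of
  \<open>G = E\<bar>D - E\<^sub>s D\<bar>\<^sup>2\<close> on the left; summed over the grid, it therefore also controls the
  right-hand side of the second.\<close>

lemma bsde_step:
  fixes X :: "'a \<Rightarrow> real ^ 'd" and U V :: "'a \<Rightarrow> real" and R :: real
  assumes st: "0 \<le> s" "s < t" "t \<le> T" and small: "t - s \<le> 1" "32 * f_L\<^sup>2 * (t - s) \<le> 1"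
    and X: "L2 M X" and R: "0 \<le> R" "\<And>u. u \<in> {s<..t} \<Longrightarrow> (\<integral>\<^sup>+\<omega>. ennreal ((norm (\<X> u \<omega> - X \<omega>))\<^sup>2) \<partial>M) \<le> ennreal R"
    and U: "L2 M U" and V: "V \<in> borel_measurable (F s)" "L2 M V"
    and z_eq: "z = (\<lambda>\<omega>. (1 / (t - s)) *\<^sub>R vec_cond_exp M (F s) (\<lambda>\<omega>'. U \<omega>' *\<^sub>R (W t \<omega>' - W s \<omega>')) \<omega>)"
    and V_eq: "AE \<omega> in M. V \<omega> = real_cond_exp M (F s) U \<omega> + f s (X \<omega>) (V \<omega>) (z \<omega>) * (t - s)"
  defines "h \<equiv> t - s"
    and "D \<equiv> \<lambda>\<omega>. Y t \<omega> - U \<omega>"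
    and "Zb \<equiv> \<lambda>\<omega>. (1 / (t - s)) *\<^sub>R vec_cond_exp M (F s) (time_integral s t Z) \<omega>"
    and "Fi \<equiv> msq (slab s t M) (\<lambda>(u, \<omega>). driver u \<omega>)"
    and "ze \<equiv> msq (slab s t M) (\<lambda>(u, \<omega>). Z u \<omega>)"
  defines "G \<equiv> msq M (\<lambda>\<omega>. D \<omega> - real_cond_exp M (F s) D \<omega>)"
    and "ep \<equiv> msq (slab s t M) (\<lambda>(u, \<omega>). Z u \<omega> - Zb \<omega>)"
  shows "(1 - h / 2) * msq M (\<lambda>\<omega>. Y s \<omega> - V \<omega>) + G / 2
      \<le> (1 + 32 * f_L\<^sup>2 * h) * msq M D + (h\<^sup>2 + h * R + 2 * h * Fi + h * ze + ep)"
    and "L2 (slab s t M) (\<lambda>(u, \<omega>). Z u \<omega> - z \<omega>)"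
    and "msq (slab s t M) (\<lambda>(u, \<omega>). Z u \<omega> - z \<omega>) \<le> 2 * ep + 2 * (2 * G + 2 * (h * Fi))"
proof -
  have s: "s \<in> {0..T}" "t \<in> {0..T}" and le: "s \<le> t" and h: "0 < h" "h \<le> 1" using st small by (auto simp: h_def)
  have zL: "L2 M z" unfolding z_eq by (rule increment_cond_exp(2)[OF st U])
  note Ys = Y_F[OF s(1)] Y_L2[OF s(1)]
  note ZL = slab_L2_sub[OF st(1,3) slab_Z] and fL = slab_L2_sub[OF st(1,3) slab_driver]
    and XL = slab_L2_sub[OF st(1,3) slab_\<X>]
  note \<Phi> = time_integral_L2[OF st(2) fL]
  note inc = ito_difference[OF ito_Z[OF s(1)] ito_Z[OF s(2)] st(1) le st(3) slab_Z]
  note eq = bsde_increment[OF st(1) le st(3)]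
  note Zm = Z_mean[OF st, folded Zb_def]
  have ZbL: "L2 M Zb" and epL: "L2 (slab s t M) (\<lambda>(u, \<omega>). Z u \<omega> - Zb \<omega>)"
    using Zm(2,4) by (simp_all add: Zb_def)
  have ZzL: "L2 (slab s t M) (\<lambda>(u, \<omega>). Z u \<omega> - z \<omega>)"
    using L2_diff[OF ZL slab_L2_const(1)[OF le zL]] by (simp add: case_prod_unfold)
  then show "L2 (slab s t M) (\<lambda>(u, \<omega>). Z u \<omega> - z \<omega>)" .
  have hZ: "h * msq M (\<lambda>\<omega>. Zb \<omega> - z \<omega>) \<le> 2 * G + 2 * (h * Fi)"
  proof -
    have "h * msq M (\<lambda>\<omega>. Zb \<omega> - z \<omega>) \<le> 2 * G + 2 * msq M (time_integral s t driver)"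
      unfolding h_def G_def D_def Zb_def z_eq
      by (rule backward_step_Z[OF st Ys Y_L2[OF s(2)] U \<Phi>(1) inc(1) eq Z_mean(1,2)[OF st]])
         (rule Z_mean(3)[OF st])
    also have "\<dots> \<le> 2 * G + 2 * (h * Fi)" using \<Phi>(2) by (simp add: h_def Fi_def)
    finally show ?thesis .
  qed
  show MZ: "msq (slab s t M) (\<lambda>(u, \<omega>). Z u \<omega> - z \<omega>) \<le> 2 * ep + 2 * (2 * G + 2 * (h * Fi))"
  proof -
    have c: "L2 M (\<lambda>\<omega>. Zb \<omega> - z \<omega>)" by (rule L2_diff[OF ZbL zL])
    note sc = slab_L2_const[OF le c]
    have "msq (slab s t M) (\<lambda>(u, \<omega>). Z u \<omega> - z \<omega>)
        = msq (slab s t M) (\<lambda>q. (\<lambda>(u, \<omega>). Z u \<omega> - Zb \<omega>) q + (Zb (snd q) - z (snd q)))"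
      by (simp add: case_prod_unfold)
    also have "\<dots> \<le> 2 * ep + 2 * (h * msq M (\<lambda>\<omega>. Zb \<omega> - z \<omega>))"
      using msq_add_le[OF epL sc(1)] unfolding sc(2) by (simp add: ep_def h_def)
    also have "\<dots> \<le> 2 * ep + 2 * (2 * G + 2 * (h * Fi))" using hZ by (intro add_left_mono mult_left_mono) simp_all
    finally show ?thesis .
  qed
  define k where "k = (\<lambda>\<omega>. f s (X \<omega>) (V \<omega>) (z \<omega>))"
  have kL: "L2 M k"
    unfolding k_def by (rule f_L2[OF finite_measure_axioms _ _ X V(2) zL]) (use s in auto)
  let ?H = "\<lambda>(u, \<omega>). driver u \<omega> - k \<omega>"
  have HL: "L2 (slab s t M) ?H"
    using L2_diff[OF fL slab_L2_const(1)[OF le kL]] by (simp add: case_prod_unfold)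
  note TH = time_integral_L2[OF st(2) HL]
  let ?dl = "msq M (\<lambda>\<omega>. Y s \<omega> - V \<omega>)"
  let ?P = "msq M (\<lambda>\<omega>. time_integral s t driver \<omega> - k \<omega> * h)"
  let ?MY = "msq (slab s t M) (\<lambda>(u, \<omega>). Y u \<omega> - V \<omega>)" and ?MZ = "msq (slab s t M) (\<lambda>(u, \<omega>). Z u \<omega> - z \<omega>)"
  have e0: "0 < 32 * f_L\<^sup>2 * h" using f_L_pos h by simp
  have step: "?dl \<le> (1 + 32 * f_L\<^sup>2 * h) * (msq M D - G) + (1 + 1 / (32 * f_L\<^sup>2 * h)) * ?P"
    unfolding D_def G_def
    by (rule backward_step_Y[OF st Ys Y_L2[OF s(2)] U \<Phi>(1) inc(1) inc(3) eq V L2_mult_right[OF kL] _ e0])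
       (use V_eq in \<open>auto simp: k_def h_def\<close>)
  have YVL: "L2 (slab s t M) (\<lambda>(u, \<omega>). Y u \<omega> - V \<omega>)"
    using L2_diff[OF slab_L2_sub[OF st(1,3) slab_Y] slab_L2_const(1)[OF le V(2)]] by (simp add: case_prod_unfold)
  have XXm: "(\<lambda>(u, \<omega>). \<X> u \<omega> - X \<omega>) \<in> borel_measurable (slab s t M)"
    using L2_measurable[OF L2_diff[OF XL slab_L2_const(1)[OF le X]]] by (simp add: case_prod_unfold)
  note XX = slab_fixed_time_bound[OF le XXm R(1), simplified, OF R(2), simplified]
  have MY: "?MY \<le> 2 * (h * (2 * h * Fi + 2 * ze)) + 2 * (h * ?dl)"
  proof -
    have c: "L2 M (\<lambda>\<omega>. Y s \<omega> - V \<omega>)" by (rule L2_diff[OF Ys(2) V(2)])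
    note sc = slab_L2_const[OF le c] and yr = Y_regularity[OF st]
    have "?MY = msq (slab s t M) (\<lambda>q. (\<lambda>(u, \<omega>). Y u \<omega> - Y s \<omega>) q + (Y s (snd q) - V (snd q)))"
      by (simp add: case_prod_unfold)
    also have "\<dots> \<le> 2 * msq (slab s t M) (\<lambda>(u, \<omega>). Y u \<omega> - Y s \<omega>) + 2 * (h * ?dl)"
      using msq_add_le[OF yr(1) sc(1)] unfolding sc(2) by (simp add: h_def)
    also have "\<dots> \<le> 2 * (h * (2 * h * Fi + 2 * ze)) + 2 * (h * ?dl)"
      using yr(2) by (simp add: h_def Fi_def ze_def)
    finally show ?thesis .
  qed
  have P: "?P \<le> h * (4 * f_L\<^sup>2 * (h\<^sup>2 + h * R + ?MY + ?MZ))"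
  proof -
    have "?P = msq M (time_integral s t (\<lambda>u \<omega>. driver u \<omega> - k \<omega>))"
    proof (rule msq_cong_AE)
      show "(\<lambda>\<omega>. time_integral s t driver \<omega> - k \<omega> * h) \<in> borel_measurable M"
        by (intro L2_measurable L2_diff \<Phi>(1) L2_mult_right kL)
      show "AE \<omega> in M. time_integral s t driver \<omega> - k \<omega> * h = time_integral s t (\<lambda>u \<omega>. driver u \<omega> - k \<omega>) \<omega>"
        using time_integral_basic(2)[OF fL]
        by eventually_elim (simp add: time_integral_diff_const[OF le] h_def)
    qed (rule L2_measurable[OF TH(1)])
    also have "\<dots> \<le> h * msq (slab s t M) ?H" using TH(2) by (simp add: h_def)
    also have "msq (slab s t M) ?H \<le> 4 * f_L\<^sup>2 * (h\<^sup>2 + h * R + ?MY + ?MZ)"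
    proof -
      let ?S = "slab s t M"
      have ih: "integrable ?S (\<lambda>q. h)" using finite_measure.integrable_const[OF finite_measure_slab] .
      have ih2: "(\<integral>q. h \<partial>?S) = h\<^sup>2"
        using slab_integral_const(2)[OF le, of "\<lambda>_. h"] by (simp add: h_def prob_space power2_eq_square)
      note ints = ih L2_sq_integrable[OF XX(1)] L2_sq_integrable[OF YVL] L2_sq_integrable[OF ZzL]
      have "msq ?S ?H \<le> (\<integral>q. 4 * f_L\<^sup>2 * (h + (norm ((\<lambda>(u, \<omega>). \<X> u \<omega> - X \<omega>) q))\<^sup>2
          + (norm ((\<lambda>(u, \<omega>). Y u \<omega> - V \<omega>) q))\<^sup>2 + (norm ((\<lambda>(u, \<omega>). Z u \<omega> - z \<omega>) q))\<^sup>2) \<partial>?S)"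
        unfolding msq_def
      proof (rule integral_mono[OF L2_sq_integrable[OF HL]])
        show "integrable ?S (\<lambda>q. 4 * f_L\<^sup>2 * (h + (norm ((\<lambda>(u, \<omega>). \<X> u \<omega> - X \<omega>) q))\<^sup>2
          + (norm ((\<lambda>(u, \<omega>). Y u \<omega> - V \<omega>) q))\<^sup>2 + (norm ((\<lambda>(u, \<omega>). Z u \<omega> - z \<omega>) q))\<^sup>2))"
          by (intro integrable_mult_right Bochner_Integration.integrable_add ints)
        fix q assume "q \<in> space ?S"
        then obtain u \<omega> where q: "q = (u, \<omega>)" "s < u" "u \<le> t" by (auto simp: space_slab)
        let ?b = "sqrt \<bar>u - s\<bar> + norm (\<X> u \<omega> - X \<omega>) + \<bar>Y u \<omega> - V \<omega>\<bar> + norm (Z u \<omega> - z \<omega>)"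
        have "u \<in> {0..T}" using q st by auto
        then have "\<bar>driver u \<omega> - k \<omega>\<bar> \<le> f_L * ?b"
          unfolding driver_def k_def by (rule f_lip[OF s(1)])
        then have "\<bar>driver u \<omega> - k \<omega>\<bar>\<^sup>2 \<le> (f_L * ?b)\<^sup>2" by (intro power_mono) auto
        also have "\<dots> = f_L\<^sup>2 * ?b\<^sup>2" by (rule power_mult_distrib)
        also have "\<dots> \<le> f_L\<^sup>2 * (4 * ((sqrt \<bar>u - s\<bar>)\<^sup>2 + (norm (\<X> u \<omega> - X \<omega>))\<^sup>2 + \<bar>Y u \<omega> - V \<omega>\<bar>\<^sup>2 + (norm (Z u \<omega> - z \<omega>))\<^sup>2))"
          by (intro mult_left_mono sum4_sq_le) simp
        also have "\<dots> \<le> f_L\<^sup>2 * (4 * (h + (norm (\<X> u \<omega> - X \<omega>))\<^sup>2 + \<bar>Y u \<omega> - V \<omega>\<bar>\<^sup>2 + (norm (Z u \<omega> - z \<omega>))\<^sup>2))"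
          using q by (intro mult_left_mono add_right_mono) (auto simp: h_def)
        finally show "(norm (?H q))\<^sup>2 \<le> 4 * f_L\<^sup>2 * (h + (norm ((\<lambda>(u, \<omega>). \<X> u \<omega> - X \<omega>) q))\<^sup>2
          + (norm ((\<lambda>(u, \<omega>). Y u \<omega> - V \<omega>) q))\<^sup>2 + (norm ((\<lambda>(u, \<omega>). Z u \<omega> - z \<omega>) q))\<^sup>2)"
          by (simp add: q algebra_simps)
      qed
      also have "\<dots> = 4 * f_L\<^sup>2 * (h\<^sup>2 + msq ?S (\<lambda>(u, \<omega>). \<X> u \<omega> - X \<omega>) + ?MY + ?MZ)"
        by (simp only: integral_mult_right_zero Bochner_Integration.integral_add Bochner_Integration.integrable_add ints ih2 msq_def)
      also have "\<dots> \<le> 4 * f_L\<^sup>2 * (h\<^sup>2 + h * R + ?MY + ?MZ)"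
        using XX(2) by (intro mult_left_mono add_right_mono add_left_mono) (auto simp: h_def)
      finally show ?thesis .
    qed
    finally show ?thesis using h by simp
  qed
  show "(1 - h / 2) * ?dl + G / 2 \<le> (1 + 32 * f_L\<^sup>2 * h) * msq M D + (h\<^sup>2 + h * R + 2 * h * Fi + h * ze + ep)"
    by (rule backward_step_arith[OF h refl e0 small(2)[folded h_def] _ _ R(1) _ _ _ step P MY MZ])
       (simp_all add: G_def Fi_def ze_def ep_def)
qed

end

section \<open>A backward Gronwall inequality\<close>

text \<open>The quantities \<open>e i\<close> are the errors of the scheme, \<open>a i\<close> those before the network approximation, and \<open>r i\<close> the
  errors of the latter. The growth factor of a step is at most \<open>exp (1 / N + (1 + \<gamma>) h)\<close>, and these exponents add up to
  at most \<open>1 + (1 + \<gamma>) T\<close>. Carrying the sum of the \<open>G j\<close> along in the induction bounds it by the same quantity.\<close>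

lemma backward_gronwall:
  fixes e G a b r h :: "nat \<Rightarrow> real" and \<gamma> T :: real and N :: nat
  assumes N: "0 < N" and \<gamma>: "0 \<le> \<gamma>" and h: "\<And>i. i < N \<Longrightarrow> 0 \<le> h i \<and> h i \<le> 1" and hT: "(\<Sum>i<N. h i) \<le> T"
    and nn: "\<And>i. i \<le> N \<Longrightarrow> 0 \<le> e i" "\<And>i. 0 \<le> G i" "\<And>i. 0 \<le> a i" "\<And>i. i < N \<Longrightarrow> 0 \<le> b i" "\<And>i. 0 \<le> r i"
    and step: "\<And>i. i < N \<Longrightarrow> (1 - h i / 2) * a i + G i / 2 \<le> (1 + \<gamma> * h i) * e (Suc i) + b i"
    and young: "\<And>i. i < N \<Longrightarrow> e i \<le> (1 + 1 / N) * a i + (1 + N) * r i"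
  defines "A \<equiv> exp (1 + (1 + \<gamma>) * T)" and "S \<equiv> e N + 4 * (\<Sum>i<N. b i) + 2 * (\<Sum>i<N. N * r i)"
  shows "\<And>i. i \<le> N \<Longrightarrow> e i \<le> A * S" and "(\<Sum>i<N. G i) \<le> 2 * (A * S)"
proof -
  define x where "x = (\<lambda>i. 1 / real N + (1 + \<gamma>) * h i)"
  define c where "c = (\<lambda>i. 4 * b i + 2 * (N * r i))"
  have x0: "0 \<le> x i" and c0: "0 \<le> c i" if "i < N" for i
    using h[OF that] \<gamma> nn(4)[OF that] nn(5)[of i] by (auto simp: x_def c_def)
  have one: "e i + G i / 2 \<le> exp (x i) * e (Suc i) + c i" if i: "i < N" for i
  proof -
    have hi: "0 \<le> h i" "h i \<le> 1" using h[OF i] by auto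
    have E0: "0 \<le> e (Suc i)" using nn(1)[of "Suc i"] i by simp
    have n1: "0 \<le> 1 / real N" "1 / real N \<le> 1" using N by auto
    define R where "R = (1 + \<gamma> * h i) * e (Suc i) + b i"
    have R0: "0 \<le> R" using E0 \<gamma> hi nn(4)[OF i] by (simp add: R_def)
    have f: "1 \<le> (1 + h i) * (1 - h i / 2)"
    proof -
      have "h i * h i \<le> h i * 1" using hi by (intro mult_left_mono) auto
      then show ?thesis by (simp add: algebra_simps)
    qed
    have "a i + G i / 2 \<le> (1 + h i) * ((1 - h i / 2) * a i) + (1 + h i) * (G i / 2)"
    proof (rule add_mono)
      show "a i \<le> (1 + h i) * ((1 - h i / 2) * a i)"
        using mult_right_mono[OF f nn(3)[of i]] by (simp add: mult.assoc)
      show "G i / 2 \<le> (1 + h i) * (G i / 2)"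
        using mult_right_mono[of 1 "1 + h i" "G i / 2"] hi nn(2)[of i] by simp
    qed
    also have "\<dots> = (1 + h i) * ((1 - h i / 2) * a i + G i / 2)" by (rule distrib_left[symmetric])
    also have "\<dots> \<le> (1 + h i) * R" using step[OF i] hi by (intro mult_left_mono) (auto simp: R_def)
    finally have aG: "a i + G i / 2 \<le> (1 + h i) * R" .
    have "1 * (G i / 2) \<le> (1 + 1 / N) * (G i / 2)" using n1 nn(2)[of i] by (intro mult_right_mono) auto
    from add_mono[OF young[OF i] this]
    have "e i + G i / 2 \<le> (1 + 1 / N) * a i + (1 + 1 / N) * (G i / 2) + (1 + N) * r i"
      by (simp only: mult_1 add_ac)
    also have "\<dots> = (1 + 1 / N) * (a i + G i / 2) + (1 + N) * r i" by (simp add: distrib_left)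
    also have "\<dots> \<le> (1 + 1 / N) * ((1 + h i) * R) + 2 * N * r i"
      using aG n1 N nn(5)[of i] by (intro add_mono mult_left_mono mult_right_mono) auto
    also have "(1 + 1 / N) * ((1 + h i) * R)
        = ((1 + 1 / N) * (1 + h i) * (1 + \<gamma> * h i)) * e (Suc i) + ((1 + 1 / N) * (1 + h i)) * b i"
    proof -
      have "p * (q * (w * E + y)) = p * q * w * E + p * q * y" for p q w E y :: real
        by (simp add: algebra_simps)
      then show ?thesis by (simp only: R_def)
    qed
    also have "((1 + 1 / N) * (1 + h i)) * b i \<le> 4 * b i"
    proof (rule mult_right_mono[OF _ nn(4)[OF i]])
      have "(1 + 1 / N) * (1 + h i) \<le> 2 * 2" using n1 hi by (intro mult_mono) auto
      then show "(1 + 1 / N) * (1 + h i) \<le> 4" by simp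
    qed
    also have "(1 + 1 / N) * (1 + h i) * (1 + \<gamma> * h i) \<le> exp (1 / N) * exp (h i) * exp (\<gamma> * h i)"
      using n1 hi \<gamma> by (intro mult_mono exp_ge_add_one_self mult_nonneg_nonneg) auto
    also have "exp (1 / N) * exp (h i) * exp (\<gamma> * h i) = exp (x i)"
      by (simp add: x_def distrib_right flip: exp_add)
    finally show ?thesis using E0 by (simp add: c_def mult_right_mono)
  qed
  have main: "e i + (\<Sum>j\<in>{i..<N}. G j / 2) \<le> exp (\<Sum>j\<in>{i..<N}. x j) * (e N + (\<Sum>j\<in>{i..<N}. c j))" if "i \<le> N" for i
    using that
  proof (induction i rule: inc_induct)
    case base
    then show ?case by simp
  next
    case (step i)
    then have i: "i < N" by simp
    let ?g = "\<Sum>j\<in>{Suc i..<N}. G j / 2" and ?x = "\<Sum>j\<in>{Suc i..<N}. x j" and ?c = "\<Sum>j\<in>{Suc i..<N}. c j"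
    have sp: "(\<Sum>j\<in>{i..<N}. p j) = p i + (\<Sum>j\<in>{Suc i..<N}. p j)" for p :: "nat \<Rightarrow> real"
      using i by (rule sum.atLeast_Suc_lessThan)
    have g0: "0 \<le> ?g" using nn(2) by (intro sum_nonneg) auto
    have xx: "0 \<le> ?x" using x0 by (intro sum_nonneg) auto
    have "e i + (G i / 2 + ?g) \<le> exp (x i) * e (Suc i) + c i + exp (x i) * ?g"
      using one[OF i] mult_right_mono[OF one_le_exp_iff[THEN iffD2, OF x0[OF i]] g0] by simp
    also have "\<dots> = exp (x i) * (e (Suc i) + ?g) + c i" by (simp add: algebra_simps)
    also have "\<dots> \<le> exp (x i) * (exp ?x * (e N + ?c)) + exp (x i) * exp ?x * c i"
    proof (rule add_mono)
      show "exp (x i) * (e (Suc i) + ?g) \<le> exp (x i) * (exp ?x * (e N + ?c))"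
        using step.IH by (intro mult_left_mono) auto
      have "1 \<le> exp (x i + ?x)" using x0[OF i] xx by simp
      then show "c i \<le> exp (x i) * exp ?x * c i"
        using mult_right_mono[OF _ c0[OF i], of 1 "exp (x i + ?x)"] by (simp add: exp_add)
    qed
    also have "\<dots> = exp (x i + ?x) * (e N + (c i + ?c))" by (simp add: exp_add algebra_simps)
    finally show ?case by (simp only: sp)
  qed
  have bound: "exp (\<Sum>j\<in>{i..<N}. x j) * (e N + (\<Sum>j\<in>{i..<N}. c j)) \<le> A * S" if "i \<le> N" for i
  proof (rule mult_mono)
    have "(\<Sum>j\<in>{i..<N}. x j) \<le> (\<Sum>j<N. x j)" using x0 by (intro sum_mono2) auto
    also have "\<dots> = 1 + (1 + \<gamma>) * (\<Sum>j<N. h j)" using N by (simp add: x_def sum.distrib sum_distrib_left)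
    also have "\<dots> \<le> 1 + (1 + \<gamma>) * T" using hT \<gamma> by (intro add_left_mono mult_left_mono) auto
    finally show "exp (\<Sum>j\<in>{i..<N}. x j) \<le> A" by (simp add: A_def)
    have "(\<Sum>j\<in>{i..<N}. c j) \<le> (\<Sum>j<N. c j)" using c0 by (intro sum_mono2) auto
    then show "e N + (\<Sum>j\<in>{i..<N}. c j) \<le> S"
      by (simp add: S_def c_def sum.distrib sum_distrib_left)
    show "0 \<le> e N + (\<Sum>j\<in>{i..<N}. c j)" using nn(1)[of N] c0 by (auto intro!: add_nonneg_nonneg sum_nonneg)
  qed (simp add: A_def)
  show "e i \<le> A * S" if "i \<le> N" for i
  proof -
    have "0 \<le> (\<Sum>j\<in>{i..<N}. G j / 2)" using nn(2) by (intro sum_nonneg) auto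
    then show ?thesis using main[OF that] bound[OF that] by linarith
  qed
  have "(\<Sum>j\<in>{0..<N}. G j / 2) \<le> A * S" using main[of 0] bound[of 0] nn(1)[of 0] by simp
  then show "(\<Sum>i<N. G i) \<le> 2 * (A * S)"
    by (simp add: lessThan_atLeast0 flip: sum_divide_distrib)
qed

section \<open>Networks and the Euler scheme\<close>

lemma borel_measurable_matrix_row:
  fixes A :: "'a \<Rightarrow> real ^ 'n ^ 'k"
  assumes "A \<in> borel_measurable N" shows "(\<lambda>\<omega>. A \<omega> $ j) \<in> borel_measurable N"
proof -
  have "continuous_on UNIV (\<lambda>A :: real ^ 'n ^ 'k. A $ j)" by (intro continuous_intros)
  from measurable_compose[OF assms borel_measurable_continuous_onI[OF this]] show ?thesis .
qed

lemma borel_measurable_matrix_vector_mult: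
  fixes A :: "'a \<Rightarrow> real ^ 'n ^ 'k" and x :: "'a \<Rightarrow> real ^ 'n"
  assumes A: "A \<in> borel_measurable N" and x: "x \<in> borel_measurable N"
  shows "(\<lambda>\<omega>. A \<omega> *v x \<omega>) \<in> borel_measurable N"
proof (rule borel_measurable_vecI)
  fix j
  have "(\<lambda>\<omega>. \<Sum>k\<in>UNIV. A \<omega> $ j $ k * x \<omega> $ k) \<in> borel_measurable N"
    by (intro borel_measurable_sum borel_measurable_times borel_measurable_vec_nth borel_measurable_matrix_row A x)
  then show "(\<lambda>\<omega>. (A \<omega> *v x \<omega>) $ j) \<in> borel_measurable N"
    by (simp add: matrix_vector_mult_def)
qed

lemma affine_map_measurable: "y \<in> borel_measurable N \<Longrightarrow> (\<lambda>x. affine_map A (y x)) \<in> borel_measurable N"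
  unfolding affine_map_def
  by (intro borel_measurable_add borel_measurable_matrix_vector_mult borel_measurable_const)

lemma activate_measurable:
  assumes \<rho>: "\<rho> \<in> borel_measurable borel" and y: "y \<in> borel_measurable N"
  shows "(\<lambda>x. activate \<rho> (y x)) \<in> borel_measurable N"
  by (rule borel_measurable_vecI)
     (use measurable_compose[OF borel_measurable_vec_nth[OF y] \<rho>] in \<open>simp add: activate_def\<close>)

lemma network_measurable:
  fixes \<theta> :: "('d::finite, 'm::finite, 'o::finite) net_param"
  assumes \<rho>: "\<rho> \<in> borel_measurable borel"
  shows "network \<rho> \<theta> \<in> borel_measurable borel"
proof -
  obtain A1 As AL where \<theta>: "\<theta> = (A1, As, AL)" by (cases \<theta>) auto
  have layers: "(\<lambda>x. fold (\<lambda>A y. affine_map A (activate \<rho> y)) As (y x)) \<in> borel_measurable borel"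
    if "y \<in> borel_measurable borel" for y :: "real ^ 'd \<Rightarrow> real ^ 'm"
    using that
  proof (induction As arbitrary: y)
    case (Cons A As)
    have "(\<lambda>x. affine_map A (activate \<rho> (y x))) \<in> borel_measurable borel"
      by (intro affine_map_measurable activate_measurable \<rho> Cons.prems)
    from Cons.IH[OF this] show ?case by simp
  qed simp
  have "(\<lambda>x. affine_map AL (activate \<rho> (fold (\<lambda>A y. affine_map A (activate \<rho> y)) As (affine_map A1 x)))) \<in> borel_measurable borel"
    by (intro affine_map_measurable activate_measurable layers \<rho>) simp
  also have "(\<lambda>x. affine_map AL (activate \<rho> (fold (\<lambda>A y. affine_map A (activate \<rho> y)) As (affine_map A1 x)))) = network \<rho> \<theta>"
    by (simp add: \<theta> fun_eq_iff)
  finally show ?thesis .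
qed

lemma net_U_measurable: "\<rho> \<in> borel_measurable borel \<Longrightarrow> net_U \<rho> \<xi> \<in> borel_measurable borel"
  unfolding net_U_def[abs_def] by (intro borel_measurable_vec_nth network_measurable)

lemma net_Z_measurable: "\<rho> \<in> borel_measurable borel \<Longrightarrow> net_Z \<rho> \<eta> \<in> borel_measurable borel"
  unfolding net_Z_def[abs_def] by (intro network_measurable)

text \<open>The network whose last layer vanishes. It has a finite loss whatever the activation function is, and so
  witnesses that the minimal loss and the approximation errors are finite.\<close>

definition zero_net :: "nat \<Rightarrow> ('d::finite, 'm::finite, 'o::finite) net_param" where
  "zero_net L = ((0, 0), replicate (L - 2) (0, 0), (0, 0))"

lemma zero_net_params: "zero_net L \<in> net_params L"
  by (simp add: zero_net_def net_params_def)

lemma zero_net_value: "net_U \<rho> (zero_net L) x = 0" "net_Z \<rho> (zero_net L) x = 0"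
  by (simp_all add: net_U_def net_Z_def zero_net_def affine_map_def)

text \<open>The infimum over the parameters need not be attained, hence a near-minimizer.\<close>

lemma ennreal_INF_approx:
  assumes "\<theta> \<in> A" "\<phi> \<theta> < (\<infinity> :: ennreal)" "0 < \<epsilon>"
  shows "\<exists>\<theta>'\<in>A. \<phi> \<theta>' \<le> ennreal (enn2real (INF \<theta>\<in>A. \<phi> \<theta>) + \<epsilon>)"
proof -
  have fin: "(INF \<theta>\<in>A. \<phi> \<theta>) < \<infinity>" using assms(1,2) by (meson INF_lower le_less_trans)
  then have eq: "ennreal (enn2real (INF \<theta>\<in>A. \<phi> \<theta>)) = (INF \<theta>\<in>A. \<phi> \<theta>)" by simp
  have "ennreal (enn2real (INF \<theta>\<in>A. \<phi> \<theta>)) < ennreal (enn2real (INF \<theta>\<in>A. \<phi> \<theta>) + \<epsilon>)"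
    using \<open>0 < \<epsilon>\<close> by (intro ennreal_lessI) (auto simp: add_nonneg_pos)
  then have "(INF \<theta>\<in>A. \<phi> \<theta>) < ennreal (enn2real (INF \<theta>\<in>A. \<phi> \<theta>) + \<epsilon>)" unfolding eq .
  then show ?thesis by (auto simp: INF_less_iff intro: less_imp_le)
qed

lemma (in brownian_space) euler_F:
  fixes t :: "nat \<Rightarrow> real" and \<mu> :: "real \<Rightarrow> real ^ 'd \<Rightarrow> real ^ 'd" and \<sigma> :: "real \<Rightarrow> real ^ 'd \<Rightarrow> real ^ 'd ^ 'd"
  assumes coeff: "lipschitz_coefficients T \<mu> \<sigma>" and t: "\<And>i j. i \<le> j \<Longrightarrow> j \<le> N \<Longrightarrow> t i \<le> t j" "0 \<le> t 0" "t N \<le> T"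
    and "i \<le> N"
  shows "euler \<mu> \<sigma> x0 W t i \<in> borel_measurable (F (t i))"
  using \<open>i \<le> N\<close>
proof (induction i)
  case 0
  show ?case by (simp add: measurable_const)
next
  case (Suc i)
  let ?X = "euler \<mu> \<sigma> x0 W t i"
  have ti: "0 \<le> t i" "t i \<le> t (Suc i)" "t (Suc i) \<le> T" "t i \<in> {0..T}" "t (Suc i) \<in> {0..T}"
    using t(1)[of 0 i] t(1)[of i "Suc i"] t(1)[of "Suc i" N] t(2,3) Suc.prems by auto
  have X: "?X \<in> borel_measurable (F (t (Suc i)))"
    using F_borel_mono[OF ti(1-3)] Suc by simp
  have sec: "(\<lambda>x. k (t i) x) \<in> borel_measurable borel"
    if "(\<lambda>(t, x). k t x) \<in> borel_measurable (restrict_space borel {0..T} \<Otimes>\<^sub>M borel)" for k :: "real \<Rightarrow> real ^ 'd \<Rightarrow> 'b::topological_space"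
  proof -
    have "Pair (t i) \<in> measurable borel (restrict_space borel {0..T} \<Otimes>\<^sub>M borel)"
      using ti by (intro measurable_Pair1') (auto simp: space_restrict_space)
    from measurable_compose[OF this that] show ?thesis by simp
  qed
  have m: "\<mu> (t i) \<in> borel_measurable borel" "\<sigma> (t i) \<in> borel_measurable borel"
    using sec coeff by (auto simp: lipschitz_coefficients_def)
  have "(\<lambda>\<omega>. ?X \<omega> + (t (Suc i) - t i) *\<^sub>R \<mu> (t i) (?X \<omega>) + \<sigma> (t i) (?X \<omega>) *v (W (t (Suc i)) \<omega> - W (t i) \<omega>))
      \<in> borel_measurable (F (t (Suc i)))"
    by (intro borel_measurable_add borel_measurable_scaleR borel_measurable_const borel_measurable_matrix_vector_mult
        borel_measurable_diff X measurable_compose[OF X m(1)] measurable_compose[OF X m(2)] W_F ti) (use ti in auto)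
  then show ?case by (simp add: Let_def)
qed

section \<open>The scheme on a grid\<close>

text \<open>One grid and one run of the scheme. \<open>X\<close> is an adapted approximation of \<open>\<X>\<close> on the grid, \<open>h_max\<close> the mesh and
  \<open>K\<close> the constant of the estimate of \<open>\<X> - X\<close>. The two smallness conditions make the implicit step a contraction and
  keep the weight in Young's inequality at most \<open>1\<close>.\<close>

locale dbdp_space = bsde_space M T F W f g f_L \<X> Y Z B\<^sub>X
  for M :: "'a measure" and T :: real and F :: "real \<Rightarrow> 'a measure" and W :: "real \<Rightarrow> 'a \<Rightarrow> real ^ 'd"
    and f :: "real \<Rightarrow> real ^ 'd \<Rightarrow> real \<Rightarrow> real ^ 'd \<Rightarrow> real" and g :: "real ^ 'd \<Rightarrow> real" and f_L :: real
    and \<X> :: "real \<Rightarrow> 'a \<Rightarrow> real ^ 'd" and Y :: "real \<Rightarrow> 'a \<Rightarrow> real" and Z :: "real \<Rightarrow> 'a \<Rightarrow> real ^ 'd"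
    and B\<^sub>X :: real +
  fixes N :: nat and t :: "nat \<Rightarrow> real" and X :: "nat \<Rightarrow> 'a \<Rightarrow> real ^ 'd" and h_max K c :: real
    and \<rho> :: "real \<Rightarrow> real" and L :: nat
    and \<xi> :: "nat \<Rightarrow> ('d, 'm::finite, 1) net_param" and \<eta> :: "nat \<Rightarrow> ('d, 'm, 'd) net_param"
    and v :: "nat \<Rightarrow> real ^ 'd \<Rightarrow> real" and z :: "nat \<Rightarrow> real ^ 'd \<Rightarrow> real ^ 'd"
  assumes N_pos: "0 < N" and t_0: "t 0 = 0" and t_N: "t N = T" and t_step: "\<And>i. i < N \<Longrightarrow> t i < t (Suc i)"
    and h_le: "\<And>i. i < N \<Longrightarrow> t (Suc i) - t i \<le> h_max" and N_h: "N * h_max \<le> c"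
    and small: "h_max \<le> 1" "32 * f_L\<^sup>2 * h_max \<le> 1"
    and X_F: "\<And>i. i \<le> N \<Longrightarrow> X i \<in> borel_measurable (F (t i))" and X_L2: "\<And>i. i \<le> N \<Longrightarrow> L2 M (X i)"
    and K: "0 \<le> K" and X_close: "\<And>i s. i < N \<Longrightarrow> s \<in> {t i<..t (Suc i)} \<Longrightarrow>
        (\<integral>\<^sup>+\<omega>. ennreal ((norm (\<X> s \<omega> - X i \<omega>))\<^sup>2) \<partial>M) \<le> ennreal (K * h_max)"
    and g_meas: "g \<in> borel_measurable borel" and g_growth: "\<exists>K. \<forall>x. \<bar>g x\<bar> \<le> K * (1 + norm x)"
    and \<rho>_meas: "\<rho> \<in> borel_measurable borel"
    and scheme: "dbdp1_scheme M W f g \<rho> L N t X \<xi> \<eta>"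
    and targets: "dbdp1_targets M F W f N t X (U_hat \<rho> g N \<xi>) v z"
begin

text \<open>\<open>U\<close> and \<open>Q\<close> are the computed values, \<open>V\<close> and \<open>Zh\<close> the targets that they approximate.\<close>

definition U :: "nat \<Rightarrow> 'a \<Rightarrow> real" where "U i \<omega> = U_hat \<rho> g N \<xi> i (X i \<omega>)"
definition Q :: "nat \<Rightarrow> 'a \<Rightarrow> real ^ 'd" where "Q i \<omega> = net_Z \<rho> (\<eta> i) (X i \<omega>)"
definition V :: "nat \<Rightarrow> 'a \<Rightarrow> real" where "V i \<omega> = v i (X i \<omega>)"
definition Zh :: "nat \<Rightarrow> 'a \<Rightarrow> real ^ 'd" where
  "Zh i = (\<lambda>\<omega>. (1 / (t (Suc i) - t i)) *\<^sub>R vec_cond_exp M (F (t i)) (\<lambda>\<omega>'. U (Suc i) \<omega>' *\<^sub>R (W (t (Suc i)) \<omega>' - W (t i) \<omega>')) \<omega>)"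

lemma t_mono: "i \<le> j \<Longrightarrow> j \<le> N \<Longrightarrow> t i \<le> t j"
  by (rule grid_mono[of N t, OF t_step])

lemma t_in: "i \<le> N \<Longrightarrow> t i \<in> {0..T}"
  using t_mono[of 0 i] t_mono[of i N] t_0 t_N by simp

lemma step_st:
  assumes "i < N"
  shows "0 \<le> t i" "t i < t (Suc i)" "t (Suc i) \<le> T" "t (Suc i) - t i \<le> 1" "32 * f_L\<^sup>2 * (t (Suc i) - t i) \<le> 1"
    "f_L * (t (Suc i) - t i) \<le> 1 / 4"
proof -
  show 1: "0 \<le> t i" "t i < t (Suc i)" "t (Suc i) \<le> T" "t (Suc i) - t i \<le> 1"
    using t_in[of i] t_in[of "Suc i"] t_step[of i] h_le[of i] small(1) assms by auto
  have "32 * f_L\<^sup>2 * (t (Suc i) - t i) \<le> 32 * f_L\<^sup>2 * h_max" using h_le[OF assms] by (intro mult_left_mono) auto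
  then show 2: "32 * f_L\<^sup>2 * (t (Suc i) - t i) \<le> 1" using small(2) by linarith
  show "f_L * (t (Suc i) - t i) \<le> 1 / 4" using 1 2 by (intro step_small) auto
qed

lemma X_M: "i \<le> N \<Longrightarrow> X i \<in> borel_measurable M"
  using L2_measurable[OF X_L2] .

lemma U_net: "i < N \<Longrightarrow> U i \<omega> = net_U \<rho> (\<xi> i) (X i \<omega>)"
  by (simp add: U_def U_hat_def)

lemma U_F: "i < N \<Longrightarrow> U i \<in> borel_measurable (F (t i))"
  using measurable_compose[OF X_F net_U_measurable[OF \<rho>_meas], of i "\<xi> i"] U_net[of i]
  by (simp cong: measurable_cong add: U_def[abs_def] U_hat_def)

lemma Q_F: "i < N \<Longrightarrow> Q i \<in> borel_measurable (F (t i))"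
  using measurable_compose[OF X_F net_Z_measurable[OF \<rho>_meas], of i "\<eta> i"] by (simp add: Q_def[abs_def])

lemma V_F: "i < N \<Longrightarrow> V i \<in> borel_measurable (F (t i))"
  using measurable_compose[OF X_F, of i "v i"] targets by (simp add: V_def[abs_def] dbdp1_targets_def)

lemma V_eq:
  assumes "i < N"
  shows "AE \<omega> in M. V i \<omega> = real_cond_exp M (F (t i)) (U (Suc i)) \<omega> + f (t i) (X i \<omega>) (V i \<omega>) (Zh i \<omega>) * (t (Suc i) - t i)"
  using targets assms unfolding dbdp1_targets_def V_def Zh_def Z_hat_bar_def U_def by simp

lemma Zh_eq: "i < N \<Longrightarrow> AE \<omega> in M. z i (X i \<omega>) = Zh i \<omega>"
  using targets unfolding dbdp1_targets_def Zh_def Z_hat_bar_def U_def by simp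

definition loss :: "nat \<Rightarrow> ('d, 'm, 1) net_param \<Rightarrow> ('d, 'm, 'd) net_param \<Rightarrow> ennreal" where
  "loss i \<xi>' \<eta>' = (\<integral>\<^sup>+\<omega>. ennreal (\<bar>U (Suc i) \<omega> - F_gen f (t i) (X i \<omega>) (net_U \<rho> \<xi>' (X i \<omega>)) (net_Z \<rho> \<eta>' (X i \<omega>))
      (t (Suc i) - t i) (W (t (Suc i)) \<omega> - W (t i) \<omega>)\<bar>\<^sup>2) \<partial>M)"

lemma loss_min:
  assumes "i < N" "\<xi>' \<in> net_params L" "\<eta>' \<in> net_params L"
  shows "loss i (\<xi> i) (\<eta> i) \<le> loss i \<xi>' \<eta>'"
proof -
  have eq: "dbdp1_loss M W f \<rho> t X (U_hat \<rho> g N \<xi> (Suc i)) i (\<xi>', \<eta>') = loss i \<xi>' \<eta>'" for \<xi>' \<eta>'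
    by (simp add: dbdp1_loss_def loss_def U_def)
  have "is_arg_min (dbdp1_loss M W f \<rho> t X (U_hat \<rho> g N \<xi> (Suc i)) i)
      (\<lambda>\<theta>. \<theta> \<in> net_params L \<times> net_params L) (\<xi> i, \<eta> i)"
    using scheme assms(1) by (simp add: dbdp1_scheme_def)
  then have "\<not> loss i \<xi>' \<eta>' < loss i (\<xi> i) (\<eta> i)"
    using SigmaI[OF assms(2,3)] unfolding is_arg_min_def eq[symmetric] by blast
  then show ?thesis by simp
qed

lemma zero_loss_finite:
  assumes "i < N" "L2 M (U (Suc i))" shows "loss i (zero_net L) (zero_net L) < \<infinity>"
proof -
  have fL: "L2 M (\<lambda>\<omega>. f (t i) (X i \<omega>) 0 0)"
    by (rule f_L2[OF finite_measure_axioms _ _ X_L2]) (use t_in assms in auto)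
  have "L2 M (\<lambda>\<omega>. U (Suc i) \<omega> + f (t i) (X i \<omega>) 0 0 * (t (Suc i) - t i))"
    by (intro L2_add assms L2_mult_right fL)
  from nn_integral_L2[OF this] show ?thesis
    by (simp add: loss_def F_gen_def zero_net_value)
qed

text \<open>Square integrability propagates backwards from the terminal time: each minimal loss is at most
  the loss of the zero network.\<close>

lemma UQ_step:
  assumes i: "i < N" and U: "L2 M (U (Suc i))"
  shows "L2 M (U i)" "L2 M (Q i)"
proof -
  have "loss i (\<xi> i) (\<eta> i) < \<infinity>"
    using loss_min[OF i zero_net_params zero_net_params] zero_loss_finite[OF i U] by (rule le_less_trans)
  then have fin: "(\<integral>\<^sup>+\<omega>. ennreal (\<bar>U (Suc i) \<omega> - F_gen f (t i) (X i \<omega>) (U i \<omega>) (Q i \<omega>)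
      (t (Suc i) - t i) (W (t (Suc i)) \<omega> - W (t i) \<omega>)\<bar>\<^sup>2) \<partial>M) < \<infinity>"
    by (simp add: loss_def U_net[OF i] Q_def)
  note st = step_st[OF i]
  have XF: "X i \<in> borel_measurable (F (t i))" and XL: "L2 M (X i)" using X_F X_L2 i by auto
  show "L2 M (U i)" "L2 M (Q i)"
    by (rule loss_finite_L2[OF st(1-3) st(6) XF XL U U_F[OF i] Q_F[OF i] fin])+
qed

lemma U_N_L2: "L2 M (U N)"
proof -
  obtain Kg where Kg: "\<And>x. \<bar>g x\<bar> \<le> Kg * (1 + norm x)" using g_growth by blast
  have U: "U N = (\<lambda>\<omega>. g (X N \<omega>))" by (simp add: U_def[abs_def] U_hat_def)
  have b: "L2 M (\<lambda>\<omega>. 1 + norm (X N \<omega>))"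
    by (intro L2_add L2_const L2_norm X_L2 finite_measure_axioms) simp
  show ?thesis
    unfolding U
  proof (rule L2_dominated[OF b, where C = Kg])
    show "(\<lambda>\<omega>. g (X N \<omega>)) \<in> borel_measurable M" using measurable_compose[OF X_M g_meas] by simp
    show "AE \<omega> in M. norm (g (X N \<omega>)) \<le> Kg * norm (1 + norm (X N \<omega>))"
      using Kg by (simp add: add_nonneg_nonneg)
  qed
qed

lemma U_L2: "i \<le> N \<Longrightarrow> L2 M (U i)"
proof (induction i rule: inc_induct)
  case base
  show ?case by (rule U_N_L2)
next
  case (step i)
  then show ?case using UQ_step(1) by simp
qed

lemma Q_L2: "i < N \<Longrightarrow> L2 M (Q i)"
  using UQ_step(2) U_L2 by simp

lemma Zh_L2: "i < N \<Longrightarrow> L2 M (Zh i)"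
  unfolding Zh_def using increment_cond_exp(2)[OF step_st(1-3) U_L2] by simp

lemma V_L2:
  assumes i: "i < N" shows "L2 M (V i)"
proof -
  note st = step_st[OF i]
  have s: "t i \<in> {0..T}" using t_in i by simp
  have aL: "L2 M (real_cond_exp M (F (t i)) (U (Suc i)))" using cond_exp_L2[OF s U_L2] i by simp
  have XL: "L2 M (X i)" using X_L2 i by simp
  have "AE \<omega> in M. V i \<omega> - f (t i) (X i \<omega>) (V i \<omega>) (Zh i \<omega>) * (t (Suc i) - t i) = real_cond_exp M (F (t i)) (U (Suc i)) \<omega>"
    using V_eq[OF i] by eventually_elim simp
  then show ?thesis
    by (rule implicit_L2[OF s _ st(6) F_borel_M[OF s V_F[OF i]] aL XL Zh_L2[OF i], rotated]) (use st in simp)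
qed

definition \<epsilon>v :: "nat \<Rightarrow> real" where
  "\<epsilon>v i = enn2real (eps_v M \<rho> (net_params L :: ('d, 'm, 1) net_param set) X v i)"
definition \<epsilon>z :: "nat \<Rightarrow> real" where
  "\<epsilon>z i = enn2real (eps_z M \<rho> (net_params L :: ('d, 'm, 'd) net_param set) X z i)"

definition err_v :: "nat \<Rightarrow> ('d, 'm, 1) net_param \<Rightarrow> ennreal" where
  "err_v i \<xi>' = (\<integral>\<^sup>+\<omega>. ennreal (\<bar>v i (X i \<omega>) - net_U \<rho> \<xi>' (X i \<omega>)\<bar>\<^sup>2) \<partial>M)"
definition err_z :: "nat \<Rightarrow> ('d, 'm, 'd) net_param \<Rightarrow> ennreal" where
  "err_z i \<eta>' = (\<integral>\<^sup>+\<omega>. ennreal ((norm (z i (X i \<omega>) - net_Z \<rho> \<eta>' (X i \<omega>)))\<^sup>2) \<partial>M)"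

lemma eps_z_Zh:
  assumes "i < N"
  shows "err_z i \<eta>' = (\<integral>\<^sup>+\<omega>. ennreal ((norm (Zh i \<omega> - net_Z \<rho> \<eta>' (X i \<omega>)))\<^sup>2) \<partial>M)"
  unfolding err_z_def
proof (rule nn_integral_cong_AE)
  show "AE \<omega> in M. ennreal ((norm (z i (X i \<omega>) - net_Z \<rho> \<eta>' (X i \<omega>)))\<^sup>2)
      = ennreal ((norm (Zh i \<omega> - net_Z \<rho> \<eta>' (X i \<omega>)))\<^sup>2)"
    using Zh_eq[OF assms] by eventually_elim simp
qed

lemma zero_net_errors:
  assumes i: "i < N"
  shows "err_v i (zero_net L) < \<infinity>" and "err_z i (zero_net L) < \<infinity>"
  unfolding eps_z_Zh[OF i] err_v_def
  using nn_integral_L2[OF V_L2[OF i]] nn_integral_L2[OF Zh_L2[OF i]] by (simp_all add: zero_net_value V_def)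

lemma eps_finite:
  assumes i: "i < N"
  shows "eps_v M \<rho> (net_params L :: ('d, 'm, 1) net_param set) X v i = ennreal (\<epsilon>v i)"
    and "eps_z M \<rho> (net_params L :: ('d, 'm, 'd) net_param set) X z i = ennreal (\<epsilon>z i)"
proof -
  have "eps_v M \<rho> (net_params L :: ('d, 'm, 1) net_param set) X v i < \<infinity>"
    unfolding eps_v_def err_v_def[symmetric]
    by (rule le_less_trans[OF INF_lower[OF zero_net_params, where f = "err_v i"] zero_net_errors(1)[OF i]])
  then show "eps_v M \<rho> (net_params L :: ('d, 'm, 1) net_param set) X v i = ennreal (\<epsilon>v i)" by (simp add: \<epsilon>v_def)
  have "eps_z M \<rho> (net_params L :: ('d, 'm, 'd) net_param set) X z i < \<infinity>"
    unfolding eps_z_def err_z_def[symmetric]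
    by (rule le_less_trans[OF INF_lower[OF zero_net_params, where f = "err_z i"] zero_net_errors(2)[OF i]])
  then show "eps_z M \<rho> (net_params L :: ('d, 'm, 'd) net_param set) X z i = ennreal (\<epsilon>z i)" by (simp add: \<epsilon>z_def)
qed

lemma eps_nonneg: "0 \<le> \<epsilon>v i" "0 \<le> \<epsilon>z i"
  by (simp_all add: \<epsilon>v_def \<epsilon>z_def)

text \<open>The minimizer of the loss is compared with near-minimizers of the two approximation errors; these can be
  combined because the parameters of the two networks vary independently.\<close>

lemma optimal_error:
  assumes i: "i < N"
  defines "h \<equiv> t (Suc i) - t i"
  shows "msq M (\<lambda>\<omega>. V i \<omega> - U i \<omega>) + h * msq M (\<lambda>\<omega>. Zh i \<omega> - Q i \<omega>) \<le> 8 * (\<epsilon>v i + h * \<epsilon>z i)"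
proof (rule field_le_epsilon)
  fix e :: real assume e: "0 < e"
  note st = step_st[OF i]
  have h: "0 < h" "h \<le> 1" using st by (auto simp: h_def)
  have XF: "X i \<in> borel_measurable (F (t i))" and XL: "L2 M (X i)" and UL: "L2 M (U (Suc i))" and UiL: "L2 M (U i)"
    using X_F X_L2 U_L2 i by auto
  have s: "t i \<in> {0..T}" using t_in i by simp
  have e16: "0 < e / 16" using e by simp
  obtain \<xi>' :: "('d, 'm, 1) net_param" where \<xi>': "\<xi>' \<in> net_params L"
    "err_v i \<xi>' \<le> ennreal (\<epsilon>v i + e / 16)"
    using ennreal_INF_approx[where \<phi> = "err_v i", OF zero_net_params zero_net_errors(1)[OF i] e16]
    unfolding \<epsilon>v_def eps_v_def err_v_def[symmetric] by blast
  obtain \<eta>' :: "('d, 'm, 'd) net_param" where \<eta>': "\<eta>' \<in> net_params L"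
    "err_z i \<eta>' \<le> ennreal (\<epsilon>z i + e / 16)"
    using ennreal_INF_approx[where \<phi> = "err_z i", OF zero_net_params zero_net_errors(2)[OF i] e16]
    unfolding \<epsilon>z_def eps_z_def err_z_def[symmetric] by blast
  define u' where "u' = (\<lambda>\<omega>. net_U \<rho> \<xi>' (X i \<omega>))"
  define q' where "q' = (\<lambda>\<omega>. net_Z \<rho> \<eta>' (X i \<omega>))"
  have u'F: "u' \<in> borel_measurable (F (t i))" and q'F: "q' \<in> borel_measurable (F (t i))"
    unfolding u'_def q'_def
    by (rule measurable_compose[OF XF net_U_measurable[OF \<rho>_meas]],
        rule measurable_compose[OF XF net_Z_measurable[OF \<rho>_meas]])
  have le1: "(\<integral>\<^sup>+\<omega>. ennreal ((norm (V i \<omega> - u' \<omega>))\<^sup>2) \<partial>M) \<le> ennreal (\<epsilon>v i + e / 16)"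
    using \<xi>'(2) by (simp add: V_def u'_def err_v_def)
  have le2: "(\<integral>\<^sup>+\<omega>. ennreal ((norm (Zh i \<omega> - q' \<omega>))\<^sup>2) \<partial>M) \<le> ennreal (\<epsilon>z i + e / 16)"
    using \<eta>'(2) unfolding eps_z_Zh[OF i] q'_def .
  have VuL: "L2 M (\<lambda>\<omega>. V i \<omega> - u' \<omega>)"
    using le_less_trans[OF le1] L2_measurable[OF V_L2[OF i]] F_borel_M[OF s u'F]
    by (subst L2_iff_nn_integral) auto
  have ZqL: "L2 M (\<lambda>\<omega>. Zh i \<omega> - q' \<omega>)"
    using le_less_trans[OF le2] L2_measurable[OF Zh_L2[OF i]] F_borel_M[OF s q'F]
    by (subst L2_iff_nn_integral) auto
  have u'L: "L2 M u'" using L2_diff[OF V_L2[OF i] VuL] by simp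
  have q'L: "L2 M q'" using L2_diff[OF Zh_L2[OF i] ZqL] by simp
  have m1: "msq M (\<lambda>\<omega>. V i \<omega> - u' \<omega>) \<le> \<epsilon>v i + e / 16"
    using ennreal_le_iff[THEN iffD1, OF _ le1[unfolded nn_integral_L2[OF VuL]]] eps_nonneg(1)[of i] e by simp
  have m2: "msq M (\<lambda>\<omega>. Zh i \<omega> - q' \<omega>) \<le> \<epsilon>z i + e / 16"
    using ennreal_le_iff[THEN iffD1, OF _ le2[unfolded nn_integral_L2[OF ZqL]]] eps_nonneg(2)[of i] e by simp
  have opt: "(\<integral>\<^sup>+\<omega>. ennreal (\<bar>U (Suc i) \<omega> - F_gen f (t i) (X i \<omega>) (U i \<omega>) (Q i \<omega>) (t (Suc i) - t i) (W (t (Suc i)) \<omega> - W (t i) \<omega>)\<bar>\<^sup>2) \<partial>M)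
      \<le> (\<integral>\<^sup>+\<omega>. ennreal (\<bar>U (Suc i) \<omega> - F_gen f (t i) (X i \<omega>) (u' \<omega>) (q' \<omega>) (t (Suc i) - t i) (W (t (Suc i)) \<omega> - W (t i) \<omega>)\<bar>\<^sup>2) \<partial>M)"
    using loss_min[OF i \<xi>'(1) \<eta>'(1)] by (simp add: loss_def U_net[OF i] Q_def u'_def q'_def)
  have "msq M (\<lambda>\<omega>. V i \<omega> - U i \<omega>) + h * msq M (\<lambda>\<omega>. Zh i \<omega> - Q i \<omega>)
      \<le> 8 * (msq M (\<lambda>\<omega>. V i \<omega> - u' \<omega>) + h * msq M (\<lambda>\<omega>. Zh i \<omega> - q' \<omega>))"
    unfolding h_def
    by (rule optimal_coefficients[OF st(1-5) XF XL UL F_borel_M[OF s V_F[OF i]] V_L2[OF i] V_eq[OF i] Zh_def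
        U_F[OF i] UiL Q_F[OF i] Q_L2[OF i] u'F u'L q'F q'L opt])
  also have "\<dots> \<le> 8 * ((\<epsilon>v i + e / 16) + h * (\<epsilon>z i + e / 16))"
    using m1 m2 h by (intro mult_left_mono add_mono) auto
  also have "\<dots> = 8 * (\<epsilon>v i + h * \<epsilon>z i) + (e / 2 + h * e / 2)" by (simp add: algebra_simps)
  also have "\<dots> \<le> 8 * (\<epsilon>v i + h * \<epsilon>z i) + e"
  proof -
    have "h * e \<le> 1 * e" using h(2) e by (intro mult_right_mono) auto
    then show ?thesis by linarith
  qed
  finally show "msq M (\<lambda>\<omega>. V i \<omega> - U i \<omega>) + h * msq M (\<lambda>\<omega>. Zh i \<omega> - Q i \<omega>) \<le> 8 * (\<epsilon>v i + h * \<epsilon>z i) + e" .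
qed

text \<open>\<open>gap\<close> is the quantity \<open>E\<bar>D - E\<^sub>s D\<bar>\<^sup>2\<close> of the step from \<open>t i\<close>.\<close>

definition err :: "nat \<Rightarrow> real" where "err i = msq M (\<lambda>\<omega>. Y (t i) \<omega> - U i \<omega>)"
definition gap :: "nat \<Rightarrow> real" where
  "gap i = msq M (\<lambda>\<omega>. (Y (t (Suc i)) \<omega> - U (Suc i) \<omega>)
      - real_cond_exp M (F (t i)) (\<lambda>\<omega>. Y (t (Suc i)) \<omega> - U (Suc i) \<omega>) \<omega>)"
definition Zreg :: "nat \<Rightarrow> real" where
  "Zreg i = msq (slab (t i) (t (Suc i)) M) (\<lambda>(s, \<omega>). Z s \<omega> - Z_bar M F Z t i \<omega>)"
definition Zerr :: "nat \<Rightarrow> real" where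
  "Zerr i = msq (slab (t i) (t (Suc i)) M) (\<lambda>(s, \<omega>). Z s \<omega> - Q i \<omega>)"
definition Fi :: "nat \<Rightarrow> real" where "Fi i = msq (slab (t i) (t (Suc i)) M) (\<lambda>(s, \<omega>). driver s \<omega>)"
definition ze :: "nat \<Rightarrow> real" where "ze i = msq (slab (t i) (t (Suc i)) M) (\<lambda>(s, \<omega>). Z s \<omega>)"

lemma Z_bar_eq: "Z_bar M F Z t i = (\<lambda>\<omega>. (1 / (t (Suc i) - t i)) *\<^sub>R vec_cond_exp M (F (t i)) (time_integral (t i) (t (Suc i)) Z) \<omega>)"
  by (simp add: Z_bar_def[abs_def] time_integral_def[abs_def])

lemma Zreg_L2: "i < N \<Longrightarrow> L2 (slab (t i) (t (Suc i)) M) (\<lambda>(s, \<omega>). Z s \<omega> - Z_bar M F Z t i \<omega>)"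
  unfolding Z_bar_eq using Z_mean(4)[OF step_st(1-3)] by simp

lemma one_step:
  assumes i: "i < N"
  defines "h \<equiv> t (Suc i) - t i"
  shows "(1 - h / 2) * msq M (\<lambda>\<omega>. Y (t i) \<omega> - V i \<omega>) + gap i / 2
      \<le> (1 + 32 * f_L\<^sup>2 * h) * err (Suc i) + (h\<^sup>2 + h * (K * h_max) + 2 * h * Fi i + h * ze i + Zreg i)"
    and "L2 (slab (t i) (t (Suc i)) M) (\<lambda>(s, \<omega>). Z s \<omega> - Q i \<omega>)"
    and "Zerr i \<le> 4 * Zreg i + 8 * gap i + 8 * (h * Fi i) + 2 * (h * msq M (\<lambda>\<omega>. Zh i \<omega> - Q i \<omega>))"
proof -
  note st = step_st[OF i]
  have le: "t i \<le> t (Suc i)" using st by simp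
  have hm: "0 \<le> h_max" using h_le[OF i] st by linarith
  have R: "0 \<le> K * h_max" using K hm by simp
  have XL: "L2 M (X i)" and UL: "L2 M (U (Suc i))" using X_L2 U_L2 i by auto
  note b = bsde_step[OF st(1-5) XL R X_close[OF i] UL V_F[OF i] V_L2[OF i] Zh_def V_eq[OF i]]
  show "(1 - h / 2) * msq M (\<lambda>\<omega>. Y (t i) \<omega> - V i \<omega>) + gap i / 2
      \<le> (1 + 32 * f_L\<^sup>2 * h) * err (Suc i) + (h\<^sup>2 + h * (K * h_max) + 2 * h * Fi i + h * ze i + Zreg i)"
    using b(1) unfolding h_def gap_def err_def Fi_def ze_def Zreg_def Z_bar_eq .
  let ?S = "slab (t i) (t (Suc i)) M"
  have c: "L2 M (\<lambda>\<omega>. Zh i \<omega> - Q i \<omega>)" by (rule L2_diff[OF Zh_L2[OF i] Q_L2[OF i]])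
  note sc = slab_L2_const[OF le c]
  have eq: "(\<lambda>(s, \<omega>). Z s \<omega> - Q i \<omega>) = (\<lambda>p. (\<lambda>(s, \<omega>). Z s \<omega> - Zh i \<omega>) p + (Zh i (snd p) - Q i (snd p)))"
    by (simp add: fun_eq_iff)
  show "L2 ?S (\<lambda>(s, \<omega>). Z s \<omega> - Q i \<omega>)" unfolding eq by (rule L2_add[OF b(2) sc(1)])
  have "Zerr i \<le> 2 * msq ?S (\<lambda>(s, \<omega>). Z s \<omega> - Zh i \<omega>) + 2 * (h * msq M (\<lambda>\<omega>. Zh i \<omega> - Q i \<omega>))"
    unfolding Zerr_def eq using msq_add_le[OF b(2) sc(1)] unfolding sc(2) h_def .
  also have "msq ?S (\<lambda>(s, \<omega>). Z s \<omega> - Zh i \<omega>) \<le> 2 * Zreg i + 2 * (2 * gap i + 2 * (h * Fi i))"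
    using b(3) unfolding h_def gap_def Fi_def Zreg_def Z_bar_eq .
  finally show "Zerr i \<le> 4 * Zreg i + 8 * gap i + 8 * (h * Fi i) + 2 * (h * msq M (\<lambda>\<omega>. Zh i \<omega> - Q i \<omega>))"
    by simp
qed

end

context dbdp_space
begin

lemma h_sum: "(\<Sum>i<N. t (Suc i) - t i) = T"
  using t_0 t_N by (simp add: sum_lessThan_telescope)

lemma h_max_pos: "0 < h_max" "0 < c"
proof -
  show "0 < h_max" using h_le[OF N_pos] t_step[OF N_pos] by linarith
  then have "0 < N * h_max" using N_pos by simp
  then show "0 < c" using N_h by linarith
qed

text \<open>The constants depend on the solution only through its norms over \<open>{0..T}\<close>, and not on the grid.\<close>

definition \<Phi> :: real where "\<Phi> = msq (slab 0 T M) (\<lambda>(s, \<omega>). driver s \<omega>)"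
definition A\<^sub>0 :: real where "A\<^sub>0 = exp (1 + (1 + 32 * f_L\<^sup>2) * T)"
definition B\<^sub>0 :: real where "B\<^sub>0 = T + T * K + 2 * \<Phi> + msq (slab 0 T M) (\<lambda>(s, \<omega>). Z s \<omega>)"
definition C\<^sub>0 :: real where "C\<^sub>0 = 17 * A\<^sub>0 * (21 + 4 * B\<^sub>0 + 16 * c) + 20 + 8 * \<Phi>"

text \<open>One bound \<open>B\<close> for all errors of \<open>Y\<close> comes out of the recursion; the errors of \<open>Z\<close> are at most \<open>16 B\<close> plus terms
  that are already on the right-hand side.\<close>

lemma total_error:
  defines "S \<equiv> err N + h_max + (\<Sum>i<N. Zreg i) + (\<Sum>i<N. N * \<epsilon>v i + \<epsilon>z i)"
  shows "\<exists>B. (\<forall>i<N. err i \<le> B) \<and> B + (\<Sum>i<N. Zerr i) \<le> C\<^sub>0 * S"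
proof -
  define h where "h = (\<lambda>i. t (Suc i) - t i)"
  define E where "E = (\<Sum>i<N. Zreg i)"
  define R where "R = (\<Sum>i<N. N * \<epsilon>v i + \<epsilon>z i)"
  define r where "r = (\<lambda>i. msq M (\<lambda>\<omega>. V i \<omega> - U i \<omega>))"
  define a where "a = (\<lambda>i. msq M (\<lambda>\<omega>. Y (t i) \<omega> - V i \<omega>))"
  define b where "b = (\<lambda>i. (h i)\<^sup>2 + h i * (K * h_max) + 2 * h i * Fi i + h i * ze i + Zreg i)"
  define \<zeta> where "\<zeta> = msq (slab 0 T M) (\<lambda>(s, \<omega>). Z s \<omega>)"
  note hm = h_max_pos(1) small(1)
  have h: "0 < h i" "h i \<le> h_max" "h i \<le> 1" if "i < N" for i
    using t_step[OF that] h_le[OF that] small(1) by (auto simp: h_def)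
  have nn: "0 \<le> err i" "0 \<le> gap i" "0 \<le> a i" "0 \<le> r i" "0 \<le> Fi i" "0 \<le> ze i" "0 \<le> Zreg i" for i
    by (simp_all add: err_def gap_def a_def r_def Fi_def ze_def Zreg_def)
  have nn': "0 \<le> E" "0 \<le> R" "0 \<le> \<Phi>" "0 \<le> \<zeta>"
    using nn eps_nonneg by (auto simp: E_def R_def \<Phi>_def \<zeta>_def intro!: sum_nonneg add_nonneg_nonneg mult_nonneg_nonneg)
  have b0: "0 \<le> b i" if "i < N" for i
    using h[OF that] nn[of i] K hm by (simp add: b_def)
  have hT: "(\<Sum>i<N. h i) = T" using h_sum by (simp add: h_def)
  have young: "err i \<le> (1 + 1 / N) * a i + (1 + N) * r i" if i: "i < N" for i
  proof -
    have l: "L2 M (\<lambda>\<omega>. Y (t i) \<omega> - V i \<omega>)" "L2 M (\<lambda>\<omega>. V i \<omega> - U i \<omega>)"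
      using L2_diff[OF Y_L2 V_L2] L2_diff[OF V_L2 U_L2] t_in i by auto
    have "err i = msq M (\<lambda>\<omega>. (Y (t i) \<omega> - V i \<omega>) + (V i \<omega> - U i \<omega>))" by (simp add: err_def)
    also have "\<dots> \<le> (1 + 1 / N) * a i + (1 + 1 / (1 / N)) * r i"
      unfolding a_def r_def using msq_add_young[OF l, of "1 / N"] N_pos by simp
    finally show ?thesis by simp
  qed
  define S1 where "S1 = err N + 4 * (\<Sum>i<N. b i) + 2 * (\<Sum>i<N. N * r i)"
  have step: "(1 - h i / 2) * a i + gap i / 2 \<le> (1 + 32 * f_L\<^sup>2 * h i) * err (Suc i) + b i" if "i < N" for i
    using one_step(1)[OF that] unfolding h_def a_def b_def .
  note gr = backward_gronwall[of N "32 * f_L\<^sup>2" h T err gap a b r, folded A\<^sub>0_def S1_def]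
  have err_le: "err i \<le> A\<^sub>0 * S1" if "i \<le> N" for i
    by (rule gr(1)) (use N_pos h hT nn b0 step young that in \<open>auto intro: less_imp_le\<close>)
  have gap_le: "(\<Sum>i<N. gap i) \<le> 2 * (A\<^sub>0 * S1)"
    by (rule gr(2)) (use N_pos h hT nn b0 step young in \<open>auto intro: less_imp_le\<close>)
  have opt: "N * r i \<le> 8 * (1 + c) * (N * \<epsilon>v i + \<epsilon>z i)"
    "h i * msq M (\<lambda>\<omega>. Zh i \<omega> - Q i \<omega>) \<le> 8 * (N * \<epsilon>v i + \<epsilon>z i)" if i: "i < N" for i
  proof -
    have N1: "1 \<le> real N" using N_pos by simp
    have o: "r i + h i * msq M (\<lambda>\<omega>. Zh i \<omega> - Q i \<omega>) \<le> 8 * (\<epsilon>v i + h i * \<epsilon>z i)"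
      using optimal_error[OF i] by (simp add: r_def h_def)
    have hz: "0 \<le> h i * msq M (\<lambda>\<omega>. Zh i \<omega> - Q i \<omega>)" using h[OF i] by simp
    have "N * h i \<le> N * h_max" using h[OF i] by (intro mult_left_mono) auto
    then have Nh: "N * h i \<le> c" using N_h by linarith
    have "N * r i \<le> N * (8 * (\<epsilon>v i + h i * \<epsilon>z i))" using o hz by (intro mult_left_mono) auto
    also have "\<dots> = 8 * (1 * (N * \<epsilon>v i) + (N * h i) * \<epsilon>z i)" by (simp add: algebra_simps)
    also have "\<dots> \<le> 8 * ((1 + c) * (N * \<epsilon>v i) + (1 + c) * \<epsilon>z i)"
      using Nh h_max_pos eps_nonneg by (intro mult_left_mono add_mono mult_right_mono) auto
    finally show "N * r i \<le> 8 * (1 + c) * (N * \<epsilon>v i + \<epsilon>z i)" by (simp add: algebra_simps)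
    have "h i * msq M (\<lambda>\<omega>. Zh i \<omega> - Q i \<omega>) \<le> 8 * (1 * \<epsilon>v i + h i * \<epsilon>z i)"
      using o nn(4)[of i] by simp
    also have "\<dots> \<le> 8 * (N * \<epsilon>v i + 1 * \<epsilon>z i)"
      using h[OF i] N1 eps_nonneg by (intro mult_left_mono add_mono mult_right_mono) auto
    finally show "h i * msq M (\<lambda>\<omega>. Zh i \<omega> - Q i \<omega>) \<le> 8 * (N * \<epsilon>v i + \<epsilon>z i)" by simp
  qed
  have sums: "(\<Sum>i<N. Fi i) \<le> \<Phi>" "(\<Sum>i<N. ze i) \<le> \<zeta>"
    using slab_msq_sum_le[of N t M "\<lambda>(s, \<omega>). driver s \<omega>"] slab_msq_sum_le[of N t M "\<lambda>(s, \<omega>). Z s \<omega>"]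
      t_mono slab_driver slab_Z
    by (auto simp: t_0 t_N Fi_def ze_def \<Phi>_def \<zeta>_def)
  have "(\<Sum>i<N. b i) \<le> (\<Sum>i<N. h_max * h i + K * h_max * h i + 2 * h_max * Fi i + h_max * ze i + Zreg i)"
  proof (rule sum_mono)
    fix i assume "i \<in> {..<N}"
    then have hi: "0 < h i" "h i \<le> h_max" using h by auto
    have "(h i)\<^sup>2 \<le> h_max * h i" using hi by (simp add: power2_eq_square mult_right_mono)
    moreover have "2 * h i * Fi i \<le> 2 * h_max * Fi i" "h i * ze i \<le> h_max * ze i"
      using hi nn by (auto intro!: mult_right_mono)
    moreover have "h i * (K * h_max) = K * h_max * h i" by simp
    ultimately show "b i \<le> h_max * h i + K * h_max * h i + 2 * h_max * Fi i + h_max * ze i + Zreg i"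
      unfolding b_def by linarith
  qed
  also have "\<dots> = h_max * T + K * h_max * T + 2 * h_max * (\<Sum>i<N. Fi i) + h_max * (\<Sum>i<N. ze i) + E"
    by (simp add: sum.distrib hT E_def flip: sum_distrib_left)
  also have "\<dots> \<le> h_max * T + K * h_max * T + 2 * h_max * \<Phi> + h_max * \<zeta> + E"
    using sums hm mult_nonneg_nonneg[OF K less_imp_le[OF hm(1)]] by (intro add_mono mult_left_mono) auto
  finally have b_le: "(\<Sum>i<N. b i) \<le> B\<^sub>0 * h_max + E"
    by (simp add: B\<^sub>0_def \<zeta>_def algebra_simps)
  have "(\<Sum>i<N. N * r i) \<le> (\<Sum>i<N. 8 * (1 + c) * (N * \<epsilon>v i + \<epsilon>z i))"
    using opt(1) by (intro sum_mono) auto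
  then have r_le: "(\<Sum>i<N. N * r i) \<le> 8 * (1 + c) * R" by (simp add: R_def flip: sum_distrib_left)
  have B0: "0 \<le> B\<^sub>0" using T_pos K nn' by (simp add: B\<^sub>0_def \<zeta>_def)
  have c0: "0 < c" by (rule h_max_pos)
  have S_eq: "S = err N + h_max + E + R" by (simp add: S_def E_def R_def)
  have S1_le: "S1 \<le> (21 + 4 * B\<^sub>0 + 16 * c) * S"
  proof -
    have "S1 \<le> 1 * err N + 4 * B\<^sub>0 * h_max + 4 * E + 16 * (1 + c) * R"
    proof -
      have "4 * (\<Sum>i<N. b i) \<le> 4 * (B\<^sub>0 * h_max + E)" "2 * (\<Sum>i<N. N * r i) \<le> 2 * (8 * (1 + c) * R)"
        using b_le r_le by simp_all
      moreover have "4 * (B\<^sub>0 * h_max + E) = 4 * B\<^sub>0 * h_max + 4 * E" "2 * (8 * (1 + c) * R) = 16 * (1 + c) * R"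
        by simp_all
      ultimately show ?thesis unfolding S1_def by linarith
    qed
    also have "\<dots> \<le> (21 + 4 * B\<^sub>0 + 16 * c) * err N + (21 + 4 * B\<^sub>0 + 16 * c) * h_max
        + (21 + 4 * B\<^sub>0 + 16 * c) * E + (21 + 4 * B\<^sub>0 + 16 * c) * R"
      using B0 c0 nn nn' hm by (intro add_mono mult_right_mono) auto
    finally show ?thesis unfolding S_eq by (simp only: distrib_left)
  qed
  have "(\<Sum>i<N. Zerr i) \<le> (\<Sum>i<N. 4 * Zreg i + 8 * gap i + 8 * (h_max * Fi i) + 16 * (N * \<epsilon>v i + \<epsilon>z i))"
  proof (rule sum_mono)
    fix i assume "i \<in> {..<N}"
    then have i: "i < N" by simp
    have "h i * Fi i \<le> h_max * Fi i" using h(2)[OF i] nn by (intro mult_right_mono) auto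
    then show "Zerr i \<le> 4 * Zreg i + 8 * gap i + 8 * (h_max * Fi i) + 16 * (N * \<epsilon>v i + \<epsilon>z i)"
      using one_step(3)[OF i, folded h_def] opt(2)[OF i] unfolding h_def by linarith
  qed
  also have "\<dots> = 4 * E + 8 * (\<Sum>i<N. gap i) + 8 * (h_max * (\<Sum>i<N. Fi i)) + 16 * R"
    by (simp add: E_def R_def sum.distrib sum_distrib_left distrib_left)
  also have "\<dots> \<le> 4 * E + 8 * (2 * (A\<^sub>0 * S1)) + 8 * (h_max * \<Phi>) + 16 * R"
    using gap_le sums(1) hm by (intro add_mono mult_left_mono) auto
  finally have Z_le: "(\<Sum>i<N. Zerr i) \<le> 4 * E + 8 * (2 * (A\<^sub>0 * S1)) + 8 * (h_max * \<Phi>) + 16 * R" .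
  show ?thesis
  proof (intro exI conjI allI impI)
    show "err i \<le> A\<^sub>0 * S1" if "i < N" for i using err_le that by simp
    have A0: "0 < A\<^sub>0" by (simp add: A\<^sub>0_def)
    have "A\<^sub>0 * S1 + (\<Sum>i<N. Zerr i) \<le> 17 * A\<^sub>0 * S1 + (0 * err N + 8 * \<Phi> * h_max + 4 * E + 16 * R)"
      using Z_le by (simp add: algebra_simps)
    also have "\<dots> \<le> 17 * A\<^sub>0 * ((21 + 4 * B\<^sub>0 + 16 * c) * S)
        + ((20 + 8 * \<Phi>) * err N + (20 + 8 * \<Phi>) * h_max + (20 + 8 * \<Phi>) * E + (20 + 8 * \<Phi>) * R)"
      using S1_le A0 nn nn' hm by (intro add_mono mult_left_mono mult_right_mono) auto
    also have "\<dots> = C\<^sub>0 * S" unfolding S_eq C\<^sub>0_def by (simp add: algebra_simps)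
    finally show "A\<^sub>0 * S1 + (\<Sum>i<N. Zerr i) \<le> C\<^sub>0 * S" .
  qed
qed

lemma nn_integral_slab_sum:
  fixes H :: "nat \<Rightarrow> real \<Rightarrow> 'a \<Rightarrow> 'b::euclidean_space"
  assumes H: "\<And>i. i < N \<Longrightarrow> L2 (slab (t i) (t (Suc i)) M) (\<lambda>(s, \<omega>). H i s \<omega>)"
  shows "(\<integral>\<^sup>+\<omega>. (\<Sum>i<N. \<integral>\<^sup>+s\<in>{t i..t (Suc i)}. ennreal ((norm (H i s \<omega>))\<^sup>2) \<partial>lborel) \<partial>M)
    = ennreal (\<Sum>i<N. msq (slab (t i) (t (Suc i)) M) (\<lambda>(s, \<omega>). H i s \<omega>))"
proof -
  have m: "(\<lambda>p. ennreal ((norm ((\<lambda>(s, \<omega>). H i s \<omega>) p))\<^sup>2)) \<in> borel_measurable (slab (t i) (t (Suc i)) M)" if "i < N" for i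
    using L2_measurable[OF H[OF that]] by measurable
  note s = nn_integral_slab_Icc[OF m]
  have "(\<integral>\<^sup>+\<omega>. (\<Sum>i<N. \<integral>\<^sup>+s\<in>{t i..t (Suc i)}. ennreal ((norm (H i s \<omega>))\<^sup>2) \<partial>lborel) \<partial>M)
      = (\<Sum>i<N. \<integral>\<^sup>+\<omega>. (\<integral>\<^sup>+s\<in>{t i..t (Suc i)}. ennreal ((norm (H i s \<omega>))\<^sup>2) \<partial>lborel) \<partial>M)"
    using s(2) by (intro nn_integral_sum) auto
  also have "\<dots> = (\<Sum>i<N. ennreal (msq (slab (t i) (t (Suc i)) M) (\<lambda>(s, \<omega>). H i s \<omega>)))"
  proof (intro sum.cong refl)
    fix i assume "i \<in> {..<N}"
    then have i: "i < N" by simp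
    show "(\<integral>\<^sup>+\<omega>. (\<integral>\<^sup>+s\<in>{t i..t (Suc i)}. ennreal ((norm (H i s \<omega>))\<^sup>2) \<partial>lborel) \<partial>M)
        = ennreal (msq (slab (t i) (t (Suc i)) M) (\<lambda>(s, \<omega>). H i s \<omega>))"
      using s(1)[OF i] nn_integral_L2[OF H[OF i]] by simp
  qed
  also have "\<dots> = ennreal (\<Sum>i<N. msq (slab (t i) (t (Suc i)) M) (\<lambda>(s, \<omega>). H i s \<omega>))"
    by (rule sum_ennreal) simp
  finally show ?thesis .
qed

lemma terminal_error: "(\<integral>\<^sup>+\<omega>. ennreal (\<bar>g (\<X> T \<omega>) - g (X N \<omega>)\<bar>\<^sup>2) \<partial>M) = ennreal (err N)"
proof -
  have "(\<integral>\<^sup>+\<omega>. ennreal (\<bar>g (\<X> T \<omega>) - g (X N \<omega>)\<bar>\<^sup>2) \<partial>M) = (\<integral>\<^sup>+\<omega>. ennreal ((norm (Y (t N) \<omega> - U N \<omega>))\<^sup>2) \<partial>M)"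
  proof (rule nn_integral_cong_AE)
    show "AE \<omega> in M. ennreal (\<bar>g (\<X> T \<omega>) - g (X N \<omega>)\<bar>\<^sup>2) = ennreal ((norm (Y (t N) \<omega> - U N \<omega>))\<^sup>2)"
      using terminal_value by eventually_elim (simp add: t_N U_def U_hat_def)
  qed
  also have "\<dots> = ennreal (err N)"
    unfolding err_def using t_in by (intro nn_integral_L2 L2_diff Y_L2 U_L2) auto
  finally show ?thesis .
qed

lemma error_bound:
  "(MAX i\<in>{..<N}. \<integral>\<^sup>+\<omega>. ennreal (\<bar>Y (t i) \<omega> - U_hat \<rho> g N \<xi> i (X i \<omega>)\<bar>\<^sup>2) \<partial>M)
    + (\<integral>\<^sup>+\<omega>. (\<Sum>i<N. \<integral>\<^sup>+s\<in>{t i..t (Suc i)}. ennreal ((norm (Z s \<omega> - net_Z \<rho> (\<eta> i) (X i \<omega>)))\<^sup>2) \<partial>lborel) \<partial>M)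
    \<le> ennreal C\<^sub>0 *
       ((\<integral>\<^sup>+\<omega>. ennreal (\<bar>g (\<X> T \<omega>) - g (X N \<omega>)\<bar>\<^sup>2) \<partial>M) + ennreal h_max + eps_Z M F Z N t
        + (\<Sum>i<N. of_nat N * eps_v M \<rho> (net_params L :: ('d, 'm, 1) net_param set) X v i
                  + eps_z M \<rho> (net_params L :: ('d, 'm, 'd) net_param set) X z i))"
proof -
  let ?S = "err N + h_max + (\<Sum>i<N. Zreg i) + (\<Sum>i<N. N * \<epsilon>v i + \<epsilon>z i)"
  obtain B where B: "\<forall>i<N. err i \<le> B" "B + (\<Sum>i<N. Zerr i) \<le> C\<^sub>0 * ?S" using total_error by blast
  have nn: "0 \<le> err i" "0 \<le> Zreg i" "0 \<le> Zerr i" for i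
    by (simp_all add: err_def Zreg_def Zerr_def)
  have B0: "0 \<le> B" using B(1) N_pos nn(1)[of 0] by fastforce
  have Y: "(\<integral>\<^sup>+\<omega>. ennreal (\<bar>Y (t i) \<omega> - U_hat \<rho> g N \<xi> i (X i \<omega>)\<bar>\<^sup>2) \<partial>M) = ennreal (err i)" if "i < N" for i
  proof -
    have "L2 M (\<lambda>\<omega>. Y (t i) \<omega> - U i \<omega>)" using t_in that by (intro L2_diff Y_L2 U_L2) auto
    from nn_integral_L2[OF this] show ?thesis by (simp add: err_def U_def)
  qed
  have max: "(MAX i\<in>{..<N}. \<integral>\<^sup>+\<omega>. ennreal (\<bar>Y (t i) \<omega> - U_hat \<rho> g N \<xi> i (X i \<omega>)\<bar>\<^sup>2) \<partial>M) \<le> ennreal B"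
  proof (rule Max.boundedI)
    fix y assume "y \<in> (\<lambda>i. \<integral>\<^sup>+\<omega>. ennreal (\<bar>Y (t i) \<omega> - U_hat \<rho> g N \<xi> i (X i \<omega>)\<bar>\<^sup>2) \<partial>M) ` {..<N}"
    then obtain i where i: "i < N" and y: "y = (\<integral>\<^sup>+\<omega>. ennreal (\<bar>Y (t i) \<omega> - U_hat \<rho> g N \<xi> i (X i \<omega>)\<bar>\<^sup>2) \<partial>M)" by auto
    show "y \<le> ennreal B" unfolding y Y[OF i] using B(1) i by (intro ennreal_leI) simp
  qed (use N_pos in auto)
  have Zs: "(\<integral>\<^sup>+\<omega>. (\<Sum>i<N. \<integral>\<^sup>+s\<in>{t i..t (Suc i)}. ennreal ((norm (Z s \<omega> - net_Z \<rho> (\<eta> i) (X i \<omega>)))\<^sup>2) \<partial>lborel) \<partial>M)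
      = ennreal (\<Sum>i<N. Zerr i)"
    using nn_integral_slab_sum[of "\<lambda>i s \<omega>. Z s \<omega> - Q i \<omega>"] one_step(2) by (simp add: Zerr_def Q_def)
  have eZ: "eps_Z M F Z N t = ennreal (\<Sum>i<N. Zreg i)"
    unfolding eps_Z_def using nn_integral_slab_sum[of "\<lambda>i s \<omega>. Z s \<omega> - Z_bar M F Z t i \<omega>"] Zreg_L2 by (simp add: Zreg_def)
  have nets: "(\<Sum>i<N. of_nat N * eps_v M \<rho> (net_params L :: ('d, 'm, 1) net_param set) X v i
                  + eps_z M \<rho> (net_params L :: ('d, 'm, 'd) net_param set) X z i) = ennreal (\<Sum>i<N. N * \<epsilon>v i + \<epsilon>z i)"
  proof -
    have "(\<Sum>i<N. of_nat N * eps_v M \<rho> (net_params L :: ('d, 'm, 1) net_param set) X v i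
                  + eps_z M \<rho> (net_params L :: ('d, 'm, 'd) net_param set) X z i)
        = (\<Sum>i<N. ennreal (N * \<epsilon>v i + \<epsilon>z i))"
      using eps_nonneg
      by (intro sum.cong refl) (simp add: eps_finite ennreal_mult ennreal_of_nat_eq_real_of_nat)
    also have "\<dots> = ennreal (\<Sum>i<N. N * \<epsilon>v i + \<epsilon>z i)"
      using eps_nonneg by (intro sum_ennreal) simp
    finally show ?thesis .
  qed
  have S0: "0 \<le> (\<Sum>i<N. Zreg i)" "0 \<le> (\<Sum>i<N. N * \<epsilon>v i + \<epsilon>z i)" "0 \<le> (\<Sum>i<N. Zerr i)"
    using nn eps_nonneg by (auto intro!: sum_nonneg)
  have S0': "0 \<le> ?S" using S0 nn(1)[of N] h_max_pos by simp
  have "ennreal B + ennreal (\<Sum>i<N. Zerr i) = ennreal (B + (\<Sum>i<N. Zerr i))" using B0 S0 by simp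
  also have "\<dots> \<le> ennreal (C\<^sub>0 * ?S)" using B(2) by (rule ennreal_leI)
  also have "\<dots> = ennreal C\<^sub>0 * ennreal ?S" by (rule ennreal_mult''[OF S0'])
  also have "ennreal ?S = ennreal (err N) + ennreal h_max + ennreal (\<Sum>i<N. Zreg i) + ennreal (\<Sum>i<N. N * \<epsilon>v i + \<epsilon>z i)"
    using S0 nn(1)[of N] h_max_pos by (simp add: ennreal_plus)
  finally show ?thesis
    unfolding terminal_error eZ nets Zs using max by (meson add_right_mono order_trans)
qed

end

section \<open>The error estimate\<close>

theorem theorem4p1:
  fixes M :: "'a measure" and F :: "real \<Rightarrow> 'a measure" and W :: "real \<Rightarrow> 'a \<Rightarrow> real ^ 'd"
    and T c f_L :: real and x0 :: "real ^ 'd"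
    and \<mu> :: "real \<Rightarrow> real ^ 'd \<Rightarrow> real ^ 'd" and \<sigma> :: "real \<Rightarrow> real ^ 'd \<Rightarrow> real ^ 'd ^ 'd"
    and f :: "real \<Rightarrow> real ^ 'd \<Rightarrow> real \<Rightarrow> real ^ 'd \<Rightarrow> real" and g :: "real ^ 'd \<Rightarrow> real"
    and \<X> :: "real \<Rightarrow> 'a \<Rightarrow> real ^ 'd" and Y :: "real \<Rightarrow> 'a \<Rightarrow> real" and Z :: "real \<Rightarrow> 'a \<Rightarrow> real ^ 'd"
    and \<rho> :: "real \<Rightarrow> real" and L :: nat
  assumes "T > 0"
    and "prob_space M" and "usual_filtration T M F" and "brownian_motion T M F W"
    and "lipschitz_coefficients T \<mu> \<sigma>"
    and "sde_solution T M F W x0 \<mu> \<sigma> \<X>" and "moment_bounds T M x0 \<X>"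
    and "euler_estimate T c M W x0 \<mu> \<sigma> \<X>"
    and "f_L > 0"
    and "\<And>t1 t2 x1 x2 y1 y2 z1 z2. t1 \<in> {0..T} \<Longrightarrow> t2 \<in> {0..T} \<Longrightarrow>
           \<bar>f t2 x2 y2 z2 - f t1 x1 y1 z1\<bar>
             \<le> f_L * (sqrt \<bar>t2 - t1\<bar> + norm (x2 - x1) + \<bar>y2 - y1\<bar> + norm (z2 - z1))"
    and "bdd_above ((\<lambda>t. \<bar>f t 0 0 0\<bar>) ` {0..T})"
    and "g \<in> borel_measurable borel" and "\<exists>K. \<forall>x. \<bar>g x\<bar> \<le> K * (1 + norm x)"
    and "bsde_solution T M F W f g \<X> Y Z"
    and "\<rho> \<in> borel_measurable borel" and "\<not> linear \<rho>" and "L \<ge> 2"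
  shows "\<exists>C>0. \<exists>\<delta>>0. \<forall>N t.
           time_grid T c N t \<and> mesh N t \<le> \<delta> \<longrightarrow>
           (let X = euler \<mu> \<sigma> x0 W t in
            \<forall>(\<xi> :: nat \<Rightarrow> ('d, 'm::finite, 1) net_param) (\<eta> :: nat \<Rightarrow> ('d, 'm, 'd) net_param) v z.
              dbdp1_scheme M W f g \<rho> L N t X \<xi> \<eta> \<and>
              dbdp1_targets M F W f N t X (U_hat \<rho> g N \<xi>) v z \<longrightarrow>
              (MAX i\<in>{..<N}. \<integral>\<^sup>+\<omega>. ennreal (\<bar>Y (t i) \<omega> - U_hat \<rho> g N \<xi> i (X i \<omega>)\<bar>\<^sup>2) \<partial>M)
              + (\<integral>\<^sup>+\<omega>. (\<Sum>i<N. \<integral>\<^sup>+s\<in>{t i..t (Suc i)}.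
                    ennreal ((norm (Z s \<omega> - net_Z \<rho> (\<eta> i) (X i \<omega>)))\<^sup>2) \<partial>lborel) \<partial>M)
              \<le> ennreal C *
                 ((\<integral>\<^sup>+\<omega>. ennreal (\<bar>g (\<X> T \<omega>) - g (X N \<omega>)\<bar>\<^sup>2) \<partial>M)
                  + ennreal (mesh N t) + eps_Z M F Z N t
                  + (\<Sum>i<N. of_nat N * eps_v M \<rho> (net_params L :: ('d, 'm, 1) net_param set) X v i
                            + eps_z M \<rho> (net_params L :: ('d, 'm, 'd) net_param set) X z i)))"
proof -
  note T = \<open>T > 0\<close> and f_L = \<open>f_L > 0\<close> and lip = assms(10)
  interpret prob_space M by fact
  have \<X>_prog: "progressive T F \<X>" using assms(6) by (simp add: sde_solution_def)
  obtain Cm where Cm: "(\<integral>\<^sup>+\<omega>. (\<Squnion>t\<in>{0..T}. ennreal (norm (\<X> t \<omega>) powr 2)) \<partial>M) \<le> ennreal (Cm * (1 + norm x0 powr 2))"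
    using assms(7) unfolding moment_bounds_def by (metis one_less_numeral_iff semiring_norm(76))
  define BX where "BX = max 0 (Cm * (1 + norm x0 powr 2))"
  have bm: "brownian_space M T F W"
  proof (unfold_locales)
    show "0 < T" by fact
    show "subalgebra M (F t)" if "t \<in> {0..T}" for t using assms(3) that by (simp add: usual_filtration_def)
    show "sets (F s) \<subseteq> sets (F t)" if "0 \<le> s" "s \<le> t" "t \<le> T" for s t
      using assms(3) that unfolding usual_filtration_def by blast
    show "adapted T F W" using assms(4) by (simp add: brownian_motion_def)
    fix s t :: real assume st: "0 \<le> s" "s < t" "t \<le> T"
    show "indep_set (sets (F s)) (sets (vimage_algebra (space M) (\<lambda>\<omega>. W t \<omega> - W s \<omega>) borel))"
      using assms(4) st unfolding brownian_motion_def by blast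
    show "distributed M lborel (\<lambda>\<omega>. W t \<omega> - W s \<omega>)
          (\<lambda>x. ennreal (\<Prod>j\<in>UNIV. normal_density 0 (sqrt (t - s)) (x $ j)))"
      using assms(4) st unfolding brownian_motion_def by blast
  qed
  interpret brownian_space M T F W by (rule bm)
  have moment: "(\<integral>\<^sup>+\<omega>. ennreal ((norm (\<X> t \<omega>))\<^sup>2) \<partial>M) \<le> ennreal BX" if "t \<in> {0..T}" for t
  proof -
    have "(\<integral>\<^sup>+\<omega>. ennreal ((norm (\<X> t \<omega>))\<^sup>2) \<partial>M) \<le> (\<integral>\<^sup>+\<omega>. (\<Squnion>t\<in>{0..T}. ennreal (norm (\<X> t \<omega>) powr 2)) \<partial>M)"
    proof (rule nn_integral_mono)
      fix \<omega>
      show "ennreal ((norm (\<X> t \<omega>))\<^sup>2) \<le> (\<Squnion>t\<in>{0..T}. ennreal (norm (\<X> t \<omega>) powr 2))"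
        using that by (intro SUP_upper2[of t]) (auto simp: powr_numeral)
    qed
    also have "\<dots> \<le> ennreal BX" using Cm by (rule order_trans) (simp add: BX_def ennreal_leI)
    finally show ?thesis .
  qed
  have bs: "bsde_space M T F W f g f_L \<X> Y Z BX"
    by (unfold_locales) (use f_L lip \<X>_prog moment assms(14) in \<open>auto simp: BX_def\<close>)
  interpret bsde_space M T F W f g f_L \<X> Y Z BX by (rule bs)
  obtain K0 \<delta>0 where \<delta>0: "0 < \<delta>0" and euler: "\<And>N t. time_grid T c N t \<Longrightarrow> mesh N t \<le> \<delta>0 \<Longrightarrow>
        (MAX i\<in>{..<N}. \<integral>\<^sup>+\<omega>.
             ennreal ((norm (\<X> (t (Suc i)) \<omega> - euler \<mu> \<sigma> x0 W t (Suc i) \<omega>))\<^sup>2)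
           + (\<Squnion>s\<in>{t i..t (Suc i)}. ennreal ((norm (\<X> s \<omega> - euler \<mu> \<sigma> x0 W t i \<omega>))\<^sup>2)) \<partial>M)
        \<le> ennreal (K0 * mesh N t)"
    using assms(8) unfolding euler_estimate_def by blast
  define K where "K = max 0 K0"
  define \<delta> where "\<delta> = min \<delta>0 (min 1 (1 / (32 * f_L\<^sup>2)))"
  have \<delta>: "0 < \<delta>" "\<delta> \<le> \<delta>0" "\<delta> \<le> 1" "32 * f_L\<^sup>2 * \<delta> \<le> 1"
  proof -
    show "0 < \<delta>" "\<delta> \<le> \<delta>0" "\<delta> \<le> 1" using \<delta>0 f_L by (auto simp: \<delta>_def)
    have "\<delta> \<le> 1 / (32 * f_L\<^sup>2)" by (simp add: \<delta>_def)
    then show "32 * f_L\<^sup>2 * \<delta> \<le> 1" using f_L by (simp add: pos_le_divide_eq mult.commute)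
  qed
  \<comment> \<open>The constant \<open>C\<^sub>0\<close> of the grid estimate, written out before a grid is chosen; the maximum makes it positive.\<close>
  define C where "C = max 1 (17 * exp (1 + (1 + 32 * f_L\<^sup>2) * T)
      * (21 + 4 * (T + T * K + 2 * msq (slab 0 T M) (\<lambda>(s, \<omega>). driver s \<omega>) + msq (slab 0 T M) (\<lambda>(s, \<omega>). Z s \<omega>)) + 16 * c)
      + 20 + 8 * msq (slab 0 T M) (\<lambda>(s, \<omega>). driver s \<omega>))"
  show ?thesis
    unfolding Let_def
  proof (rule exI[of _ C], rule conjI, goal_cases)
    case 1
    show "0 < C" by (simp add: C_def)
  next
    case 2
    show ?case
    proof (rule exI[of _ \<delta>], rule conjI[OF \<delta>(1)], intro allI impI)
    fix N :: nat and t :: "nat \<Rightarrow> real"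
      and \<xi> :: "nat \<Rightarrow> ('d, 'm::finite, 1) net_param" and \<eta> :: "nat \<Rightarrow> ('d, 'm, 'd) net_param"
      and v :: "nat \<Rightarrow> real ^ 'd \<Rightarrow> real" and z :: "nat \<Rightarrow> real ^ 'd \<Rightarrow> real ^ 'd"
    assume grid: "time_grid T c N t \<and> mesh N t \<le> \<delta>"
    let ?X = "euler \<mu> \<sigma> x0 W t"
    assume nets: "dbdp1_scheme M W f g \<rho> L N t ?X \<xi> \<eta> \<and>
        dbdp1_targets M F W f N t ?X (U_hat \<rho> g N \<xi>) v z"
    have g0: "t 0 = 0" "t N = T" "\<And>i. i < N \<Longrightarrow> t i < t (Suc i)" "real N * mesh N t \<le> c"
      using grid by (auto simp: time_grid_def)
    have N: "0 < N"
    proof (rule ccontr)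
      assume "\<not> 0 < N"
      then show False using g0(1,2) T by simp
    qed
    have h_le: "t (Suc i) - t i \<le> mesh N t" if "i < N" for i
      unfolding mesh_def using that by (intro Max_ge) auto
    note t_mono = grid_mono[of N t, OF g0(3)]
    have t_in: "t i \<in> {0..T}" if "i \<le> N" for i using t_mono[of 0 i] t_mono[of i N] that g0 by simp
    have mesh0: "0 < mesh N t" using h_le[OF N] g0(3)[OF N] by linarith
    have eul: "(\<integral>\<^sup>+\<omega>. ennreal ((norm (\<X> (t (Suc i)) \<omega> - ?X (Suc i) \<omega>))\<^sup>2)
           + (\<Squnion>s\<in>{t i..t (Suc i)}. ennreal ((norm (\<X> s \<omega> - ?X i \<omega>))\<^sup>2)) \<partial>M) \<le> ennreal (K * mesh N t)" if i: "i < N" for i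
    proof -
      have "(\<integral>\<^sup>+\<omega>. ennreal ((norm (\<X> (t (Suc i)) \<omega> - ?X (Suc i) \<omega>))\<^sup>2)
           + (\<Squnion>s\<in>{t i..t (Suc i)}. ennreal ((norm (\<X> s \<omega> - ?X i \<omega>))\<^sup>2)) \<partial>M)
          \<le> (MAX i\<in>{..<N}. \<integral>\<^sup>+\<omega>. ennreal ((norm (\<X> (t (Suc i)) \<omega> - ?X (Suc i) \<omega>))\<^sup>2)
           + (\<Squnion>s\<in>{t i..t (Suc i)}. ennreal ((norm (\<X> s \<omega> - ?X i \<omega>))\<^sup>2)) \<partial>M)"
        using i by (intro Max_ge) auto
      also have "\<dots> \<le> ennreal (K0 * mesh N t)" using grid \<delta>(2) by (intro euler) auto
      also have "\<dots> \<le> ennreal (K * mesh N t)"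
        using mesh0 by (intro ennreal_leI mult_right_mono) (auto simp: K_def)
      finally show ?thesis .
    qed
    have X_F: "?X i \<in> borel_measurable (F (t i))" if "i \<le> N" for i
      by (rule euler_F[OF assms(5) t_mono _ _ that]) (use g0 in auto)
    have X_L2: "L2 M (?X i)" if "i \<le> N" for i
    proof (cases i)
      case 0
      then have "?X i = (\<lambda>\<omega>. x0)" by auto
      then show ?thesis by (simp add: L2_const finite_measure_axioms)
    next
      case (Suc j)
      have Xm: "?X i \<in> borel_measurable M" using F_borel_M[OF t_in X_F] that by simp
      have \<X>L: "L2 M (\<X> (t i))" using \<X>_L2 t_in that by simp
      have "(\<integral>\<^sup>+\<omega>. ennreal ((norm (\<X> (t i) \<omega> - ?X i \<omega>))\<^sup>2) \<partial>M)
          \<le> (\<integral>\<^sup>+\<omega>. ennreal ((norm (\<X> (t (Suc j)) \<omega> - ?X (Suc j) \<omega>))\<^sup>2)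
           + (\<Squnion>s\<in>{t j..t (Suc j)}. ennreal ((norm (\<X> s \<omega> - ?X j \<omega>))\<^sup>2)) \<partial>M)"
        unfolding Suc by (rule nn_integral_mono) simp
      also have "\<dots> < \<infinity>" using le_less_trans[OF eul[of j]] that Suc by simp
      finally have d: "L2 M (\<lambda>\<omega>. \<X> (t i) \<omega> - ?X i \<omega>)"
        using L2_measurable[OF \<X>L] Xm by (subst L2_iff_nn_integral) auto
      from L2_diff[OF \<X>L d] show ?thesis by simp
    qed
    have X_close: "(\<integral>\<^sup>+\<omega>. ennreal ((norm (\<X> s \<omega> - ?X i \<omega>))\<^sup>2) \<partial>M) \<le> ennreal (K * mesh N t)"
      if i: "i < N" and s: "s \<in> {t i<..t (Suc i)}" for i s
    proof -
      have "(\<integral>\<^sup>+\<omega>. ennreal ((norm (\<X> s \<omega> - ?X i \<omega>))\<^sup>2) \<partial>M)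
          \<le> (\<integral>\<^sup>+\<omega>. ennreal ((norm (\<X> (t (Suc i)) \<omega> - ?X (Suc i) \<omega>))\<^sup>2)
           + (\<Squnion>s\<in>{t i..t (Suc i)}. ennreal ((norm (\<X> s \<omega> - ?X i \<omega>))\<^sup>2)) \<partial>M)"
      proof (rule nn_integral_mono)
        fix \<omega>
        have "ennreal ((norm (\<X> s \<omega> - ?X i \<omega>))\<^sup>2) \<le> (\<Squnion>s\<in>{t i..t (Suc i)}. ennreal ((norm (\<X> s \<omega> - ?X i \<omega>))\<^sup>2))"
          using s by (intro SUP_upper) auto
        then show "ennreal ((norm (\<X> s \<omega> - ?X i \<omega>))\<^sup>2) \<le> ennreal ((norm (\<X> (t (Suc i)) \<omega> - ?X (Suc i) \<omega>))\<^sup>2)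
           + (\<Squnion>s\<in>{t i..t (Suc i)}. ennreal ((norm (\<X> s \<omega> - ?X i \<omega>))\<^sup>2))"
          by (rule order_trans) simp
      qed
      also have "\<dots> \<le> ennreal (K * mesh N t)" by (rule eul[OF i])
      finally show ?thesis .
    qed
    have sm: "mesh N t \<le> 1" "32 * f_L\<^sup>2 * mesh N t \<le> 1"
    proof -
      show "mesh N t \<le> 1" using grid \<delta>(3) by simp
      have "32 * f_L\<^sup>2 * mesh N t \<le> 32 * f_L\<^sup>2 * \<delta>" using grid by (intro mult_left_mono) auto
      then show "32 * f_L\<^sup>2 * mesh N t \<le> 1" using \<delta>(4) by linarith
    qed
    interpret dbdp_space M T F W f g f_L \<X> Y Z BX N t ?X "mesh N t" K c \<rho> L \<xi> \<eta> v z
      by (unfold_locales)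
         (use N g0 h_le sm X_F X_L2 X_close assms(12,13,15) nets in \<open>auto simp: K_def\<close>)
    have "C\<^sub>0 \<le> C" by (simp add: C\<^sub>0_def C_def A\<^sub>0_def B\<^sub>0_def \<Phi>_def)
    then have "ennreal C\<^sub>0 \<le> ennreal C" by (rule ennreal_leI)
    from order_trans[OF error_bound mult_right_mono[OF this]]
    show "(MAX i\<in>{..<N}. \<integral>\<^sup>+\<omega>. ennreal (\<bar>Y (t i) \<omega> - U_hat \<rho> g N \<xi> i (?X i \<omega>)\<bar>\<^sup>2) \<partial>M)
              + (\<integral>\<^sup>+\<omega>. (\<Sum>i<N. \<integral>\<^sup>+s\<in>{t i..t (Suc i)}.
                    ennreal ((norm (Z s \<omega> - net_Z \<rho> (\<eta> i) (?X i \<omega>)))\<^sup>2) \<partial>lborel) \<partial>M)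
              \<le> ennreal C *
                 ((\<integral>\<^sup>+\<omega>. ennreal (\<bar>g (\<X> T \<omega>) - g (?X N \<omega>)\<bar>\<^sup>2) \<partial>M)
                  + ennreal (mesh N t) + eps_Z M F Z N t
                  + (\<Sum>i<N. of_nat N * eps_v M \<rho> (net_params L :: ('d, 'm, 1) net_param set) ?X v i
                            + eps_z M \<rho> (net_params L :: ('d, 'm, 'd) net_param set) ?X z i))"
      by simp
    qed
  qed
qed

end
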